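(* Let $\Omega\subset\mathbb{R}^2$ be a domain and let $K\subset\Omega$ be a subset with $\mathcal{H}^2(K)=0$. Let $\theta\in C^0(\Omega\setminus K)$ be a weak solution to $$(\cos\theta)_x+(\sin\theta)_y=H$$ with $H\in C^1(\Omega)$. Then: (a) the set of nondegenerate crack points consists of $C^1$ smooth curves; (b) the two characteristic curves issuing from a nondegenerate crack point $p_0$ have the same angle with the tangent line of the curve of nondegenerate crack points through $p_0$.
   Context: $\mathcal{H}^2$ is 2-dimensional Hausdorff measure. Write $N=(\cos\theta,\sin\theta)$, $N^\perp=(\sin\theta,-\cos\theta)$ on $\Omega\setminus K$. $\theta$ is a weak solution of $(\cos\theta)_x+(\sin\theta)_y=H$ if $\int_\Omega N\cdot\nabla\varphi+\int_\Omega H\varphi=0$ for all $\varphi\in C_0^\infty(\Omega)$. Characteristic curves are integral curves of $N^\perp$; seed curves are integral curves of $N$. Crack point: $p\in K$ is a crack point if (i) there is an open neighborhood $U\subset\Omega$ of $p$ such that $U\cap K$ is a $C^0$ curve dividing $U$ into two connected regions $U^+,U^-$; (ii) $N_\pm(p)$ exists as the limit of $N(q)$ as $q\in U^\pm$, $q\to p$, respectively, and $N_+(p)\ne N_-(p)$. Nondegenerate point: Let $p\in K$ and suppose: (i) there is an open neighborhood $U\subset\Omega$ of $p$ such that $U\cap K$ is a $C^0$ curve $\gamma$ through $p$ dividing $U$ into two connected regions $U^+$ and $U^-$; (ii) for any $q\in\gamma$ there are exactly two characteristic curves $\Gamma_q^+,\Gamma_q^-$ issuing from $q$, with $\Gamma_q^\pm\subset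 U^\pm$. Take $q^\pm\in\Gamma_q^\pm\setminus\{q\}$ and a seed curve $\gamma_\pm$ through $q^\pm$ each point of which emits a characteristic curve in $U^\pm$ hitting $\gamma$ (in a neighborhood of $p$). Parametrize $\gamma_\pm$ by arc length $\tau^\pm$ in an open interval containing $\tau_0^\pm$ (so $\partial/\partial\tau^\pm=\pm N$ up to choice of sign), and let $X_\pm(\tau^\pm)\in\gamma$ be the point where the characteristic curve from $\gamma_\pm(\tau^\pm)$ hits $\gamma$; assume $X_+(\tau_0^+)=X_-(\tau_0^-)=:p_0$. Let $(x_\pm,y_\pm,\theta_\pm)(\sigma,\tau^\pm)$ solve $$\frac{dx}{d\sigma}=\sin\theta,\quad \frac{dy}{d\sigma}=-\cos\theta,\quad \frac{d\theta}{d\sigma}=-H(x,y)$$ with $(x_\pm,y_\pm)(0,\tau^\pm)=\gamma_\pm(\tau^\pm)$, $\theta_\pm(0,\tau^\pm)=\theta(\gamma_\pm(\tau^\pm))$, let $P_\pm=(x_\pm,y_\pm)$, and write $X_\pm(\tau^\pm)=P_\pm(\sigma_\pm(\tau^\pm),\tau^\pm)$ with $\sigma_\pm$ continuous. The point $p_0$ is nondegenerate if, for both signs, $$\det\frac{\partial(x_\pm,y_\pm)}{\partial(\sigma,\tau^\pm)}\ne0\quad\text{at }(\sigma_\pm(\tau_0^\pm),\tau_0^\pm).$$ This does not depend on the choice of seed curves. A nondegenerate crack point is a crack point which is nondegenerate.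
   Formalization: In the definition of a nondegenerate point, the map (x±,y±)(σ,τ±) is required to be C¹ near (σ±(τ0±),τ0±), not merely differentiable there; for θ only continuous the Jacobian may fail to exist on a dense set of crack points and (a) would fail. *)

theory Defs
  imports "HOL-Analysis.Analysis"
begin

type_synonym plane = "real \<times> real"

text \<open>The exponent must be positive: since \<open>0 powr 0 = 0\<close>, the case \<open>s = 0\<close> is not counting
  measure.  Boundedness of the covering sets is required because \<open>diameter\<close> is unspecified on
  unbounded sets.\<close>

definition hausdorff_measure :: "real \<Rightarrow> 'a::metric_space set \<Rightarrow> ennreal" where
  "hausdorff_measure s A =
     (SUP \<delta>\<in>{0::real<..}.
        INF C\<in>{C :: nat \<Rightarrow> 'a set.
                 A \<subseteq> (\<Union>i. C i) \<and> (\<forall>i. bounded (C i) \<and> diameter (C i) \<le> \<delta>)}.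
          (\<Sum>i. ennreal (unit_ball_vol s * (diameter (C i) / 2) powr s)))"

text \<open>\<open>Ck_on k f S\<close>, for open \<open>S\<close>: the function \<open>f\<close> is of class \<open>C^k\<close> on \<open>S\<close>;
  \<open>fx\<close> and \<open>fy\<close> are its partial derivatives.\<close>

primrec Ck_on :: "nat \<Rightarrow> (plane \<Rightarrow> real) \<Rightarrow> plane set \<Rightarrow> bool" where
  "Ck_on 0 f S \<longleftrightarrow> continuous_on S f"
| "Ck_on (Suc k) f S \<longleftrightarrow>
     (\<exists>fx fy. (\<forall>z\<in>S. (f has_derivative (\<lambda>h. fst h * fx z + snd h * fy z)) (at z)) \<and>
              Ck_on k fx S \<and> Ck_on k fy S)"

definition test_function :: "plane set \<Rightarrow> (plane \<Rightarrow> real) \<Rightarrow> bool" where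
  "test_function \<Omega> \<phi> \<longleftrightarrow>
     (\<forall>k. Ck_on k \<phi> UNIV) \<and>
     compact (closure {z. \<phi> z \<noteq> 0}) \<and> closure {z. \<phi> z \<noteq> 0} \<subseteq> \<Omega>"

definition Nvec :: "real \<Rightarrow> plane" where
  "Nvec t = (cos t, sin t)"

definition Nperp :: "real \<Rightarrow> plane" where
  "Nperp t = (sin t, - cos t)"

text \<open>\<open>N \<sqdot> \<nabla>\<phi>\<close> is written as the Frechet derivative of \<open>\<phi>\<close> applied to \<open>N\<close>.  The values of \<open>\<theta>\<close> on
  the null set where it is not continuous do not matter, as the integrals are taken with respect to
  the completed measure \<open>lebesgue\<close>.\<close>

definition weak_solution :: "plane set \<Rightarrow> (plane \<Rightarrow> real) \<Rightarrow> (plane \<Rightarrow> real) \<Rightarrow> bool" where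
  "weak_solution \<Omega> H \<theta> \<longleftrightarrow>
     (\<forall>\<phi>. test_function \<Omega> \<phi> \<longrightarrow>
        (LINT z:\<Omega>|lebesgue. frechet_derivative \<phi> (at z) (Nvec (\<theta> z))) +
        (LINT z:\<Omega>|lebesgue. H z * \<phi> z) = 0)"

text \<open>\<open>U \<inter> K\<close> is a \<open>C^0\<close> curve through \<open>p\<close> dividing \<open>U\<close> into the regions \<open>Up\<close> and \<open>Um\<close>.  Dividing
  includes that both regions are adjacent to the curve; this excludes, for instance, a slit in one
  component of a disconnected \<open>U\<close>.\<close>

definition divides_at ::
  "plane set \<Rightarrow> plane set \<Rightarrow> plane \<Rightarrow> plane set \<Rightarrow> plane set \<Rightarrow> plane set \<Rightarrow> bool" where
  "divides_at \<Omega> K p U Up Um \<longleftrightarrow>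
     open U \<and> U \<subseteq> \<Omega> \<and> p \<in> U \<inter> K \<and>
     (U \<inter> K) homeomorphic {0<..<1::real} \<and>
     open Up \<and> connected Up \<and> Up \<noteq> {} \<and>
     open Um \<and> connected Um \<and> Um \<noteq> {} \<and>
     Up \<inter> Um = {} \<and> U - K = Up \<union> Um \<and>
     U \<inter> K \<subseteq> frontier Up \<and> U \<inter> K \<subseteq> frontier Um"

definition crack_point :: "plane set \<Rightarrow> plane set \<Rightarrow> (plane \<Rightarrow> real) \<Rightarrow> plane \<Rightarrow> bool" where
  "crack_point \<Omega> K \<theta> p \<longleftrightarrow>
     (\<exists>U Up Um Np Nm.
        divides_at \<Omega> K p U Up Um \<and>
        ((\<lambda>q. Nvec (\<theta> q)) \<longlongrightarrow> Np) (at p within Up) \<and>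
        ((\<lambda>q. Nvec (\<theta> q)) \<longlongrightarrow> Nm) (at p within Um) \<and>
        Np \<noteq> Nm)"

text \<open>The curve \<open>c\<close>, on the parameter interval \<open>[0, e)\<close>, is a characteristic curve issuing from \<open>q\<close>
  into \<open>S\<close>.  The sign \<open>s\<close> is there because, parametrized away from \<open>q\<close>, the curve may be run along
  in the direction of either \<open>N\<^sup>\<bottom>\<close> or its negative.\<close>

definition char_issuing ::
  "(plane \<Rightarrow> real) \<Rightarrow> plane set \<Rightarrow> plane \<Rightarrow> (real \<Rightarrow> plane) \<Rightarrow> real \<Rightarrow> bool" where
  "char_issuing \<theta> S q c e \<longleftrightarrow>
     0 < e \<and> c 0 = q \<and> continuous_on {0..<e} c \<and>
     (\<forall>t\<in>{0<..<e}. c t \<in> S) \<and>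
     (\<exists>s\<in>{-1, 1::real}. \<forall>t\<in>{0<..<e}.
        (c has_vector_derivative s *\<^sub>R Nperp (\<theta> (c t))) (at t))"

text \<open>Uniqueness is up to the length of the parameter interval.\<close>

definition unique_char_issuing :: "(plane \<Rightarrow> real) \<Rightarrow> plane set \<Rightarrow> plane \<Rightarrow> bool" where
  "unique_char_issuing \<theta> S q \<longleftrightarrow>
     (\<exists>c e. char_issuing \<theta> S q c e) \<and>
     (\<forall>c e c' e'. char_issuing \<theta> S q c e \<longrightarrow> char_issuing \<theta> S q c' e' \<longrightarrow>
        (\<forall>t\<in>{0..<min e e'}. c t = c' t))"

text \<open>A characteristic curve in \<open>U - K\<close> issuing from a point of \<open>U \<inter> K\<close> is connected, so it runs in
  exactly one of \<open>Up\<close>, \<open>Um\<close>; thus there being exactly two, one on each side, is uniqueness on each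
  side.\<close>

definition two_chars_at ::
  "plane set \<Rightarrow> plane set \<Rightarrow> (plane \<Rightarrow> real) \<Rightarrow> plane \<Rightarrow>
   plane set \<Rightarrow> plane set \<Rightarrow> plane set \<Rightarrow> bool" where
  "two_chars_at \<Omega> K \<theta> p U Up Um \<longleftrightarrow>
     divides_at \<Omega> K p U Up Um \<and>
     (\<forall>q\<in>U \<inter> K. unique_char_issuing \<theta> Up q \<and> unique_char_issuing \<theta> Um q)"

definition jacobian_det :: "(plane \<Rightarrow> plane) \<Rightarrow> plane \<Rightarrow> real" where
  "jacobian_det P z =
     (let u = frechet_derivative P (at z) (1, 0); v = frechet_derivative P (at z) (0, 1)
      in fst u * snd v - fst v * snd u)"

text \<open>The seed curve \<open>g\<close> runs in the side \<open>S\<close> of the curve \<open>\<gamma>\<close> and has parameter interval \<open>(a, b)\<close>.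
  The solution \<open>(P, \<Theta>)\<close> of the characteristic system lives on an open set \<open>D\<close> of pairs \<open>(\<sigma>, \<tau>)\<close>;
  it continues past \<open>\<gamma>\<close>, since the system involves only \<open>H\<close>.  Up to the hitting time \<open>\<sigma>h \<tau>\<close>, which
  may be negative, the curve \<open>P (\<cdot>, \<tau>)\<close> is the characteristic curve emitted from \<open>g \<tau>\<close>.  The Jacobian
  determinant is understood for a map that is continuously differentiable near the point in
  question.\<close>

definition nondegenerate_side ::
  "plane set \<Rightarrow> (plane \<Rightarrow> real) \<Rightarrow> (plane \<Rightarrow> real) \<Rightarrow> plane set \<Rightarrow> plane set \<Rightarrow> plane \<Rightarrow> bool" where
  "nondegenerate_side \<Omega> H \<theta> S \<gamma> p0 \<longleftrightarrow>
     (\<exists>(g :: real \<Rightarrow> plane) a b \<tau>0 s D (P :: plane \<Rightarrow> plane) (\<Theta> :: plane \<Rightarrow> real) (\<sigma>h :: real \<Rightarrow> real).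
        \<tau>0 \<in> {a<..<b} \<and> s \<in> {-1, 1::real} \<and>
        (\<forall>\<tau>\<in>{a<..<b}. g \<tau> \<in> S \<and> (g has_vector_derivative s *\<^sub>R Nvec (\<theta> (g \<tau>))) (at \<tau>)) \<and>
        open D \<and> D \<subseteq> UNIV \<times> {a<..<b} \<and>
        (\<forall>\<tau>\<in>{a<..<b}. is_interval {\<sigma>. (\<sigma>, \<tau>) \<in> D} \<and> (0, \<tau>) \<in> D \<and> (\<sigma>h \<tau>, \<tau>) \<in> D) \<and>
        (\<forall>\<sigma> \<tau>. (\<sigma>, \<tau>) \<in> D \<longrightarrow>
           P (\<sigma>, \<tau>) \<in> \<Omega> \<and>
           ((\<lambda>r. P (r, \<tau>)) has_vector_derivative Nperp (\<Theta> (\<sigma>, \<tau>))) (at \<sigma>) \<and>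
           ((\<lambda>r. \<Theta> (r, \<tau>)) has_real_derivative - H (P (\<sigma>, \<tau>))) (at \<sigma>)) \<and>
        (\<forall>\<tau>\<in>{a<..<b}. P (0, \<tau>) = g \<tau> \<and> \<Theta> (0, \<tau>) = \<theta> (g \<tau>)) \<and>
        continuous_on {a<..<b} \<sigma>h \<and>
        (\<forall>\<tau>\<in>{a<..<b}.
           P (\<sigma>h \<tau>, \<tau>) \<in> \<gamma> \<and>
           (\<forall>\<sigma>\<in>open_segment 0 (\<sigma>h \<tau>).
              P (\<sigma>, \<tau>) \<in> S \<and>
              ((\<lambda>r. P (r, \<tau>)) has_vector_derivative Nperp (\<theta> (P (\<sigma>, \<tau>)))) (at \<sigma>))) \<and>
        P (\<sigma>h \<tau>0, \<tau>0) = p0 \<and>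
        (\<exists>W. open W \<and> (\<sigma>h \<tau>0, \<tau>0) \<in> W \<and> W \<subseteq> D \<and>
             Ck_on 1 (\<lambda>z. fst (P z)) W \<and> Ck_on 1 (\<lambda>z. snd (P z)) W) \<and>
        jacobian_det P (\<sigma>h \<tau>0, \<tau>0) \<noteq> 0)"

definition nondegenerate_point ::
  "plane set \<Rightarrow> plane set \<Rightarrow> (plane \<Rightarrow> real) \<Rightarrow> (plane \<Rightarrow> real) \<Rightarrow> plane \<Rightarrow> bool" where
  "nondegenerate_point \<Omega> K H \<theta> p \<longleftrightarrow>
     (\<exists>U Up Um. two_chars_at \<Omega> K \<theta> p U Up Um \<and>
        nondegenerate_side \<Omega> H \<theta> Up (U \<inter> K) p \<and>
        nondegenerate_side \<Omega> H \<theta> Um (U \<inter> K) p)"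

definition nondegenerate_crack_points ::
  "plane set \<Rightarrow> plane set \<Rightarrow> (plane \<Rightarrow> real) \<Rightarrow> (plane \<Rightarrow> real) \<Rightarrow> plane set" where
  "nondegenerate_crack_points \<Omega> K H \<theta> =
     {p \<in> K. crack_point \<Omega> K \<theta> p \<and> nondegenerate_point \<Omega> K H \<theta> p}"

text \<open>\<open>g\<close> is a regular \<open>C^1\<close> parametrization of the embedded curve \<open>C\<close>.\<close>

definition C1_curve_param :: "plane set \<Rightarrow> (real \<Rightarrow> plane) \<Rightarrow> real \<Rightarrow> real \<Rightarrow> bool" where
  "C1_curve_param C g a b \<longleftrightarrow>
     g C1_differentiable_on {a<..<b} \<and>
     (\<forall>t\<in>{a<..<b}. vector_derivative g (at t) \<noteq> 0) \<and>
     (\<exists>h. homeomorphism {a<..<b} C g h)"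

definition vec_angle :: "plane \<Rightarrow> plane \<Rightarrow> real" where
  "vec_angle v w = arccos (inner v w / (norm v * norm w))"

end

(* The characteristic system only involves H, so its solutions continue past the crack; by
   nondegeneracy they form a chart, which extends the field N from either side to a C^1 unit field with
   divergence H on a full neighbourhood of p.  The difference W of the two extensions is classically
   divergence free, so it is the rotated gradient of a potential F, and W(p) is nonzero because N
   jumps.  Subtracting the classical equation of one extension from the weak equation shows that W
   is weakly divergence free on one side of the crack alone; testing with functions of F and of a
   transversal linear coordinate shows that no level curve of F meets both sides.  Hence the crack
   is locally a regular level curve of F, with tangent parallel to the jump of N.  Since both
   one-sided values of N are unit vectors, the jump being tangential forces equal angles. *)
theory Submission
  imports Defs "HOL-Computational_Algebra.Polynomial"
begin

section \<open>Continuously differentiable functions on the plane\<close>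

text \<open>Two obstacles shape the proof. The crack is only a \<open>C^0\<close> curve and \<theta>
  only continuous off it, so there is no Gauss-Green formula on either side; every integration by
  parts is done on a full box with a field extended across the crack. And nothing is known about how
  the angle \<open>\<Theta>\<close> depends on the seed parameter, so the regularity of the extended
  field has to be extracted from the flow map \<open>P\<close> alone. The test functions made from
  the potential are only \<open>C^1\<close>, whereas the weak equation is posed for smooth ones;
  this is what mollification is for. For (a), the points of the crack near \<open>p\<close> must be
  shown to be nondegenerate crack points themselves: jump and Jacobian persist. For (b), the sides
  and the parametrization are arbitrary, so they are compared locally with the sublevel and
  superlevel sets of the potential; and tangency of the jump alone leaves the orientation of the two
  characteristic curves open, which is settled by the side that each of them enters.\<close>

definition has_grad :: "(plane \<Rightarrow> real) \<Rightarrow> real \<Rightarrow> real \<Rightarrow> plane \<Rightarrow> bool" where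
  "has_grad f a b z \<longleftrightarrow> (f has_derivative (\<lambda>h. fst h * a + snd h * b)) (at z)"

abbreviation C1_on :: "(plane \<Rightarrow> real) \<Rightarrow> plane set \<Rightarrow> bool" where
  "C1_on \<equiv> Ck_on (Suc 0)"

lemma C1_on_iff:
  "C1_on f S \<longleftrightarrow>
     (\<exists>fx fy. (\<forall>z\<in>S. has_grad f (fx z) (fy z) z) \<and> continuous_on S fx \<and> continuous_on S fy)"
  by (auto simp: has_grad_def)

declare Ck_on.simps [simp del]

lemma C1_onI:
  assumes "\<And>z. z \<in> S \<Longrightarrow> has_grad f (fx z) (fy z) z" "continuous_on S fx" "continuous_on S fy"
  shows "C1_on f S"
  using assms unfolding C1_on_iff by blast

lemma C1_onE:
  assumes "C1_on f S"
  obtains fx fy where "\<forall>z\<in>S. has_grad f (fx z) (fy z) z" "continuous_on S fx" "continuous_on S fy"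
  using assms unfolding C1_on_iff by blast

lemma has_grad_continuous: "has_grad f a b z \<Longrightarrow> isCont f z"
  unfolding has_grad_def by (rule has_derivative_continuous)

lemma has_grad_continuous_on:
  "(\<And>z. z \<in> S \<Longrightarrow> has_grad f (fx z) (fy z) z) \<Longrightarrow> continuous_on S f"
  by (blast intro: continuous_at_imp_continuous_on has_grad_continuous)

lemma C1_on_continuous: "C1_on f S \<Longrightarrow> continuous_on S f"
  by (meson C1_onE continuous_at_imp_continuous_on has_grad_continuous)

lemma C1_on_subset: "C1_on f S \<Longrightarrow> T \<subseteq> S \<Longrightarrow> C1_on f T"
  unfolding C1_on_iff using continuous_on_subset by blast

lemma has_grad_unique:
  assumes "has_grad f a b z" "has_grad f c d z"
  shows "a = c \<and> b = d"
proof -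
  have "(\<lambda>h::plane. fst h * a + snd h * b) = (\<lambda>h. fst h * c + snd h * d)"
    using assms has_derivative_unique unfolding has_grad_def by blast
  from fun_cong[OF this, of "(1,0)"] fun_cong[OF this, of "(0,1)"] show ?thesis by auto
qed

lemma has_grad_transform_open:
  assumes "has_grad f a b z" "open S" "z \<in> S" "\<And>w. w \<in> S \<Longrightarrow> f w = g w"
  shows "has_grad g a b z"
  using assms has_derivative_transform_within_open unfolding has_grad_def by blast

lemma C1_on_cong:
  assumes "C1_on f S" "open S" "\<And>w. w \<in> S \<Longrightarrow> f w = g w"
  shows "C1_on g S"
  using assms has_grad_transform_open by (metis C1_onE C1_onI)

lemma has_grad_fst: "has_grad fst 1 0 z"
  and has_grad_snd: "has_grad snd 0 1 z"
  and has_grad_const: "has_grad (\<lambda>_. c) 0 0 z"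
  unfolding has_grad_def by (auto intro!: derivative_eq_intros)

lemma has_grad_add: "has_grad f a b z \<Longrightarrow> has_grad g c d z \<Longrightarrow> has_grad (\<lambda>z. f z + g z) (a + c) (b + d) z"
  and has_grad_diff: "has_grad f a b z \<Longrightarrow> has_grad g c d z \<Longrightarrow> has_grad (\<lambda>z. f z - g z) (a - c) (b - d) z"
  and has_grad_mult: "has_grad f a b z \<Longrightarrow> has_grad g c d z \<Longrightarrow>
     has_grad (\<lambda>z. f z * g z) (a * g z + f z * c) (b * g z + f z * d) z"
  unfolding has_grad_def
  by (auto intro!: derivative_eq_intros simp: algebra_simps)

lemma has_grad_compose:
  assumes f: "has_grad f a b (g z, h z)" and g: "has_grad g c d z" and h: "has_grad h e k z"
  shows "has_grad (\<lambda>z. f (g z, h z)) (c * a + e * b) (d * a + k * b) z"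
proof -
  have "((\<lambda>z. (g z, h z)) has_derivative (\<lambda>v. (fst v * c + snd v * d, fst v * e + snd v * k))) (at z)"
    using g h unfolding has_grad_def by (auto intro!: derivative_eq_intros)
  from has_derivative_compose[OF this f[unfolded has_grad_def]]
  show ?thesis
    unfolding has_grad_def by (simp add: algebra_simps)
qed

lemma has_grad_compose_real:
  assumes f: "DERIV f (g z) :> a" and g: "has_grad g c d z"
  shows "has_grad (\<lambda>z. f (g z)) (c * a) (d * a) z"
  using has_derivative_compose[OF g[unfolded has_grad_def] f[unfolded has_field_derivative_def]]
  unfolding has_grad_def by (simp add: algebra_simps)

lemma has_grad_along:
  assumes f: "has_grad f a b (c t)" and c: "(c has_vector_derivative v) (at t within S)"
  shows "((\<lambda>t. f (c t)) has_real_derivative (fst v * a + snd v * b)) (at t within S)"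
  using has_derivative_compose[OF c[unfolded has_vector_derivative_def] f[unfolded has_grad_def]]
  unfolding has_field_derivative_def
  by (rule has_derivative_eq_rhs) (auto simp: algebra_simps)

lemma has_grad_partials:
  assumes "has_grad f a b (x, y)"
  shows "DERIV (\<lambda>t. f (t, y)) x :> a" and "DERIV (\<lambda>t. f (x, t)) y :> b"
proof -
  have "((\<lambda>t. (t, y)) has_vector_derivative (1, 0)) (at x)"
       "((\<lambda>t. (x, t)) has_vector_derivative (0, 1)) (at y)"
    by (auto intro!: derivative_eq_intros simp: has_vector_derivative_def)
  then show "DERIV (\<lambda>t. f (t, y)) x :> a" and "DERIV (\<lambda>t. f (x, t)) y :> b"
    using has_grad_along[of f a b "\<lambda>t. (t, y)" x "(1, 0)" UNIV]
      has_grad_along[of f a b "\<lambda>t. (x, t)" y "(0, 1)" UNIV] assms by auto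
qed

lemma C1_on_compose:
  assumes "C1_on f T" "C1_on g S" "C1_on h S" "\<And>z. z \<in> S \<Longrightarrow> (g z, h z) \<in> T"
  shows "C1_on (\<lambda>z. f (g z, h z)) S"
proof -
  obtain fx fy where f: "\<forall>z\<in>T. has_grad f (fx z) (fy z) z" "continuous_on T fx" "continuous_on T fy"
    using C1_onE[OF assms(1)] by blast
  obtain gx gy where g: "\<forall>z\<in>S. has_grad g (gx z) (gy z) z" "continuous_on S gx" "continuous_on S gy"
    using C1_onE[OF assms(2)] by blast
  obtain hx hy where h: "\<forall>z\<in>S. has_grad h (hx z) (hy z) z" "continuous_on S hx" "continuous_on S hy"
    using C1_onE[OF assms(3)] by blast
  have c: "continuous_on S (\<lambda>z. (g z, h z))"
    by (intro continuous_on_Pair C1_on_continuous assms)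
  have sub: "(\<lambda>z. (g z, h z)) ` S \<subseteq> T" using assms(4) by blast
  have c': "continuous_on S (\<lambda>z. fx (g z, h z))" "continuous_on S (\<lambda>z. fy (g z, h z))"
    using continuous_on_compose2[OF f(2) c sub] continuous_on_compose2[OF f(3) c sub] .
  show ?thesis
    by (rule C1_onI[OF has_grad_compose[OF f(1)[rule_format] g(1)[rule_format] h(1)[rule_format]]])
       (use assms(4) c' g h in \<open>auto intro!: continuous_intros\<close>)
qed

lemma C1_on_compose_real:
  assumes f: "\<And>x. x \<in> g ` S \<Longrightarrow> DERIV f x :> f' x" "continuous_on (g ` S) f'" and g: "C1_on g S"
  shows "C1_on (\<lambda>z. f (g z)) S"
proof -
  obtain gx gy where g': "\<forall>z\<in>S. has_grad g (gx z) (gy z) z" "continuous_on S gx" "continuous_on S gy"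
    using C1_onE[OF g] by blast
  have "continuous_on S (\<lambda>z. f' (g z))"
    by (rule continuous_on_compose2[OF f(2) C1_on_continuous[OF g]]) auto
  then show ?thesis
    by (intro C1_onI[OF has_grad_compose_real[OF f(1) g'(1)[rule_format]]])
       (use g' in \<open>auto intro!: continuous_intros\<close>)
qed

named_theorems Ck1_intros

lemma C1_on_snd [Ck1_intros]: "C1_on snd S"
  and C1_on_const [Ck1_intros]: "C1_on (\<lambda>_. c) S"
  by (blast intro: C1_onI[OF has_grad_snd continuous_on_const continuous_on_const]
      C1_onI[OF has_grad_const continuous_on_const continuous_on_const])+

lemma C1_on_add [Ck1_intros]:
  "C1_on f S \<Longrightarrow> C1_on g S \<Longrightarrow> C1_on (\<lambda>z. f z + g z) S"
  and C1_on_diff [Ck1_intros]: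
  "C1_on f S \<Longrightarrow> C1_on g S \<Longrightarrow> C1_on (\<lambda>z. f z - g z) S"
  and C1_on_mult [Ck1_intros]:
  "C1_on f S \<Longrightarrow> C1_on g S \<Longrightarrow> C1_on (\<lambda>z. f z * g z) S"
proof -
  have *: "C1_on (\<lambda>z. fst z + snd z) UNIV"
    by (rule C1_onI[OF has_grad_add[OF has_grad_fst has_grad_snd]]) auto
  show "C1_on (\<lambda>z. f z + g z) S" if "C1_on f S" "C1_on g S"
    using C1_on_compose[OF * that] by simp
  have *: "C1_on (\<lambda>z. fst z - snd z) UNIV"
    by (rule C1_onI[OF has_grad_diff[OF has_grad_fst has_grad_snd]]) auto
  show "C1_on (\<lambda>z. f z - g z) S" if "C1_on f S" "C1_on g S"
    using C1_on_compose[OF * that] by simp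
  have *: "C1_on (\<lambda>z. fst z * snd z) UNIV"
    by (rule C1_onI[OF has_grad_mult[OF has_grad_fst has_grad_snd]]) (auto intro!: continuous_intros)
  show "C1_on (\<lambda>z. f z * g z) S" if "C1_on f S" "C1_on g S"
    using C1_on_compose[OF * that] by simp
qed

lemma C1_on_minus [Ck1_intros]: "C1_on f S \<Longrightarrow> C1_on (\<lambda>z. - f z) S"
  using C1_on_mult[OF C1_on_const[of "-1"], of f S] by simp

lemma C1_on_sin [Ck1_intros]: "C1_on f S \<Longrightarrow> C1_on (\<lambda>z. sin (f z)) S"
  by (rule C1_on_compose_real[where f = sin and f' = cos]) (auto intro!: continuous_intros derivative_eq_intros)

lemma C1_on_cos [Ck1_intros]: "C1_on f S \<Longrightarrow> C1_on (\<lambda>z. cos (f z)) S"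
  by (rule C1_on_compose_real[where f = cos and f' = "\<lambda>x. - sin x"])
    (auto intro!: continuous_intros derivative_eq_intros)

lemma C1_on_inverse [Ck1_intros]:
  assumes f: "C1_on f S" "\<And>z. z \<in> S \<Longrightarrow> f z \<noteq> 0"
  shows "C1_on (\<lambda>z. inverse (f z)) S"
proof (rule C1_on_compose_real[where f = inverse])
  show "DERIV inverse x :> - (inverse x ^ Suc (Suc 0))" if "x \<in> f ` S" for x
    using that f by (intro DERIV_inverse) auto
qed (use f in \<open>auto intro!: continuous_intros\<close>)

lemma C1_on_divide [Ck1_intros]:
  assumes "C1_on f S" "C1_on g S" "\<And>z. z \<in> S \<Longrightarrow> g z \<noteq> 0"
  shows "C1_on (\<lambda>z. f z / g z) S"
  using C1_on_mult[OF assms(1) C1_on_inverse[OF assms(2,3)]] by (simp add: divide_inverse)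

text \<open>One partial is required at the point only, the other throughout and continuously; this
  already gives total differentiability. The asymmetry suits integrals with a variable upper limit,
  whose derivative in the limit comes from the fundamental theorem on a line.\<close>

lemma has_grad_from_partials:
  assumes S: "open S" "(x, y) \<in> S"
    and fx: "DERIV (\<lambda>t. f (t, y)) x :> a"
    and fy: "\<And>x y. (x, y) \<in> S \<Longrightarrow> DERIV (\<lambda>t. f (x, t)) y :> g (x, y)"
    and g: "continuous_on S g"
  shows "has_grad f a (g (x, y)) (x, y)"
proof -
  obtain A B where AB: "open A" "open B" "x \<in> A" "y \<in> B" "A \<times> B \<subseteq> S"
    using S by (metis mem_Sigma_iff open_prod_elim)
  obtain e where e: "e > 0" "ball y e \<subseteq> B" using AB openE by blast
  define Y where "Y = ball y e"
  have Y: "open Y" "y \<in> Y" "convex Y" "A \<times> Y \<subseteq> S" using e AB by (auto simp: Y_def)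
  have *: "continuous (at (x, y) within A \<times> Y) (\<lambda>(x, y). blinfun_mult_right (g (x, y)))"
  proof -
    have "isCont g (x, y)" using g S continuous_on_eq_continuous_at by blast
    then have "isCont (\<lambda>z. blinfun_mult_right (g z)) (x, y)" by (intro continuous_intros)
    then show ?thesis by (simp add: continuous_at_imp_continuous_at_within case_prod_beta')
  qed
  have "((\<lambda>(x, y). f (x, y)) has_derivative (\<lambda>(tx, ty). a * tx + blinfun_mult_right (g (x, y)) ty))
        (at (x, y) within A \<times> Y)"
  proof (rule has_derivative_partialsI[OF _ _ * Y(2,3)])
    show "((\<lambda>x. f (x, y)) has_derivative (*) a) (at x within A)"
      using fx unfolding has_field_derivative_def by (rule has_derivative_at_withinI)
    fix u v assume "u \<in> A" "v \<in> Y"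
    then have "DERIV (\<lambda>t. f (u, t)) v :> g (u, v)" using fy Y by auto
    then show "((\<lambda>y. f (u, y)) has_derivative blinfun_apply (blinfun_mult_right (g (u, v)))) (at v within Y)"
      unfolding has_field_derivative_def by (simp add: has_derivative_at_withinI mult_commute_abs bounded_linear_mult_left)
  qed
  moreover have "at (x, y) within A \<times> Y = at (x, y)"
    using AB Y by (intro at_within_open) (auto simp: open_Times)
  moreover have "(\<lambda>(tx, ty). a * tx + blinfun_mult_right (g (x, y)) ty) = (\<lambda>h. fst h * a + snd h * g (x, y))"
    by (auto simp: algebra_simps)
  ultimately show ?thesis unfolding has_grad_def by (simp add: case_prod_eta)
qed

section \<open>Integrals with a variable upper limit and a parameter\<close>

text \<open>The substitution \<open>r = a + s * (x - a)\<close> moves the variable limit into the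
  integrand over the fixed interval from 0 to 1, where continuity of parameter integrals
  applies.\<close>

lemma continuous_on_integral_upper:
  fixes g :: "plane \<Rightarrow> real"
  assumes g: "continuous_on ({a..<b} \<times> J) g"
  shows "continuous_on ({a<..<b} \<times> J) (\<lambda>z. integral {a..fst z} (\<lambda>r. g (r, snd z)))"
proof -
  have eq: "integral {a..fst z} (\<lambda>r. g (r, snd z)) =
        integral {0..1} (\<lambda>s. (fst z - a) * g (a + s * (fst z - a), snd z))" (is "?l = integral _ ?k")
    if z: "z \<in> {a<..<b} \<times> J" for z
  proof -
    define x where "x = fst z"
    have x: "a < x" "x < b" using z by (auto simp: x_def)
    have m: "a + s * (x - a) \<in> {a..x}" if "s \<in> {0..1}" for s
    proof -
      have "s * (x - a) \<le> x - a" "0 \<le> s * (x - a)"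
        using x that by (auto intro!: mult_left_le_one_le)
      then show ?thesis by simp
    qed
    have c: "continuous_on {a..x} (\<lambda>r. g (r, snd z))"
      by (rule continuous_on_compose2[OF g]) (use z in \<open>auto intro!: continuous_intros simp: x_def\<close>)
    have "(?k has_integral (\<lambda>t. integral {a..t} (\<lambda>r. g (r, snd z))) (a + 1 * (x - a))
            - (\<lambda>t. integral {a..t} (\<lambda>r. g (r, snd z))) (a + 0 * (x - a))) {0..1}"
    proof (rule fundamental_theorem_of_calculus)
      fix s :: real assume s: "s \<in> {0..1}"
      have "a + s * (x - a) \<in> {a..x}" by (rule m[OF s])
      then have "((\<lambda>t. integral {a..t} (\<lambda>r. g (r, snd z))) has_vector_derivative g (a + s * (x - a), snd z))
             (at (a + s * (x - a)) within {a..x})"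
        by (rule integral_has_vector_derivative[OF c])
      moreover have "(\<lambda>s. a + s * (x - a)) ` {0..1} \<subseteq> {a..x}"
      proof (intro image_subsetI)
      fix s :: real assume "s \<in> {0..1}"
      then show "a + s * (x - a) \<in> {a..x}" by (rule m)
    qed
      ultimately have 1: "((\<lambda>t. integral {a..t} (\<lambda>r. g (r, snd z))) has_vector_derivative g (a + s * (x - a), snd z))
             (at (a + s * (x - a)) within (\<lambda>s. a + s * (x - a)) ` {0..1})"
        using has_vector_derivative_within_subset by blast
      have 2: "((\<lambda>s. a + s * (x - a)) has_real_derivative (x - a)) (at s within {0..1})"
        by (auto intro!: derivative_eq_intros)
      show "((\<lambda>s. integral {a..a + s * (x - a)} (\<lambda>r. g (r, snd z))) has_vector_derivative ?k s) (at s within {0..1})"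
        using vector_diff_chain_within[OF 2[unfolded has_real_derivative_iff_has_vector_derivative] 1]
        by (simp add: o_def x_def)
    qed simp
    then show ?thesis by (intro integral_unique[symmetric]) (simp add: x_def)
  qed
  have "continuous_on ({a<..<b} \<times> J) (\<lambda>z. integral (cbox 0 1) (\<lambda>s. (fst z - a) * g (a + s * (fst z - a), snd z)))"
  proof (rule integral_continuous_on_param)
    have "a + s * (x - a) < b" if "x < b" "0 \<le> s" "s \<le> 1" "a < x" for s x
      using that mult_left_le_one_le[of "x - a" s] by linarith
    then have "continuous_on (({a<..<b} \<times> J) \<times> cbox 0 1) (\<lambda>p. g (a + snd p * (fst (fst p) - a), snd (fst p)))"
      by (intro continuous_on_compose2[OF g]) (auto intro!: continuous_intros)
    then show "continuous_on (({a<..<b} \<times> J) \<times> cbox 0 1) (\<lambda>(z, s). (fst z - a) * g (a + s * (fst z - a), snd z))"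
      by (auto intro!: continuous_intros simp: case_prod_beta)
  qed
  then show ?thesis using eq by (simp cong: continuous_on_cong)
qed

text \<open>The fundamental theorem handles the upper limit, the Leibniz rule the parameter;
  \<open>has_grad_from_partials\<close> joins them. The integrand is differentiated in the parameter
  only.\<close>

lemma has_grad_integral_upper:
  fixes f :: "plane \<Rightarrow> real"
  assumes f: "continuous_on ({a..<b} \<times> J) f" and J: "open J"
    and f': "\<And>x y. x \<in> {a..<b} \<Longrightarrow> y \<in> J \<Longrightarrow> DERIV (\<lambda>t. f (x, t)) y :> g (x, y)"
    and g: "continuous_on ({a..<b} \<times> J) g"
    and z: "z \<in> {a<..<b} \<times> J"
  shows "has_grad (\<lambda>z. integral {a..fst z} (\<lambda>r. f (r, snd z))) (f z) (integral {a..fst z} (\<lambda>r. g (r, snd z))) z"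
proof -
  obtain x y where xy: "z = (x, y)" by force
  have c: "continuous_on {a..u} (\<lambda>r. f (r, v))" if "u < b" "v \<in> J" for u v
    by (rule continuous_on_compose2[OF f]) (use that in \<open>auto intro!: continuous_intros\<close>)
  have d: "DERIV (\<lambda>t. integral {a..u} (\<lambda>r. f (r, t))) v :> integral {a..u} (\<lambda>r. g (r, v))"
    if u: "(u, v) \<in> {a<..<b} \<times> J" for u v
  proof -
    obtain e where e: "e > 0" "ball v e \<subseteq> J" using J u openE by blast
    have "((\<lambda>t. integral (cbox a u) (\<lambda>r. f (r, t))) has_field_derivative integral (cbox a u) (\<lambda>r. g (r, v))) (at v within ball v e)"
    proof (rule leibniz_rule_field_derivative)
      show "((\<lambda>x. f (t, x)) has_real_derivative g (t, x)) (at x within ball v e)"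
        if "x \<in> ball v e" "t \<in> cbox a u" for x t
      proof (rule has_field_derivative_at_within[OF f'])
        show "x \<in> J" using that e by blast
      qed (use that u in auto)
      show "(\<lambda>r. f (r, x)) integrable_on cbox a u" if "x \<in> ball v e" for x
        using c[of u x] that e u by (intro integrable_continuous) auto
      have "continuous_on (ball v e \<times> cbox a u) (\<lambda>p. g (snd p, fst p))"
        by (rule continuous_on_compose2[OF g]) (use u e in \<open>auto intro!: continuous_intros\<close>)
      then show "continuous_on (ball v e \<times> cbox a u) (\<lambda>(x, t). g (t, x))"
        by (simp add: case_prod_beta)
    qed (use e in auto)
    moreover have "at v within ball v e = at v" using e by (intro at_within_open) auto
    ultimately show ?thesis by simp
  qed
  show ?thesis unfolding xy fst_conv snd_conv
  proof (rule has_grad_from_partials[where f="\<lambda>z. integral {a..fst z} (\<lambda>r. f (r, snd z))"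
        and S="{a<..<b} \<times> J" and g="\<lambda>z. integral {a..fst z} (\<lambda>r. g (r, snd z))", unfolded fst_conv snd_conv])
    have xb: "a < x" "x < b" "y \<in> J" using z xy by auto
    obtain x' where x': "x < x'" "x' < b" using dense xb(2) by blast
    have "((\<lambda>t. integral {a..t} (\<lambda>r. f (r, y))) has_real_derivative f (x, y)) (at x within {a..x'})"
      using c[of x' y] xb x' by (intro integral_has_real_derivative) auto
    moreover have "at x within {a..x'} = at x" using xb x' by (intro at_within_interior) auto
    ultimately show "((\<lambda>t. integral {a..t} (\<lambda>r. f (r, y))) has_real_derivative f (x, y)) (at x)" by simp
    show "continuous_on ({a<..<b} \<times> J) (\<lambda>z. integral {a..fst z} (\<lambda>r. g (r, snd z)))"
      by (rule continuous_on_integral_upper[OF g])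
  qed (use d J z xy in \<open>auto intro!: open_Times\<close>)
qed

lemma C1_on_integral_upper:
  fixes f :: "plane \<Rightarrow> real"
  assumes f: "C1_on f ({a..<b} \<times> J)" and J: "open J"
  shows "C1_on (\<lambda>z. integral {a..fst z} (\<lambda>r. f (r, snd z))) ({a<..<b} \<times> J)"
proof -
  obtain fx fy where f': "\<forall>z\<in>{a..<b} \<times> J. has_grad f (fx z) (fy z) z"
     "continuous_on ({a..<b} \<times> J) fx" "continuous_on ({a..<b} \<times> J) fy"
    using C1_onE[OF f] by blast
  have c: "continuous_on ({a..<b} \<times> J) f" using f C1_on_continuous by blast
  show ?thesis
    by (rule C1_onI[OF has_grad_integral_upper[OF c J has_grad_partials(2)[OF f'(1)[rule_format]] f'(3)]])
       (auto intro: continuous_on_subset[OF c] continuous_on_integral_upper[OF f'(3)])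
qed

section \<open>Local inverses of class C^1\<close>

text \<open>\<open>inverse_function_theorem\<close> returns the derivative of \<open>Q\<close> as
  the inverse of a linear map. Cramer's rule makes its entries explicit, and their continuity can
  then be read off.\<close>

lemma plane_inverse_function:
  fixes T :: "plane \<Rightarrow> plane"
  assumes S: "open S" "z0 \<in> S"
    and T1: "C1_on (\<lambda>z. fst (T z)) S" and T2: "C1_on (\<lambda>z. snd (T z)) S"
    and g1: "has_grad (\<lambda>z. fst (T z)) a b z0" and g2: "has_grad (\<lambda>z. snd (T z)) c d z0"
    and det: "a * d - b * c \<noteq> 0"
  obtains A B Q where "open A" "z0 \<in> A" "A \<subseteq> S" "open B" "homeomorphism A B T Q"
    "C1_on (\<lambda>z. fst (Q z)) B" "C1_on (\<lambda>z. snd (Q z)) B"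
proof -
  obtain ax ay where A: "\<forall>z\<in>S. has_grad (\<lambda>z. fst (T z)) (ax z) (ay z) z"
    "continuous_on S ax" "continuous_on S ay"
    using C1_onE[OF T1] by blast
  obtain bx b_y where B: "\<forall>z\<in>S. has_grad (\<lambda>z. snd (T z)) (bx z) (b_y z) z"
    "continuous_on S bx" "continuous_on S b_y"
    using C1_onE[OF T2] by blast
  define D where "D z = ax z * b_y z - ay z * bx z" for z
  define S0 where "S0 = {z \<in> S. D z \<noteq> 0}"
  have cD: "continuous_on S D" unfolding D_def using A B by (intro continuous_intros)
  have "open S0"
  proof -
    have "open (S \<inter> D -` (- {0}))"
      using cD S continuous_open_preimage[of S D "- {0}"] by (simp add: open_Compl)
    moreover have "S \<inter> D -` (- {0}) = S0" by (auto simp: S0_def)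
    ultimately show ?thesis by simp
  qed
  have "has_grad (\<lambda>z. fst (T z)) (ax z0) (ay z0) z0" "has_grad (\<lambda>z. snd (T z)) (bx z0) (b_y z0) z0"
    using A B S by auto
  then have "a = ax z0" "b = ay z0" "c = bx z0" "d = b_y z0"
    using has_grad_unique g1 g2 by blast+
  then have z0: "z0 \<in> S0" using det S by (simp add: S0_def D_def)
  define L where "L z h = (fst h * ax z + snd h * ay z, fst h * bx z + snd h * b_y z)" for z h :: plane
  have blL: "bounded_linear (L z)" for z
    unfolding L_def by (intro bounded_linear_intros)
  define T' where "T' z = Blinfun (L z)" for z
  have T'_apply: "blinfun_apply (T' z) = L z" for z
    using bounded_linear_Blinfun_apply[OF blL] by (simp add: T'_def)
  \<comment> \<open>\<open>M z\<close> is the adjugate of \<open>L z\<close> divided by the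
    determinant \<open>D z\<close>; it inverts \<open>L z\<close> at every point of
    \<open>S0\<close>, not only at \<open>z0\<close>.\<close>
  define M where "M z h = ((fst h * b_y z - snd h * ay z) / D z, (snd h * ax z - fst h * bx z) / D z)" for z h :: plane
  have blM: "bounded_linear (M z)" for z
    unfolding M_def divide_inverse by (intro bounded_linear_intros)
  have MLid: "M z (L z h) = h" and LM: "L z (M z h) = h" if "D z \<noteq> 0" for z h
    using that by (cases h; simp add: M_def L_def field_simps; simp add: D_def algebra_simps)+
  have der: "(T has_derivative blinfun_apply (T' z)) (at z)" if "z \<in> S0" for z
  proof -
    have "((\<lambda>z. (fst (T z), snd (T z))) has_derivative L z) (at z)"
      using A(1) B(1) that unfolding has_grad_def L_def S0_def by (intro has_derivative_Pair) auto
    then show ?thesis by (simp add: T'_apply)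
  qed
  have ct: "continuous_on S0 T'"
  proof (rule continuous_on_blinfun_componentwise)
    fix i :: plane assume "i \<in> Basis"
    have "continuous_on S0 ax" "continuous_on S0 ay" "continuous_on S0 bx" "continuous_on S0 b_y"
      using A B by (auto intro: continuous_on_subset simp: S0_def)
    then show "continuous_on S0 (\<lambda>x. blinfun_apply (T' x) i)"
      unfolding T'_apply L_def by (intro continuous_intros)
  qed
  have inv: "Blinfun (M z0) o\<^sub>L T' z0 = id_blinfun"
    using MLid[of z0] z0 by (intro blinfun_eqI)
      (simp add: T'_apply bounded_linear_Blinfun_apply[OF blM] S0_def)
  obtain A' B' Q Q' where Q: "open A'" "A' \<subseteq> S0" "z0 \<in> A'" "open B'" "T z0 \<in> B'" "homeomorphism A' B' T Q"
    and Qd: "\<And>y. y \<in> B' \<Longrightarrow> (Q has_derivative (Q' y)) (at y)"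
    and Q': "\<And>y. y \<in> B' \<Longrightarrow> Q' y = inv (blinfun_apply (T' (Q y)))"
    by (rule inverse_function_theorem[OF \<open>open S0\<close> der ct z0 inv]) blast+
  have QB: "Q y \<in> S0" if "y \<in> B'" for y
    using Q that homeomorphism_image2 by fastforce
  have cQ: "continuous_on B' Q" using Q homeomorphism_cont2 by blast
  have Q'M: "Q' y = M (Q y)" if "y \<in> B'" for y
  proof -
    have "D (Q y) \<noteq> 0" using QB[OF that] by (simp add: S0_def)
    then have "inv (L (Q y)) = M (Q y)"
      by (intro inv_unique_comp) (auto simp: MLid LM fun_eq_iff)
    then show ?thesis using Q'[OF that] by (simp add: T'_apply)
  qed
  have cc: "continuous_on B' (\<lambda>y. f (Q y))" if "continuous_on S f" for f :: "plane \<Rightarrow> real"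
    by (rule continuous_on_compose2[OF that cQ]) (use QB in \<open>auto simp: S0_def\<close>)
  have D0: "D (Q y) \<noteq> 0" if "y \<in> B'" for y using QB[OF that] by (simp add: S0_def)
  have 1: "has_grad (\<lambda>z. fst (Q z)) (b_y (Q y) / D (Q y)) (- ay (Q y) / D (Q y)) y"
   and 2: "has_grad (\<lambda>z. snd (Q z)) (- bx (Q y) / D (Q y)) (ax (Q y) / D (Q y)) y" if "y \<in> B'" for y
    using has_derivative_fst[OF Qd[OF that]] has_derivative_snd[OF Qd[OF that]]
    unfolding has_grad_def Q'M[OF that] M_def by (simp_all add: diff_divide_distrib add_divide_distrib)
  show thesis
  proof (rule that[of A' B' Q])
    show "C1_on (\<lambda>z. fst (Q z)) B'" "C1_on (\<lambda>z. snd (Q z)) B'"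
      by (rule C1_onI[OF 1] C1_onI[OF 2];
          use cc[OF A(2)] cc[OF A(3)] cc[OF B(2)] cc[OF B(3)] cc[OF cD] D0 in \<open>auto intro!: continuous_intros\<close>)+
  qed (use Q in \<open>auto simp: S0_def\<close>)
qed


section \<open>Mollification\<close>

lemma Ck_on_continuous: "Ck_on k f S \<Longrightarrow> continuous_on S f"
  by (cases k) (auto simp: Ck_on.simps intro: continuous_at_imp_continuous_on has_derivative_continuous)

lemma Ck_on_SucI:
  assumes "\<And>z. z \<in> S \<Longrightarrow> has_grad f (fx z) (fy z) z" "Ck_on k fx S" "Ck_on k fy S"
  shows "Ck_on (Suc k) f S"
  unfolding Ck_on.simps using assms unfolding has_grad_def by (intro exI[of _ fx] exI[of _ fy]) simp

lemma Ck_on_SucE: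
  assumes "Ck_on (Suc k) f S"
  obtains fx fy where "\<forall>z\<in>S. has_grad f (fx z) (fy z) z" "Ck_on k fx S" "Ck_on k fy S"
  using assms unfolding Ck_on.simps has_grad_def by blast

lemma Ck_on_SucD: "Ck_on (Suc k) f S \<Longrightarrow> Ck_on k f S"
proof (induction k arbitrary: f)
  case 0
  then show ?case using Ck_on_continuous[of "Suc 0"] by (simp add: Ck_on.simps(1))
next
  case (Suc k)
  obtain fx fy where f: "\<forall>z\<in>S. has_grad f (fx z) (fy z) z" "Ck_on (Suc k) fx S" "Ck_on (Suc k) fy S"
    using Ck_on_SucE[OF Suc.prems] by blast
  show ?case by (rule Ck_on_SucI[OF f(1)[rule_format]]) (use f Suc.IH in auto)
qed

lemma Ck_on_add: "Ck_on k f S \<Longrightarrow> Ck_on k g S \<Longrightarrow> Ck_on k (\<lambda>z. f z + g z) S"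
proof (induction k arbitrary: f g)
  case 0
  then show ?case by (auto simp: Ck_on.simps intro: continuous_intros)
next
  case (Suc k)
  obtain fx fy where f: "\<forall>z\<in>S. has_grad f (fx z) (fy z) z" "Ck_on k fx S" "Ck_on k fy S"
    using Ck_on_SucE[OF Suc.prems(1)] by blast
  obtain gx gy where g: "\<forall>z\<in>S. has_grad g (gx z) (gy z) z" "Ck_on k gx S" "Ck_on k gy S"
    using Ck_on_SucE[OF Suc.prems(2)] by blast
  show ?case
    by (rule Ck_on_SucI[OF has_grad_add[OF f(1)[rule_format] g(1)[rule_format]]]) (use f g Suc.IH in auto)
qed

lemma Ck_on_mult: "Ck_on k f S \<Longrightarrow> Ck_on k g S \<Longrightarrow> Ck_on k (\<lambda>z. f z * g z) S"
proof (induction k arbitrary: f g)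
  case 0
  then show ?case by (auto simp: Ck_on.simps intro: continuous_intros)
next
  case (Suc k)
  obtain fx fy where f: "\<forall>z\<in>S. has_grad f (fx z) (fy z) z" "Ck_on k fx S" "Ck_on k fy S"
    using Ck_on_SucE[OF Suc.prems(1)] by blast
  obtain gx gy where g: "\<forall>z\<in>S. has_grad g (gx z) (gy z) z" "Ck_on k gx S" "Ck_on k gy S"
    using Ck_on_SucE[OF Suc.prems(2)] by blast
  show ?case
    by (rule Ck_on_SucI[OF has_grad_mult[OF f(1)[rule_format] g(1)[rule_format]]])
       (use f g Suc.IH Suc.prems[THEN Ck_on_SucD] in \<open>auto intro!: Ck_on_add\<close>)
qed

lemma Ck_on_const: "Ck_on k (\<lambda>_. c) S"
proof (induction k arbitrary: c)
  case (Suc k)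
  show ?case by (rule Ck_on_SucI[OF has_grad_const Suc Suc])
qed (simp add: Ck_on.simps)

section \<open>Flat functions and smooth bumps\<close>

text \<open>The functions p(1/t) exp(-1/t), extended by zero, form a family closed under
  differentiation; with the polynomial as a parameter, one induction covers all orders.\<close>

definition flat_exp :: "real poly \<Rightarrow> real \<Rightarrow> real" where
  "flat_exp p t = (if t > 0 then poly p (1 / t) * exp (- (1 / t)) else 0)"

lemma poly_exp_tendsto_0: "((\<lambda>u. poly p u * exp (- u)) \<longlongrightarrow> (0::real)) at_top"
proof -
  have "((\<lambda>u. \<Sum>i\<le>degree p. coeff p i * (u ^ i / exp u)) \<longlongrightarrow> (\<Sum>i\<le>degree p. coeff p i * (0::real))) at_top"
    by (intro tendsto_intros tendsto_power_div_exp_0)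
  moreover have "(\<lambda>u. \<Sum>i\<le>degree p. coeff p i * (u ^ i / exp u)) = (\<lambda>u. poly p u * exp (- u))"
    by (auto simp: poly_altdef sum_distrib_right exp_minus divide_inverse mult.assoc)
  ultimately show ?thesis by simp
qed

text \<open>With u = 1/t the chain rule contributes -u^2, and p(u) exp(-u) has derivative (p' - p)
  exp(-u); hence the polynomial u^2 (p - p'). At 0 the difference quotient from the right is again a
  polynomial in 1/t times exp(-1/t) and tends to 0.\<close>

lemma DERIV_flat_exp: "DERIV (flat_exp p) t :> flat_exp ([:0, 0, 1:] * (p - pderiv p)) t"
proof -
  consider "t > 0" | "t < 0" | "t = 0" by linarith
  then show ?thesis
  proof cases
    case 1
    have "DERIV (\<lambda>t. poly p (1 / t) * exp (- (1 / t))) t :> flat_exp ([:0, 0, 1:] * (p - pderiv p)) t"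
      using 1 by (auto intro!: derivative_eq_intros simp: flat_exp_def field_simps power2_eq_square)
    then show ?thesis
      by (rule has_field_derivative_transform_within_open[where S="{0<..}"]) (use 1 in \<open>auto simp: flat_exp_def\<close>)
  next
    case 2
    have "DERIV (\<lambda>t. 0) t :> flat_exp ([:0, 0, 1:] * (p - pderiv p)) t"
      using 2 by (auto simp: flat_exp_def)
    then show ?thesis
      by (rule has_field_derivative_transform_within_open[where S="{..<0}"]) (use 2 in \<open>auto simp: flat_exp_def\<close>)
  next
    case 3
    have "((\<lambda>h. flat_exp p h / h) \<longlongrightarrow> 0) (at_right 0)"
    proof -
      have "((\<lambda>h. poly ([:0, 1:] * p) (inverse h) * exp (- inverse h)) \<longlongrightarrow> 0) (at_right (0::real))"
        by (rule filterlim_compose[OF poly_exp_tendsto_0 filterlim_inverse_at_top_right])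
      moreover have "\<forall>\<^sub>F h in at_right (0::real). poly ([:0, 1:] * p) (inverse h) * exp (- inverse h) = flat_exp p h / h"
        unfolding eventually_at_right_field by (rule exI[of _ 1]) (auto simp: flat_exp_def field_simps)
      ultimately show ?thesis by (rule Lim_transform_eventually)
    qed
    moreover have "((\<lambda>h. flat_exp p h / h) \<longlongrightarrow> 0) (at_left 0)"
    proof (rule Lim_transform_eventually[OF tendsto_const])
      show "\<forall>\<^sub>F h in at_left (0::real). 0 = flat_exp p h / h"
        unfolding eventually_at_left_field by (rule exI[of _ "-1"]) (auto simp: flat_exp_def)
    qed
    ultimately have "((\<lambda>h. flat_exp p h / h) \<longlongrightarrow> 0) (at 0)"
      using filterlim_split_at by blast
    then show ?thesis using 3 by (simp add: DERIV_def flat_exp_def)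
  qed
qed

text \<open>\<open>[:0, 0, 1:]\<close> is u^2, the polynomial that belongs to the derivative of
  \<open>flat_exp 1\<close>.\<close>

lemma flat_exp_1: "0 \<le> flat_exp 1 t" "flat_exp 1 t = 0 \<longleftrightarrow> t \<le> 0"
  and flat_exp_01: "0 \<le> flat_exp [:0, 0, 1:] t" "flat_exp [:0, 0, 1:] t = 0 \<longleftrightarrow> t \<le> 0"
  by (auto simp: flat_exp_def)

lemma DERIV_flat_exp_1_shift:
  "DERIV (\<lambda>t. flat_exp 1 (t + r)) t :> flat_exp [:0, 0, 1:] (t + r)"
  "DERIV (\<lambda>t. flat_exp 1 (r - t)) t :> - flat_exp [:0, 0, 1:] (r - t)"
proof -
  have d: "DERIV (flat_exp 1) u :> flat_exp [:0, 0, 1:] u" for u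
    using DERIV_flat_exp[of 1 u] by (simp add: one_pCons)
  show "DERIV (\<lambda>t. flat_exp 1 (t + r)) t :> flat_exp [:0, 0, 1:] (t + r)"
    using d[of "t + r"] by (simp add: DERIV_shift)
  have "DERIV (\<lambda>t. r - t) t :> -1" by (auto intro!: derivative_eq_intros)
  from DERIV_chain2[OF d this] show "DERIV (\<lambda>t. flat_exp 1 (r - t)) t :> - flat_exp [:0, 0, 1:] (r - t)"
    by simp
qed

lemma continuous_on_flat_exp: "continuous_on UNIV (flat_exp p)"
  using DERIV_flat_exp DERIV_isCont by (blast intro: continuous_at_imp_continuous_on)

text \<open>The factor \<open>c\<close> and the polynomial are generalised in the induction, because
  differentiation changes both; the affine argument stays fixed.\<close>

lemma Ck_on_flat_exp: "Ck_on k (\<lambda>z. c * flat_exp p (\<alpha> * fst z + \<beta> * snd z + \<gamma>)) S"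
proof (induction k arbitrary: c p)
  case 0
  have "continuous_on S (\<lambda>z. flat_exp p (\<alpha> * fst z + \<beta> * snd z + \<gamma>))"
    by (rule continuous_on_compose2[OF continuous_on_flat_exp]) (auto intro!: continuous_intros)
  then show ?case unfolding Ck_on.simps by (rule continuous_on_mult_left)
next
  case (Suc k)
  define q where "q = [:0, 0, 1:] * (p - pderiv p)"
  have a: "has_grad (\<lambda>z. \<alpha> * fst z + \<beta> * snd z + \<gamma>) \<alpha> \<beta> z" for z
    unfolding has_grad_def by (auto intro!: derivative_eq_intros)
  have "has_grad (\<lambda>z. c * flat_exp p (\<alpha> * fst z + \<beta> * snd z + \<gamma>))
     ((c * \<alpha>) * flat_exp q (\<alpha> * fst z + \<beta> * snd z + \<gamma>)) ((c * \<beta>) * flat_exp q (\<alpha> * fst z + \<beta> * snd z + \<gamma>)) z" for z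
    using has_grad_mult[OF has_grad_const[of c] has_grad_compose_real[OF DERIV_flat_exp a]]
    by (simp add: q_def mult.assoc)
  then show ?case by (rule Ck_on_SucI) (rule Suc)+
qed

lemma smooth_bump:
  fixes r :: real assumes r: "r > 0"
  obtains \<eta> :: "plane \<Rightarrow> real" where "\<And>k. Ck_on k \<eta> UNIV" "\<And>z. 0 \<le> \<eta> z"
    "\<And>z. z \<notin> cbox (-r, -r) (r, r) \<Longrightarrow> \<eta> z = 0" "(\<eta> has_integral 1) (cbox (-r, -r) (r, r))"
proof -
  define e where "e = flat_exp 1"
  note e0 = flat_exp_1(1)[folded e_def] and e1 = flat_exp_1(2)[folded e_def]
  define f where "f z = e (fst z + r) * e (r - fst z) * e (snd z + r) * e (r - snd z)" for z :: plane
  have Ck: "Ck_on k f UNIV" for k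
    using Ck_on_flat_exp[of k 1 1 1 0 r UNIV] Ck_on_flat_exp[of k 1 1 "-1" 0 r UNIV]
      Ck_on_flat_exp[of k 1 1 0 1 r UNIV] Ck_on_flat_exp[of k 1 1 0 "-1" r UNIV]
    unfolding f_def e_def by (intro Ck_on_mult) (auto simp: algebra_simps)
  have f0: "f z \<ge> 0" for z by (simp add: f_def e0)
  have cf: "continuous_on UNIV f" using Ck Ck_on_continuous by blast
  define B where "B = cbox (-r, -r) (r, r :: real)"
  define I where "I = integral B f"
  have I: "(f has_integral I) B"
    unfolding I_def B_def by (intro integrable_integral integrable_continuous continuous_on_subset[OF cf]) auto
  \<comment> \<open>A continuous nonnegative function with zero integral over the box would vanish
    at the centre, where all four factors are positive.\<close>
  have "I \<noteq> 0"
  proof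
    assume "I = 0"
    then have "(f has_integral 0) (cbox (-r, -r) (r, r))" using I by (simp add: B_def)
    moreover have "(0, 0) \<in> box (-r, -r) (r, r)" using r by (simp add: mem_box Basis_prod_def)
    ultimately have "f (0, 0) = 0"
      by (intro has_integral_0_cbox_imp_0[of "(-r,-r)" "(r,r)" f])
         (use cf f0 r in \<open>auto intro: continuous_on_subset\<close>)
    then show False using r by (simp add: f_def e1)
  qed
  moreover have "I \<ge> 0" using has_integral_nonneg[OF I] f0 by blast
  ultimately have I0: "I > 0" by simp
  show thesis
  proof (rule that[of "\<lambda>z. (1 / I) * f z"])
    show "Ck_on k (\<lambda>z. (1 / I) * f z) UNIV" for k using Ck by (intro Ck_on_mult Ck_on_const)
    show "0 \<le> 1 / I * f z" for z using I0 f0 by simp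
    show "1 / I * f z = 0" if "z \<notin> cbox (-r, -r) (r, r)" for z
    proof -
      have "fst z + r \<le> 0 \<or> r - fst z \<le> 0 \<or> snd z + r \<le> 0 \<or> r - snd z \<le> 0"
        using that by (cases z) (auto simp: cbox_Pair_eq)
      then show ?thesis by (auto simp: f_def e1)
    qed
    show "((\<lambda>z. 1 / I * f z) has_integral 1) (cbox (-r, -r) (r, r))"
      using has_integral_mult_right[OF I, of "1 / I"] I0 by (simp add: B_def)
  qed
qed

section \<open>Convolution and approximation by test functions\<close>

lemma continuous_on_convolution:
  fixes \<phi> \<eta> :: "plane \<Rightarrow> real"
  assumes "continuous_on (cbox a b) \<phi>" "continuous_on UNIV \<eta>"
  shows "continuous_on UNIV (\<lambda>z. integral (cbox a b) (\<lambda>w. \<phi> w * \<eta> (z - w)))"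
proof (rule integral_continuous_on_param)
  have "continuous_on (UNIV \<times> cbox a b) (\<lambda>p. \<phi> (snd p) * \<eta> (fst p - snd p))"
    by (intro continuous_intros continuous_on_compose2[OF assms(1)] continuous_on_compose2[OF assms(2)]) auto
  then show "continuous_on (UNIV \<times> cbox a b) (\<lambda>(z, w). \<phi> w * \<eta> (z - w))"
    by (simp add: case_prod_beta)
qed

text \<open>All derivatives fall on the kernel, so continuity of \<open>\<phi>\<close> is enough.
  The Leibniz rule is used with values in the linear functionals on the plane; the coordinate
  functionals \<open>F\<close> and \<open>G\<close> turn its result back into two partials.\<close>

lemma has_grad_convolution:
  fixes \<phi> \<eta> :: "plane \<Rightarrow> real"
  assumes \<phi>: "continuous_on (cbox a b) \<phi>"
    and \<eta>: "\<And>z. has_grad \<eta> (\<eta>x z) (\<eta>y z) z" "continuous_on UNIV \<eta>x" "continuous_on UNIV \<eta>y"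
  shows "has_grad (\<lambda>z. integral (cbox a b) (\<lambda>w. \<phi> w * \<eta> (z - w)))
     (integral (cbox a b) (\<lambda>w. \<phi> w * \<eta>x (z - w))) (integral (cbox a b) (\<lambda>w. \<phi> w * \<eta>y (z - w))) z"
proof -
  define F where "F = (Blinfun fst :: plane \<Rightarrow>\<^sub>L real)"
  define G where "G = (Blinfun snd :: plane \<Rightarrow>\<^sub>L real)"
  have FG: "blinfun_apply F = fst" "blinfun_apply G = snd"
    unfolding F_def G_def by (simp_all add: bounded_linear_Blinfun_apply bounded_linear_fst bounded_linear_snd)
  have c\<eta>: "continuous_on UNIV \<eta>"
    by (rule has_grad_continuous_on[OF \<eta>(1)])
  have int: "(\<lambda>w. \<phi> w * g (z - w)) integrable_on cbox a b" if "continuous_on UNIV g" for g z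
    by (intro integrable_continuous continuous_intros \<phi> continuous_on_compose2[OF that]) auto
  define D where "D z w = (\<phi> w * \<eta>x (z - w)) *\<^sub>R F + (\<phi> w * \<eta>y (z - w)) *\<^sub>R G" for z w
  have "((\<lambda>z. integral (cbox a b) (\<lambda>w. \<phi> w * \<eta> (z - w))) has_derivative
      blinfun_apply (integral (cbox a b) (D z))) (at z within UNIV)"
  proof (rule leibniz_rule)
    fix x t :: plane
    have "((\<lambda>x. x - t) has_derivative (\<lambda>h. h)) (at x)" by (auto intro!: derivative_eq_intros)
    from has_derivative_compose[OF this \<eta>(1)[unfolded has_grad_def, of "x - t"]]
    have "((\<lambda>x. \<eta> (x - t)) has_derivative (\<lambda>h. fst h * \<eta>x (x - t) + snd h * \<eta>y (x - t))) (at x)" .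
    from has_derivative_mult_right[OF this, of "\<phi> t"]
    show "((\<lambda>z. \<phi> t * \<eta> (z - t)) has_derivative blinfun_apply (D x t)) (at x within UNIV)"
      by (rule has_derivative_eq_rhs)
        (auto simp: D_def FG blinfun.bilinear_simps algebra_simps)
  next
    have "continuous_on (UNIV \<times> cbox a b) (\<lambda>p. D (fst p) (snd p))"
      unfolding D_def
      by (intro continuous_intros continuous_on_compose2[OF \<phi>] continuous_on_compose2[OF \<eta>(2)] continuous_on_compose2[OF \<eta>(3)]) auto
    then show "continuous_on (UNIV \<times> cbox a b) (\<lambda>(z, w). D z w)"
      by (simp add: case_prod_beta)
  qed (use int[OF c\<eta>] in auto)
  moreover have "integral (cbox a b) (D z) = integral (cbox a b) (\<lambda>w. \<phi> w * \<eta>x (z - w)) *\<^sub>R F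
      + integral (cbox a b) (\<lambda>w. \<phi> w * \<eta>y (z - w)) *\<^sub>R G"
    unfolding D_def
    by (intro integral_unique has_integral_add has_integral_scaleR_left integrable_integral int \<eta>)
  ultimately show ?thesis unfolding has_grad_def
    by (auto elim!: has_derivative_eq_rhs simp: blinfun.bilinear_simps FG mult.commute)
qed

lemma Ck_on_convolution:
  fixes \<phi> \<eta> :: "plane \<Rightarrow> real"
  assumes \<phi>: "continuous_on (cbox a b) \<phi>" and \<eta>: "Ck_on k \<eta> UNIV"
  shows "Ck_on k (\<lambda>z. integral (cbox a b) (\<lambda>w. \<phi> w * \<eta> (z - w))) UNIV"
  using \<eta>
proof (induction k arbitrary: \<eta>)
  case 0
  then show ?case using continuous_on_convolution[OF \<phi>] by (simp add: Ck_on.simps)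
next
  case (Suc k)
  obtain \<eta>x \<eta>y where \<eta>: "\<forall>z\<in>UNIV. has_grad \<eta> (\<eta>x z) (\<eta>y z) z" "Ck_on k \<eta>x UNIV" "Ck_on k \<eta>y UNIV"
    using Ck_on_SucE[OF Suc.prems] by blast
  show ?case
    by (rule Ck_on_SucI[OF has_grad_convolution[OF \<phi> \<eta>(1)[rule_format]]])
       (use \<eta> Suc.IH Ck_on_continuous in auto)
qed

text \<open>One form lets the kernel be differentiated, which gives smoothness; the other lets
  \<open>\<phi>\<close> be differentiated, which gives convergence of the gradients. The integrand
  vanishes off both supports, so the box \<open>cbox a b\<close> can be exchanged for a translate of
  the kernel's box, and the reflection \<open>z - w\<close> does the rest.\<close>

lemma integral_convolution_swap:
  fixes \<phi> \<eta> :: "plane \<Rightarrow> real"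
  assumes c: "continuous_on UNIV \<phi>" "continuous_on UNIV \<eta>"
    and \<phi>: "\<And>z. z \<notin> cbox a b \<Longrightarrow> \<phi> z = 0" and \<eta>: "\<And>z. z \<notin> cbox (-R) R \<Longrightarrow> \<eta> z = 0"
  shows "integral (cbox a b) (\<lambda>w. \<phi> w * \<eta> (z - w)) = integral (cbox (-R) R) (\<lambda>w. \<eta> w * \<phi> (z - w))"
proof -
  have mem: "z - w \<in> cbox (-R) R \<longleftrightarrow> w \<in> cbox (z - R) (z + R)" for w
    by (cases z; cases w; cases R) (auto simp: cbox_Pair_eq)
  have "integral (cbox a b) (\<lambda>w. \<phi> w * \<eta> (z - w)) = integral UNIV (\<lambda>w. if w \<in> cbox a b then \<phi> w * \<eta> (z - w) else 0)"
    by (simp add: integral_restrict_UNIV)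
  also have "(\<lambda>w. if w \<in> cbox a b then \<phi> w * \<eta> (z - w) else 0) =
     (\<lambda>w. if w \<in> cbox (z - R) (z + R) then \<phi> w * \<eta> (z - w) else 0)"
    using \<phi> \<eta> mem by (auto simp: fun_eq_iff)
  also have "integral UNIV \<dots> = integral (cbox (z - R) (z + R)) (\<lambda>w. \<phi> w * \<eta> (z - w))"
    by (simp add: integral_restrict_UNIV)
  finally have 1: "integral (cbox a b) (\<lambda>w. \<phi> w * \<eta> (z - w)) = integral (cbox (z - R) (z + R)) (\<lambda>w. \<phi> w * \<eta> (z - w))" .
  have "((\<lambda>w. \<phi> w * \<eta> (z - w)) has_integral integral (cbox (z - R) (z + R)) (\<lambda>w. \<phi> w * \<eta> (z - w))) (cbox (z - R) (z + R))"
    by (intro integrable_integral integrable_continuous continuous_intros continuous_on_compose2[OF c(1)] continuous_on_compose2[OF c(2)]) auto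
  from has_integral_affinity[OF this, of "-1" z]
  have "((\<lambda>x. \<phi> (z - x) * \<eta> x) has_integral integral (cbox (z - R) (z + R)) (\<lambda>w. \<phi> w * \<eta> (z - w)))
     ((\<lambda>x. - x + z) ` cbox (z - R) (z + R))"
    by (simp add: algebra_simps)
  moreover have "(\<lambda>x. - x + z) ` cbox (z - R) (z + R) = cbox (-R) R"
  proof (intro equalityI subsetI)
    fix w assume "w \<in> cbox (-R) R"
    then have "z - w \<in> cbox (z - R) (z + R)" using mem[of "z - w"] by simp
    then show "w \<in> (\<lambda>x. - x + z) ` cbox (z - R) (z + R)" by (rule rev_image_eqI) simp
  qed (use mem in auto)
  ultimately show ?thesis using 1 by (simp add: integral_unique mult.commute)
qed

text \<open>The gradient of the mollified function is an average of the gradient of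
  \<open>\<phi>\<close> against a kernel of mass one, so uniform continuity of
  \<open>\<phi>x\<close> and \<open>\<phi>y\<close> bounds the error.\<close>

lemma test_function_dense:
  fixes \<phi> :: "plane \<Rightarrow> real"
  assumes C: "compact C" "C \<subseteq> box a b"
    and \<phi>: "\<And>z. has_grad \<phi> (\<phi>x z) (\<phi>y z) z" "continuous_on UNIV \<phi>x" "continuous_on UNIV \<phi>y"
    and supp: "\<And>z. z \<notin> C \<Longrightarrow> \<phi> z = 0" and e: "e > 0"
  obtains \<psi> \<psi>x \<psi>y where "test_function (box a b) \<psi>" "\<And>z. has_grad \<psi> (\<psi>x z) (\<psi>y z) z"
    "continuous_on UNIV \<psi>x" "continuous_on UNIV \<psi>y"
    "\<And>z. z \<in> cbox a b \<Longrightarrow> \<bar>\<psi>x z - \<phi>x z\<bar> \<le> e" "\<And>z. z \<in> cbox a b \<Longrightarrow> \<bar>\<psi>y z - \<phi>y z\<bar> \<le> e"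
proof -
  \<comment> \<open>\<open>D\<close> contains all arguments \<open>z - w\<close> for kernels of
    half-side at most 1; the moduli of continuity can thus be fixed before the radius
    \<open>r\<close>.\<close>
  define D where "D = {x - y | x y. x \<in> cbox a b \<and> y \<in> cbox (-1, -1) (1, 1 :: real)}"
  have "compact D" unfolding D_def by (intro compact_differences) auto
  then have uc: "uniformly_continuous_on D \<phi>x" "uniformly_continuous_on D \<phi>y"
    using \<phi> by (auto intro!: compact_uniformly_continuous intro: continuous_on_subset)
  obtain d1 where d1: "d1 > 0" "\<And>x x'. x \<in> D \<Longrightarrow> x' \<in> D \<Longrightarrow> dist x' x < d1 \<Longrightarrow> dist (\<phi>x x') (\<phi>x x) < e"
    using uc(1) e unfolding uniformly_continuous_on_def by metis
  obtain d2 where d2: "d2 > 0" "\<And>x x'. x \<in> D \<Longrightarrow> x' \<in> D \<Longrightarrow> dist x' x < d2 \<Longrightarrow> dist (\<phi>y x') (\<phi>y x) < e"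
    using uc(2) e unfolding uniformly_continuous_on_def by metis
  obtain d3 where d3: "d3 > 0" "(\<Union>x\<in>C. ball x d3) \<subseteq> box a b"
    using compact_subset_open_imp_ball_epsilon_subset[OF C(1) open_box C(2)] by blast
  \<comment> \<open>Points of the square of half-side \<open>r\<close> have norm at most
    \<open>2 * r\<close>; the thirds push this below \<open>d1\<close>, \<open>d2\<close> and
    \<open>d3\<close>. The bound by \<open>d3\<close> keeps the enlarged support inside the
    box.\<close>
  define r where "r = min (1 / 2) (min (d1 / 3) (min (d2 / 3) (d3 / 3)))"
  have r: "r > 0" "r \<le> 1" "2 * r < d1" "2 * r < d2" "2 * r < d3"
    using d1 d2 d3 by (auto simp: r_def min_def)
  define R where "R = (r, r)"
  have nw: "norm w \<le> 2 * r" if "w \<in> cbox (-R) R" for w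
  proof -
    have "norm w \<le> \<bar>fst w\<bar> + \<bar>snd w\<bar>" using norm_Pair_le[of "fst w" "snd w"] by simp
    also have "\<dots> \<le> 2 * r" using that by (cases w) (auto simp: R_def cbox_Pair_eq)
    finally show ?thesis .
  qed
  obtain \<eta> where \<eta>: "\<And>k. Ck_on k \<eta> UNIV" "\<And>z. 0 \<le> \<eta> z"
    "\<And>z. z \<notin> cbox (-R) R \<Longrightarrow> \<eta> z = 0" "(\<eta> has_integral 1) (cbox (-R) R)"
    using smooth_bump[OF r(1)] unfolding R_def by (metis uminus_Pair)
  have c\<eta>: "continuous_on UNIV \<eta>" using \<eta> Ck_on_continuous by blast
  have c\<phi>: "continuous_on UNIV \<phi>"
    by (rule has_grad_continuous_on[OF \<phi>(1)])
  define \<psi> where "\<psi> z = integral (cbox a b) (\<lambda>w. \<phi> w * \<eta> (z - w))" for z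
  have \<psi>_eq: "\<psi> = (\<lambda>z. integral (cbox (-R) R) (\<lambda>w. \<eta> w * \<phi> (z - w)))"
    unfolding \<psi>_def
    by (intro ext integral_convolution_swap c\<phi> c\<eta> \<eta>(3)) (use supp C box_subset_cbox[of a b] in blast)+
  define \<psi>x where "\<psi>x z = integral (cbox (-R) R) (\<lambda>w. \<eta> w * \<phi>x (z - w))" for z
  define \<psi>y where "\<psi>y z = integral (cbox (-R) R) (\<lambda>w. \<eta> w * \<phi>y (z - w))" for z
  have c\<eta>': "continuous_on (cbox (-R) R) \<eta>" using c\<eta> continuous_on_subset by blast
  have close: "\<bar>integral (cbox (-R) R) (\<lambda>w. \<eta> w * g (z - w)) - g z\<bar> \<le> e"
    if z: "z \<in> cbox a b" and g: "continuous_on UNIV g"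
      and d: "2 * r < d" "\<And>x x'. x \<in> D \<Longrightarrow> x' \<in> D \<Longrightarrow> dist x' x < d \<Longrightarrow> dist (g x') (g x) < e" for z g d
  proof -
    let ?I = "integral (cbox (-R) R) (\<lambda>w. \<eta> w * g (z - w))"
    have 1: "((\<lambda>w. \<eta> w * g (z - w)) has_integral ?I) (cbox (-R) R)"
      by (intro integrable_integral integrable_continuous continuous_intros c\<eta>' continuous_on_compose2[OF g]) auto
    have I1: "((\<lambda>w. \<eta> w * g (z - w) - \<eta> w * g z) has_integral
       (?I - 1 * g z)) (cbox (-R) R)"
      by (intro has_integral_diff has_integral_mult_left \<eta>(4) 1)
    have I2: "((\<lambda>w. \<eta> w * e) has_integral (1 * e)) (cbox (-R) R)"
      by (intro has_integral_mult_left \<eta>(4))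
    have "norm (\<eta> w * g (z - w) - \<eta> w * g z) \<le> \<eta> w * e" if w: "w \<in> cbox (-R) R" for w
    proof -
      have w1: "w \<in> cbox (-1, -1) (1, 1)" using w r by (cases w) (auto simp: R_def cbox_Pair_eq)
      have zw: "z - w \<in> D" using z w1 unfolding D_def by blast
      have "(0 :: real, 0) \<in> cbox (-1, -1) (1, 1 :: real)" unfolding cbox_Pair_eq by simp
      then have "z - (0, 0) \<in> D" using z unfolding D_def by blast
      then have "z \<in> D" by (cases z) simp
      then have "dist (g (z - w)) (g z) < e"
        using d zw nw[OF w] by (simp add: dist_norm)
      then have "\<bar>g (z - w) - g z\<bar> \<le> e" by (simp add: dist_real_def)
      moreover have "norm (\<eta> w * g (z - w) - \<eta> w * g z) = \<eta> w * \<bar>g (z - w) - g z\<bar>"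
        using \<eta>(2)[of w] by (simp add: abs_mult flip: right_diff_distrib)
      ultimately show ?thesis using \<eta>(2)[of w] by (simp add: mult_left_mono)
    qed
    then have "norm (integral (cbox (-R) R) (\<lambda>w. \<eta> w * g (z - w) - \<eta> w * g z)) \<le> integral (cbox (-R) R) (\<lambda>w. \<eta> w * e)"
      by (intro integral_norm_bound_integral has_integral_integrable[OF I1] has_integral_integrable[OF I2])
    then have "norm (?I - 1 * g z) \<le> 1 * e"
      unfolding integral_unique[OF I1] integral_unique[OF I2] .
    then show ?thesis by simp
  qed
  show thesis
  proof (rule that[of \<psi> \<psi>x \<psi>y])
    show "has_grad \<psi> (\<psi>x z) (\<psi>y z) z" for z
      unfolding \<psi>_eq \<psi>x_def \<psi>y_def by (rule has_grad_convolution[OF c\<eta>' \<phi>])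
    show "continuous_on UNIV \<psi>x" "continuous_on UNIV \<psi>y"
      unfolding \<psi>x_def \<psi>y_def using continuous_on_convolution[OF c\<eta>'] \<phi> by auto
    show "\<bar>\<psi>x z - \<phi>x z\<bar> \<le> e" if "z \<in> cbox a b" for z
      unfolding \<psi>x_def using close[OF that \<phi>(2) r(3) d1(2)] .
    show "\<bar>\<psi>y z - \<phi>y z\<bar> \<le> e" if "z \<in> cbox a b" for z
      unfolding \<psi>y_def using close[OF that \<phi>(3) r(4) d2(2)] .
    define C' where "C' = {x + y | x y. x \<in> C \<and> y \<in> cbox (-R) R}"
    have C': "compact C'" unfolding C'_def using C by (intro compact_sums) auto
    have "C' \<subseteq> box a b"
    proof
      fix z assume "z \<in> C'"
      then obtain x y where xy: "z = x + y" "x \<in> C" "y \<in> cbox (-R) R" by (auto simp: C'_def)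
      have "z \<in> ball x d3" using nw[OF xy(3)] r(5) xy by (simp add: dist_norm)
      then show "z \<in> box a b" using d3(2) xy(2) by blast
    qed
    have "\<psi> z = 0" if z: "z \<notin> C'" for z
    proof -
      have "\<eta> w * \<phi> (z - w) = 0" if "w \<in> cbox (-R) R" for w
      proof -
        have "z - w \<notin> C"
        proof
          assume "z - w \<in> C"
          then have "(z - w) + w \<in> C'" using that unfolding C'_def by blast
          then show False using z by simp
        qed
        then show ?thesis using supp by simp
      qed
      then have "integral (cbox (-R) R) (\<lambda>w. \<eta> w * \<phi> (z - w)) = integral (cbox (-R) R) (\<lambda>w. 0)"
        by (rule integral_cong)
      then show ?thesis unfolding \<psi>_eq by simp
    qed
    then have "{z. \<psi> z \<noteq> 0} \<subseteq> C'" by blast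
    then have cl: "closure {z. \<psi> z \<noteq> 0} \<subseteq> C'" using C' by (simp add: closure_minimal compact_imp_closed)
    then have "compact (closure {z. \<psi> z \<noteq> 0})"
      using C' compact_Int_closed[of C' "closure {z. \<psi> z \<noteq> 0}"] by (simp add: inf_absorb2)
    moreover have "Ck_on k \<psi> UNIV" for k unfolding \<psi>_def
      using c\<phi> \<eta>(1) by (intro Ck_on_convolution) (auto intro: continuous_on_subset)
    ultimately show "test_function (box a b) \<psi>"
      unfolding test_function_def using cl \<open>C' \<subseteq> box a b\<close> by blast
  qed
qed

section \<open>Weak solutions across an interface\<close>

lemma mem_box_plane: "z \<in> box (a, b) (c, d) \<longleftrightarrow> a < fst z \<and> fst z < c \<and> b < snd z \<and> snd z < (d::real)"
  for a c :: real
  by (cases z) (auto simp: mem_box Basis_prod_def)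

lemma integral_zeroI:
  "(\<And>x. x \<in> S \<Longrightarrow> f x = 0) \<Longrightarrow> integral S f = 0"
  using integral_cong[of S f "\<lambda>_. 0"] by simp

text \<open>Fubini reduces the claim to vertical lines, and there the fundamental theorem leaves
  only end values; the end points lie outside the open box, where \<open>f\<close> vanishes.\<close>

lemma integral_dy_zero:
  fixes f :: "plane \<Rightarrow> real"
  assumes f: "\<And>z. z \<in> cbox (a1, a2) (b1, b2) \<Longrightarrow> has_grad f (fx z) (fy z) z"
    and c: "continuous_on (cbox (a1, a2) (b1, b2)) fy" and 0: "\<And>z. z \<notin> box (a1, a2) (b1, b2) \<Longrightarrow> f z = 0"
  shows "integral (cbox (a1, a2) (b1, b2)) fy = 0"
proof -
  have "integral (cbox a2 b2) (\<lambda>y. fy (x, y)) = 0" if x: "x \<in> cbox a1 b1" for x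
  proof (cases "a2 \<le> b2")
    case True
    have "((\<lambda>y. fy (x, y)) has_integral f (x, b2) - f (x, a2)) {a2..b2}"
    proof (rule fundamental_theorem_of_calculus[OF True])
      fix y assume "y \<in> {a2..b2}"
      then have "DERIV (\<lambda>y. f (x, y)) y :> fy (x, y)"
        using x by (intro has_grad_partials(2)[OF f]) (auto simp: cbox_Pair_eq)
      then show "((\<lambda>y. f (x, y)) has_vector_derivative fy (x, y)) (at y within {a2..b2})"
        by (simp add: has_real_derivative_iff_has_vector_derivative has_vector_derivative_at_within)
    qed
    moreover have "f (x, b2) = 0" "f (x, a2) = 0" using 0 by (auto simp: mem_box_plane)
    ultimately show ?thesis by (simp add: integral_unique)
  qed simp
  then show ?thesis unfolding integral_prod_continuous[OF c] by (rule integral_zeroI)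
qed

lemma integral_dx_zero:
  fixes f :: "plane \<Rightarrow> real"
  assumes f: "\<And>z. z \<in> cbox (a1, a2) (b1, b2) \<Longrightarrow> has_grad f (fx z) (fy z) z"
    and c: "continuous_on (cbox (a1, a2) (b1, b2)) fx" and 0: "\<And>z. z \<notin> box (a1, a2) (b1, b2) \<Longrightarrow> f z = 0"
  shows "integral (cbox (a1, a2) (b1, b2)) fx = 0"
proof -
  have "integral (cbox (a2, a1) (b2, b1)) (\<lambda>z. fx (snd z, fst z)) = 0"
  proof (rule integral_dy_zero)
    fix z assume "z \<in> cbox (a2, a1) (b2, b1)"
    then have "(snd z, fst z) \<in> cbox (a1, a2) (b1, b2)" by (cases z) (simp add: cbox_Pair_eq)
    from has_grad_compose[OF f[OF this] has_grad_snd has_grad_fst]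
    show "has_grad (\<lambda>z. f (snd z, fst z)) (fy (snd z, fst z)) (fx (snd z, fst z)) z" by simp
  next
    show "continuous_on (cbox (a2, a1) (b2, b1)) (\<lambda>z. fx (snd z, fst z))"
      by (rule continuous_on_compose2[OF c]) (auto simp: cbox_Pair_eq intro!: continuous_intros)
  qed (auto simp: mem_box_plane intro!: 0)
  then show ?thesis
    using integral_swap_2dim[of a1 a2 b1 b2 "\<lambda>x y. fx (x, y)"] c by (simp add: case_prod_beta')
qed

text \<open>The integrand is the divergence of the field \<open>(u, v)\<close> multiplied by
  \<open>\<psi>\<close>, and \<open>\<psi>\<close> vanishes off the open box.\<close>

lemma integral_by_parts_box:
  fixes a b :: plane
  assumes u: "\<And>z. z \<in> cbox a b \<Longrightarrow> has_grad u (ux z) (uy z) z" "continuous_on (cbox a b) ux"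
    and v: "\<And>z. z \<in> cbox a b \<Longrightarrow> has_grad v (vx z) (vy z) z" "continuous_on (cbox a b) vy"
    and \<psi>: "\<And>z. has_grad \<psi> (\<psi>x z) (\<psi>y z) z" "continuous_on UNIV \<psi>x" "continuous_on UNIV \<psi>y"
      "\<And>z. z \<notin> box a b \<Longrightarrow> \<psi> z = 0"
  shows "((\<lambda>z. u z * \<psi>x z + v z * \<psi>y z + (ux z + vy z) * \<psi> z) has_integral 0) (cbox a b)"
proof -
  obtain a1 a2 b1 b2 where ab: "a = (a1, a2)" "b = (b1, b2)" by (cases a; cases b) auto
  have cu: "continuous_on (cbox a b) u" "continuous_on (cbox a b) v" "continuous_on (cbox a b) \<psi>"
    by (rule has_grad_continuous_on, (erule u(1) v(1) | rule \<psi>(1)))+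
  have cp: "continuous_on (cbox a b) \<psi>x" "continuous_on (cbox a b) \<psi>y"
    using \<psi> continuous_on_subset by blast+
  have c1: "continuous_on (cbox a b) (\<lambda>z. ux z * \<psi> z + u z * \<psi>x z)"
    and c2: "continuous_on (cbox a b) (\<lambda>z. vy z * \<psi> z + v z * \<psi>y z)"
    using cu cp u v by (auto intro!: continuous_intros)
  have 1: "integral (cbox a b) (\<lambda>z. ux z * \<psi> z + u z * \<psi>x z) = 0"
    using c1 unfolding ab
    by (rule integral_dx_zero[rotated, where f="\<lambda>z. u z * \<psi> z" and fy="\<lambda>z. uy z * \<psi> z + u z * \<psi>y z"])
       (use u \<psi> has_grad_mult in \<open>auto simp: ab\<close>)
  have 2: "integral (cbox a b) (\<lambda>z. vy z * \<psi> z + v z * \<psi>y z) = 0"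
    using c2 unfolding ab
    by (rule integral_dy_zero[rotated, where f="\<lambda>z. v z * \<psi> z" and fx="\<lambda>z. vx z * \<psi> z + v z * \<psi>x z"])
       (use v \<psi> has_grad_mult in \<open>auto simp: ab\<close>)
  have "((\<lambda>z. (ux z * \<psi> z + u z * \<psi>x z) + (vy z * \<psi> z + v z * \<psi>y z)) has_integral (0 + 0)) (cbox a b)"
    using c1 c2 1 2 by (intro has_integral_add) (metis integrable_continuous integrable_integral)+
  then show ?thesis by (simp add: algebra_simps)
qed

lemma absolutely_integrable_if_open:
  fixes g :: "plane \<Rightarrow> real"
  assumes "continuous_on (cbox a b) g" "open E"
  shows "(\<lambda>z. if z \<in> E then g z else 0) absolutely_integrable_on cbox a b"
proof -
  have "g absolutely_integrable_on (cbox a b)"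
    by (rule absolutely_integrable_continuous[OF assms(1)])
  then have "g absolutely_integrable_on (cbox a b \<inter> E)"
    by (rule set_integrable_subset) (use assms in \<open>auto intro: borel_open sets.Int\<close>)
  moreover have "(\<lambda>z. indicat_real (cbox a b \<inter> E) z *\<^sub>R g z) =
     (\<lambda>z. indicat_real (cbox a b) z *\<^sub>R (if z \<in> E then g z else 0))"
    by (auto simp: indicator_def)
  ultimately show ?thesis unfolding set_integrable_def by simp
qed

lemma has_grad_zero_outside:
  assumes "closed C" "\<And>z. z \<notin> C \<Longrightarrow> f z = 0" "z \<notin> C" "has_grad f a b z"
  shows "a = 0 \<and> b = 0"
proof -
  have "has_grad f 0 0 z"
    by (rule has_grad_transform_open[OF has_grad_const[of 0], of "- C"]) (use assms in auto)
  then show ?thesis using has_grad_unique assms(4) by blast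
qed

text \<open>No regularity of the interface enters: \<open>(u, v)\<close> is differentiable on the
  whole box, so its own equation follows by parts there, and the difference with the weak equation
  is exactly the integral over \<open>E\<close>.\<close>

lemma weak_solution_jump:
  fixes a b :: plane
  assumes weak: "weak_solution \<Omega> H \<theta>" and ab: "cbox a b \<subseteq> \<Omega>"
    and u: "\<And>z. z \<in> cbox a b \<Longrightarrow> has_grad u (ux z) (uy z) z" "continuous_on (cbox a b) ux"
    and v: "\<And>z. z \<in> cbox a b \<Longrightarrow> has_grad v (vx z) (vy z) z" "continuous_on (cbox a b) vy"
    and div: "\<And>z. z \<in> cbox a b \<Longrightarrow> ux z + vy z = H z" and H: "continuous_on (cbox a b) H"
    and W: "continuous_on (cbox a b) W1" "continuous_on (cbox a b) W2"
    and E: "open E" and Z: "negligible Z"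
    and in_E: "\<And>z. z \<in> cbox a b - Z \<Longrightarrow> z \<in> E \<Longrightarrow> Nvec (\<theta> z) = (u z + W1 z, v z + W2 z)"
    and not_E: "\<And>z. z \<in> cbox a b - Z \<Longrightarrow> z \<notin> E \<Longrightarrow> Nvec (\<theta> z) = (u z, v z)"
    and \<psi>: "test_function (box a b) \<psi>" "\<And>z. has_grad \<psi> (\<psi>x z) (\<psi>y z) z"
      "continuous_on UNIV \<psi>x" "continuous_on UNIV \<psi>y"
  shows "integral (cbox a b) (\<lambda>z. if z \<in> E then W1 z * \<psi>x z + W2 z * \<psi>y z else 0) = 0"
proof -
  define C where "C = closure {z. \<psi> z \<noteq> 0}"
  have C: "compact C" "C \<subseteq> box a b" using \<psi>(1) by (auto simp: test_function_def C_def)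
  have C0: "\<psi> z = 0" if "z \<notin> C" for z using that closure_subset[of "{z. \<psi> z \<noteq> 0}"] by (auto simp: C_def)
  have D0: "\<psi>x z = 0 \<and> \<psi>y z = 0" if "z \<notin> C" for z
    by (rule has_grad_zero_outside[OF compact_imp_closed[OF C(1)] C0 that \<psi>(2)])
  have Ccb: "C \<subseteq> cbox a b" using C box_subset_cbox by blast
  have "test_function \<Omega> \<psi>" using \<psi>(1) Ccb ab by (auto simp: test_function_def C_def)
  then have w: "(LINT z:\<Omega>|lebesgue. frechet_derivative \<psi> (at z) (Nvec (\<theta> z))) + (LINT z:\<Omega>|lebesgue. H z * \<psi> z) = 0"
    using weak unfolding weak_solution_def by blast
  define f where "f z = cos (\<theta> z) * \<psi>x z + sin (\<theta> z) * \<psi>y z" for z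
  have "frechet_derivative \<psi> (at z) (Nvec (\<theta> z)) = f z" for z
    using frechet_derivative_at[OF \<psi>(2)[unfolded has_grad_def], symmetric] by (simp add: f_def Nvec_def)
  then have w: "(LINT z:\<Omega>|lebesgue. f z) + (LINT z:\<Omega>|lebesgue. H z * \<psi> z) = 0"
    using w by simp
  \<comment> \<open>Every integrand vanishes off the support \<open>C\<close>, so the Lebesgue
    integral over \<open>\<Omega>\<close> reduces to the box, where it can be exchanged for a gauge
    integral.\<close>
  have red: "(LINT z:\<Omega>|lebesgue. g z) = (LINT z:cbox a b|lebesgue. g z)" if "\<And>z. z \<notin> C \<Longrightarrow> g z = 0" for g :: "plane \<Rightarrow> real"
  proof -
    have "(\<lambda>z. indicat_real \<Omega> z *\<^sub>R g z) = (\<lambda>z. indicat_real (cbox a b) z *\<^sub>R g z)"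
      using that Ccb ab by (fastforce simp: indicator_def)
    then show ?thesis unfolding set_lebesgue_integral_def by simp
  qed
  have cp: "continuous_on (cbox a b) \<psi>x" "continuous_on (cbox a b) \<psi>y"
    using \<psi> continuous_on_subset by blast+
  have cu: "continuous_on (cbox a b) u" "continuous_on (cbox a b) v" "continuous_on (cbox a b) \<psi>"
    by (rule has_grad_continuous_on, (erule u(1) v(1) | rule \<psi>(2)))+
  define f0 where "f0 z = u z * \<psi>x z + v z * \<psi>y z" for z
  define f1 where "f1 z = (if z \<in> E then W1 z * \<psi>x z + W2 z * \<psi>y z else 0)" for z
  have ai0: "f0 absolutely_integrable_on cbox a b" unfolding f0_def
    by (intro absolutely_integrable_continuous continuous_intros cu cp)
  have ai1: "f1 absolutely_integrable_on cbox a b" unfolding f1_def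
    by (intro absolutely_integrable_if_open continuous_intros W cp E)
  have aiH: "(\<lambda>z. H z * \<psi> z) absolutely_integrable_on cbox a b"
    by (intro absolutely_integrable_continuous continuous_intros H cu)
  have ai01: "(\<lambda>z. f0 z + f1 z) absolutely_integrable_on cbox a b"
    by (rule set_integral_add(1)[OF ai0 ai1])
  have eq: "f z = f0 z + f1 z" if "z \<in> cbox a b - Z" for z
    using in_E[OF that] not_E[OF that] by (auto simp: Nvec_def f_def f0_def f1_def algebra_simps)
  \<comment> \<open>Integrability of \<open>f\<close> is inferred from its agreement off
    \<open>Z\<close> with an integrable function, since \<open>\<theta>\<close> is arbitrary on
    \<open>Z\<close>.\<close>
  have aif: "f absolutely_integrable_on cbox a b"
    by (rule absolutely_integrable_spike[OF ai01 Z]) (use eq in auto)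
  have "(LINT z:\<Omega>|lebesgue. f z) = integral (cbox a b) f"
    using D0 by (subst red) (auto simp: f_def intro!: set_lebesgue_integral_eq_integral(2) aif[unfolded f_def])
  also have "\<dots> = integral (cbox a b) (\<lambda>z. f0 z + f1 z)"
    by (rule integral_spike[OF Z]) (use eq in auto)
  also have "\<dots> = integral (cbox a b) f0 + integral (cbox a b) f1"
    using ai0 ai1 by (intro integral_add) (auto simp: absolutely_integrable_on_def)
  finally have 1: "(LINT z:\<Omega>|lebesgue. f z) = integral (cbox a b) f0 + integral (cbox a b) f1" .
  have 2: "(LINT z:\<Omega>|lebesgue. H z * \<psi> z) = integral (cbox a b) (\<lambda>z. H z * \<psi> z)"
    using C0 by (subst red) (auto intro!: set_lebesgue_integral_eq_integral(2) aiH)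
  have "((\<lambda>z. u z * \<psi>x z + v z * \<psi>y z + (ux z + vy z) * \<psi> z) has_integral 0) (cbox a b)"
    by (rule integral_by_parts_box[OF u v \<psi>(2-4)]) (use C C0 in auto)
  then have "((\<lambda>z. f0 z + H z * \<psi> z) has_integral 0) (cbox a b)"
    by (rule has_integral_eq[rotated]) (use div in \<open>auto simp: f0_def\<close>)
  moreover have "integral (cbox a b) (\<lambda>z. f0 z + H z * \<psi> z) = integral (cbox a b) f0 + integral (cbox a b) (\<lambda>z. H z * \<psi> z)"
    using ai0 aiH by (intro integral_add) (auto simp: absolutely_integrable_on_def)
  ultimately have "integral (cbox a b) f0 + integral (cbox a b) (\<lambda>z. H z * \<psi> z) = 0"
    by (simp add: integral_unique)
  then show ?thesis using w 1 2 unfolding f1_def by simp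
qed

text \<open>The integral depends continuously on the gradient of the test function: a gradient error
  \<open>e\<close> changes it by at most \<open>e * (M * c)\<close>, where \<open>M\<close> exceeds
  the sum of the bounds for \<open>W1\<close> and \<open>W2\<close> and \<open>c\<close> is the area
  of the box. This admits test functions that are only as smooth as the potential.\<close>

lemma weak_divergence_free_C1:
  fixes a b :: plane
  assumes test: "\<And>\<psi> \<psi>x \<psi>y. test_function (box a b) \<psi> \<Longrightarrow> (\<And>z. has_grad \<psi> (\<psi>x z) (\<psi>y z) z) \<Longrightarrow>
      continuous_on UNIV \<psi>x \<Longrightarrow> continuous_on UNIV \<psi>y \<Longrightarrow>
      integral (cbox a b) (\<lambda>z. if z \<in> E then W1 z * \<psi>x z + W2 z * \<psi>y z else 0) = 0"
    and W: "continuous_on (cbox a b) W1" "continuous_on (cbox a b) W2" and E: "open E"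
    and C: "compact C" "C \<subseteq> box a b" "\<And>z. z \<notin> C \<Longrightarrow> \<phi> z = 0"
    and \<phi>: "\<And>z. has_grad \<phi> (\<phi>x z) (\<phi>y z) z" "continuous_on UNIV \<phi>x" "continuous_on UNIV \<phi>y"
  shows "integral (cbox a b) (\<lambda>z. if z \<in> E then W1 z * \<phi>x z + W2 z * \<phi>y z else 0) = 0" (is "?I = 0")
proof -
  have "bounded (W1 ` cbox a b)" "bounded (W2 ` cbox a b)"
    using W by (auto intro!: compact_imp_bounded compact_continuous_image)
  then obtain M1 M2 where M: "\<And>z. z \<in> cbox a b \<Longrightarrow> \<bar>W1 z\<bar> \<le> M1" "\<And>z. z \<in> cbox a b \<Longrightarrow> \<bar>W2 z\<bar> \<le> M2"
    by (auto simp: bounded_iff)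
  define M where "M = \<bar>M1\<bar> + \<bar>M2\<bar> + 1"
  have M0: "M > 0" by (simp add: M_def)
  define c where "c = Sigma_Algebra.measure lborel (cbox a b)"
  have c0: "c \<ge> 0" by (simp add: c_def)
  have small: "\<bar>?I\<bar> \<le> e * (M * c)" if e: "e > 0" for e
  proof -
    obtain \<psi> \<psi>x \<psi>y where \<psi>: "test_function (box a b) \<psi>" "\<And>z. has_grad \<psi> (\<psi>x z) (\<psi>y z) z"
      "continuous_on UNIV \<psi>x" "continuous_on UNIV \<psi>y"
      "\<And>z. z \<in> cbox a b \<Longrightarrow> \<bar>\<psi>x z - \<phi>x z\<bar> \<le> e" "\<And>z. z \<in> cbox a b \<Longrightarrow> \<bar>\<psi>y z - \<phi>y z\<bar> \<le> e"
      using test_function_dense[OF C(1,2) \<phi> C(3) e] by blast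
    have int: "(\<lambda>z. if z \<in> E then W1 z * f z + W2 z * g z else 0) integrable_on cbox a b"
      if "continuous_on UNIV f" "continuous_on UNIV g" for f g
    proof -
      have "continuous_on (cbox a b) f" "continuous_on (cbox a b) g"
        using that continuous_on_subset by blast+
      then have "continuous_on (cbox a b) (\<lambda>z. W1 z * f z + W2 z * g z)"
        using W by (intro continuous_intros)
      then show ?thesis
        using absolutely_integrable_if_open[OF _ E] by (simp add: absolutely_integrable_on_def)
    qed
    have "((\<lambda>z. (if z \<in> E then W1 z * \<phi>x z + W2 z * \<phi>y z else 0) - (if z \<in> E then W1 z * \<psi>x z + W2 z * \<psi>y z else 0))
       has_integral (?I - 0)) (cbox a b)"
      using integrable_integral[OF int[OF \<phi>(2,3)]] integrable_integral[OF int[OF \<psi>(3,4)]]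
      unfolding test[OF \<psi>(1-4)] by (rule has_integral_diff)
    then have "norm (?I - 0) \<le> (e * M) * c" unfolding c_def
    proof (rule has_integral_bound[rotated])
      fix z assume z: "z \<in> cbox a b"
      have "\<bar>W1 z * (\<phi>x z - \<psi>x z) + W2 z * (\<phi>y z - \<psi>y z)\<bar> \<le> \<bar>W1 z\<bar> * \<bar>\<phi>x z - \<psi>x z\<bar> + \<bar>W2 z\<bar> * \<bar>\<phi>y z - \<psi>y z\<bar>"
        by (metis abs_mult abs_triangle_ineq)
      also have "\<dots> \<le> \<bar>M1\<bar> * e + \<bar>M2\<bar> * e"
        using M[OF z] \<psi>(5,6)[OF z] e by (intro add_mono mult_mono) (auto simp: abs_minus_commute)
      also have "\<dots> \<le> e * M" using e by (simp add: M_def algebra_simps)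
      finally show "norm ((if z \<in> E then W1 z * \<phi>x z + W2 z * \<phi>y z else 0) - (if z \<in> E then W1 z * \<psi>x z + W2 z * \<psi>y z else 0)) \<le> e * M"
        using e M0 by (auto simp: algebra_simps)
    qed (use e M0 in auto)
    then show ?thesis by (simp add: mult.assoc)
  qed
  show ?thesis
  proof (rule ccontr)
    assume ne: "?I \<noteq> 0"
    \<comment> \<open>The summand 1 keeps the denominator positive; the factor 2 makes the resulting
      bound at most half of the integral's absolute value.\<close>
    define e where "e = \<bar>?I\<bar> / (2 * (M * c + 1))"
    have Mc: "M * c \<ge> 0" using M0 c0 by simp
    then have e0: "e > 0" using ne by (simp add: e_def)
    have "e * (M * c) < \<bar>?I\<bar>"
    proof -
      have "e * (M * c) \<le> e * (M * c + 1)" using e0 by simp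
      also have "\<dots> = \<bar>?I\<bar> / 2" using Mc by (simp add: e_def field_simps)
      also have "\<dots> < \<bar>?I\<bar>" using ne by simp
      finally show ?thesis .
    qed
    with small[OF e0] show False by simp
  qed
qed

section \<open>Cut-off functions and the crossing argument\<close>

text \<open>The quotient of e(t + r) by e(t + r) + e(r - t): as r is positive, one of the two
  arguments is positive and the denominator never vanishes. A step is wanted besides a bump because
  its derivative has one sign.\<close>

lemma smooth_step:
  fixes r :: real assumes r: "r > 0"
  obtains A k where "\<And>t. DERIV A t :> k t" "continuous_on UNIV k" "\<And>t. 0 \<le> k t" "0 < k 0"
    "\<And>t. \<bar>t\<bar> \<ge> r \<Longrightarrow> k t = 0" "\<And>t. t \<le> -r \<Longrightarrow> A t = 0" "\<And>t. t \<ge> r \<Longrightarrow> A t = (1 :: real)"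
proof -
  define e where "e = flat_exp 1"
  define e' where "e' = flat_exp [:0, 0, 1:]"
  note e = flat_exp_1[folded e_def] flat_exp_01[folded e'_def]
  note c = continuous_on_flat_exp[of 1, folded e_def] continuous_on_flat_exp[of "[:0, 0, 1:]", folded e'_def]
  define s where "s t = e (t + r) + e (r - t)" for t
  have "e (t + r) > 0 \<or> e (r - t) > 0" for t
    using e(1)[of "t + r"] e(1)[of "r - t"] e(2)[of "t + r"] e(2)[of "r - t"] r by linarith
  then have s0: "s t > 0" for t unfolding s_def using e(1) add_pos_nonneg add_nonneg_pos by blast
  define A where "A t = e (t + r) / s t" for t
  define k where "k t = (e' (t + r) * e (r - t) + e (t + r) * e' (r - t)) / (s t)\<^sup>2" for t
  have dA: "DERIV A t :> k t" for t
  proof -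
    have "DERIV A t :> (e' (t + r) * s t - e (t + r) * (e' (t + r) + - e' (r - t))) / (s t * s t)"
      unfolding A_def s_def
      by (intro DERIV_divide DERIV_add DERIV_flat_exp_1_shift[folded e_def e'_def])
         (use s0[of t] in \<open>simp add: s_def\<close>)
    moreover have "(e' (t + r) * s t - e (t + r) * (e' (t + r) + - e' (r - t))) / (s t * s t) = k t"
      by (simp add: k_def power2_eq_square s_def algebra_simps)
    ultimately show ?thesis by simp
  qed
  show thesis
  proof (rule that[OF dA])
    have "continuous_on UNIV s" unfolding s_def
      by (intro continuous_intros continuous_on_compose2[OF c(1)]) auto
    then show "continuous_on UNIV k" unfolding k_def
      by (intro continuous_intros continuous_on_compose2[OF c(1)] continuous_on_compose2[OF c(2)])
         (use s0 in \<open>auto simp: less_imp_neq[THEN not_sym]\<close>)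
    show "0 \<le> k t" for t unfolding k_def using e by simp
    have "e' r > 0" "e r > 0" using e(1,3)[of r] e(2,4)[of r] r by linarith+
    then show "0 < k 0" unfolding k_def using s0[of 0] by (intro divide_pos_pos add_pos_pos mult_pos_pos) auto
    show "k t = 0" if "\<bar>t\<bar> \<ge> r" for t
    proof -
      have "t + r \<le> 0 \<or> r - t \<le> 0" using that by linarith
      then have "e (t + r) = 0 \<and> e' (t + r) = 0 \<or> e (r - t) = 0 \<and> e' (r - t) = 0" using e(2,4) by blast
      then show ?thesis unfolding k_def by auto
    qed
    show "A t = 0" if "t \<le> -r" for t unfolding A_def using that e(2)[of "t + r"] by simp
    show "A t = 1" if "t \<ge> r" for t
    proof -
      have "e (r - t) = 0" using that e(2) by simp
      then show ?thesis unfolding A_def using s0[of t] by (simp add: s_def)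
    qed
  qed
qed

lemma C1_bump:
  fixes r :: real assumes r: "r > 0"
  obtains A k where "\<And>t. DERIV A t :> k t" "continuous_on UNIV k" "\<And>t. 0 \<le> A t" "0 < A 0"
    "\<And>t. \<bar>t\<bar> \<ge> r \<Longrightarrow> A t = (0 :: real)"
proof -
  define e where "e = flat_exp 1"
  define e' where "e' = flat_exp [:0, 0, 1:]"
  note e = flat_exp_1[folded e_def]
  note c = continuous_on_flat_exp[of 1, folded e_def] continuous_on_flat_exp[of "[:0, 0, 1:]", folded e'_def]
  define A where "A t = e (t + r) * e (r - t)" for t
  define k where "k t = e' (t + r) * e (r - t) + - e' (r - t) * e (t + r)" for t
  show thesis
  proof (rule that[of A k])
    show "DERIV A t :> k t" for t
      unfolding A_def k_def by (rule DERIV_mult[OF DERIV_flat_exp_1_shift[folded e_def e'_def]])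
    show "0 \<le> A t" for t unfolding A_def using e by simp
    show "A t = 0" if "\<bar>t\<bar> \<ge> r" for t
    proof -
      have "t + r \<le> 0 \<or> r - t \<le> 0" using that by linarith
      then show ?thesis unfolding A_def using e(2) by auto
    qed
    show "continuous_on UNIV k" unfolding k_def
      by (intro continuous_intros continuous_on_compose2[OF c(1)] continuous_on_compose2[OF c(2)]) auto
    show "0 < A 0" unfolding A_def using e[of r] r by simp
  qed
qed

lemma continuous_on_extend_zero:
  fixes f :: "plane \<Rightarrow> real"
  assumes "open A" "compact C" "C \<subseteq> A" "continuous_on A f" "\<And>z. z \<in> A - C \<Longrightarrow> f z = 0"
  shows "continuous_on UNIV (\<lambda>z. if z \<in> A then f z else 0)"
proof -
  have "continuous_on (A \<union> - C) (\<lambda>z. if z \<in> A then f z else 0)"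
  proof (rule continuous_on_open_Un)
    show "continuous_on (- C) (\<lambda>z. if z \<in> A then f z else 0)"
      using assms(5) by (intro continuous_on_eq[OF continuous_on_const[of _ 0]]) auto
  qed (use assms in \<open>auto cong: continuous_on_cong simp: compact_imp_closed open_Compl\<close>)
  moreover have "A \<union> - C = UNIV" using assms by auto
  ultimately show ?thesis by simp
qed

lemma has_grad_extend_zero:
  assumes "open A" "compact C" "C \<subseteq> A" "\<And>z. z \<in> A - C \<Longrightarrow> f z = 0"
    "\<And>z. z \<in> A \<Longrightarrow> has_grad f (fx z) (fy z) z"
  shows "has_grad (\<lambda>z. if z \<in> A then f z else 0) (if z \<in> A then fx z else 0) (if z \<in> A then fy z else 0) z"
proof (cases "z \<in> A")
  case True
  then have "has_grad (\<lambda>z. if z \<in> A then f z else 0) (fx z) (fy z) z"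
    by (intro has_grad_transform_open[OF assms(5) assms(1)]) auto
  then show ?thesis using True by simp
next
  case False
  then have "has_grad (\<lambda>z. if z \<in> A then f z else 0) 0 0 z"
    using assms by (intro has_grad_transform_open[OF has_grad_const[of 0], of "- C"])
      (auto simp: compact_imp_closed open_Compl)
  then show ?thesis using False by simp
qed


text \<open>The test function \<open>\<alpha> (l z) * \<beta> (F z - c)\<close> has \<open>W\<close>-derivative \<open>\<alpha>' (l z) * \<beta> (F z - c) * (w \<bullet> W z)\<close>,
  as \<open>W\<close> annihilates the gradient of \<open>F\<close>; here \<open>\<alpha>'\<close> is a positive bump at the first point
  minus one at the second, and \<open>E\<close> sees only the first.\<close>

lemma no_crossing:
  fixes a b :: plane and E E' :: "plane set"
  assumes weak: "\<And>\<phi> \<phi>x \<phi>y C. compact C \<Longrightarrow> C \<subseteq> box a b \<Longrightarrow> (\<And>z. z \<notin> C \<Longrightarrow> \<phi> z = 0) \<Longrightarrow>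
      (\<And>z. has_grad \<phi> (\<phi>x z) (\<phi>y z) z) \<Longrightarrow> continuous_on UNIV \<phi>x \<Longrightarrow> continuous_on UNIV \<phi>y \<Longrightarrow>
      integral (cbox a b) (\<lambda>z. if z \<in> E then W1 z * \<phi>x z + W2 z * \<phi>y z else 0) = 0"
    and W: "continuous_on (cbox a b) W1" "continuous_on (cbox a b) W2"
    and A: "open A" "A \<subseteq> box a b" "homeomorphism A (box p q) T Q"
    and T1: "\<And>z. z \<in> A \<Longrightarrow> has_grad (\<lambda>z. fst (T z)) w1 w2 z"
    and T2: "\<And>z. z \<in> A \<Longrightarrow> has_grad (\<lambda>z. snd (T z)) (- W2 z) (W1 z) z"
    and pos: "\<And>z. z \<in> A \<Longrightarrow> w1 * W1 z + w2 * W2 z > 0"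
    and E: "open E" "open E'" "E \<inter> E' = {}"
    and z: "z1 \<in> A \<inter> E" "z2 \<in> A \<inter> E'" "snd (T z1) = snd (T z2)"
  shows False
proof -
  obtain p1 p2 q1 q2 where pq: "p = (p1, p2)" "q = (q1, q2)" by (cases p; cases q) auto
  define l1 where "l1 = fst (T z1)"
  define l2 where "l2 = fst (T z2)"
  define c where "c = snd (T z1)"
  have Tz: "T z1 = (l1, c)" "T z2 = (l2, c)" using z by (auto simp: l1_def l2_def c_def prod_eq_iff)
  have cT: "continuous_on A T" and cQ: "continuous_on (box p q) Q"
    using A homeomorphism_cont1 homeomorphism_cont2 by blast+
  have QT: "Q (T z) = z" if "z \<in> A" for z using A that homeomorphism_apply1 by fastforce
  have TA: "T z \<in> box p q" if "z \<in> A" for z using A that homeomorphism_image1 by blast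
  have QA: "Q z \<in> A" if "z \<in> box p q" for z using A that homeomorphism_image2 by blast
  \<comment> \<open>Neighbourhoods are expressed in the coordinates \<open>T\<close>, in which the
    supports of the cut-offs are rectangles.\<close>
  have near: "\<exists>r>0. \<forall>w\<in>A. \<bar>fst (T w) - fst (T z)\<bar> < r \<longrightarrow> \<bar>snd (T w) - snd (T z)\<bar> < r \<longrightarrow> w \<in> G"
    if "z \<in> A \<inter> G" "open G" for z G
  proof -
    have "open (box p q \<inter> Q -` G)"
      using continuous_open_preimage[OF cQ open_box that(2)] by (simp add: Int_commute)
    moreover have "T z \<in> box p q \<inter> Q -` G" using that TA QT by auto
    ultimately obtain r where r: "r > 0" "ball (T z) r \<subseteq> box p q \<inter> Q -` G"
      using openE by blast
    have "w \<in> G" if w: "w \<in> A" "\<bar>fst (T w) - fst (T z)\<bar> < r / 2" "\<bar>snd (T w) - snd (T z)\<bar> < r / 2" for w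
    proof -
      have "norm (T w - T z) \<le> \<bar>fst (T w) - fst (T z)\<bar> + \<bar>snd (T w) - snd (T z)\<bar>"
        using norm_Pair_le[of "fst (T w - T z)" "snd (T w - T z)"]
        by (simp only: prod.collapse) (simp add: fst_diff snd_diff)
      then have "T w \<in> ball (T z) r" using w by (simp add: dist_norm norm_minus_commute)
      then show "w \<in> G" using r QT[OF w(1)] by auto
    qed
    then show ?thesis using r by (intro exI[of _ "r / 2"]) auto
  qed
  obtain r1 where r1: "r1 > 0" "\<And>w. w \<in> A \<Longrightarrow> \<bar>fst (T w) - l1\<bar> < r1 \<Longrightarrow> \<bar>snd (T w) - c\<bar> < r1 \<Longrightarrow> w \<in> E"
    using near[OF z(1) E(1)] Tz by auto
  obtain r2 where r2: "r2 > 0" "\<And>w. w \<in> A \<Longrightarrow> \<bar>fst (T w) - l2\<bar> < r2 \<Longrightarrow> \<bar>snd (T w) - c\<bar> < r2 \<Longrightarrow> w \<in> E'"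
    using near[OF z(2) E(2)] Tz by auto
  have lpq: "p1 < l1" "l1 < q1" "p1 < l2" "l2 < q1" "p2 < c" "c < q2"
    using TA[of z1] TA[of z2] z Tz by (auto simp: pq mem_box_plane)
  \<comment> \<open>\<open>m\<close> is the least distance, in the coordinates \<open>T\<close>, of
    the two points from the edges of \<open>box p q\<close>. A radius below \<open>m\<close> keeps
    the support of the test function in the chart; a radius at most \<open>r1\<close> and
    \<open>r2\<close> places the bumps at the two points in \<open>E\<close> and in
    \<open>E'\<close>.\<close>
  define m where "m = min (min l1 l2 - p1) (min (q1 - max l1 l2) (min (c - p2) (q2 - c)))"
  have m: "m > 0" using lpq by (auto simp: m_def)
  define r where "r = min (m / 2) (min r1 r2)"
  have r: "r > 0" "r \<le> r1" "r \<le> r2" "r < m" using m r1(1) r2(1) by (auto simp: r_def)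
  have rm: "p1 < min l1 l2 - r" "max l1 l2 + r < q1" "p2 < c - r" "c + r < q2"
    using r(4) by (auto simp: m_def)
  obtain S k where S: "\<And>t. DERIV S t :> k t" "continuous_on UNIV k" "\<And>t. 0 \<le> k t" "0 < k 0"
    "\<And>t. \<bar>t\<bar> \<ge> r \<Longrightarrow> k t = 0" "\<And>t. t \<le> -r \<Longrightarrow> S t = 0" "\<And>t. t \<ge> r \<Longrightarrow> S t = (1 :: real)"
    using smooth_step[OF r(1)] by blast
  obtain \<beta> \<beta>' where \<beta>: "\<And>t. DERIV \<beta> t :> \<beta>' t" "continuous_on UNIV \<beta>'" "\<And>t. 0 \<le> \<beta> t" "0 < \<beta> 0"
    "\<And>t. \<bar>t\<bar> \<ge> r \<Longrightarrow> \<beta> t = (0 :: real)"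
    using C1_bump[OF r(1)] by blast
  have c\<beta>: "continuous_on UNIV \<beta>" using \<beta>(1) DERIV_isCont by (blast intro: continuous_at_imp_continuous_on)
  \<comment> \<open>A difference of two steps is zero far out and constant between the two
    transition zones. So it has compact support, while its derivative lives only near the two
    points.\<close>
  define \<alpha> where "\<alpha> t = S (t - l1) - S (t - l2)" for t
  define \<alpha>' where "\<alpha>' t = k (t - l1) - k (t - l2)" for t
  have d\<alpha>: "DERIV \<alpha> t :> \<alpha>' t" for t
    using S(1)[of "t - l1"] S(1)[of "t - l2"] DERIV_shift[of S _ t "- l1"] DERIV_shift[of S _ t "- l2"]
    unfolding \<alpha>_def \<alpha>'_def by (intro DERIV_diff) auto
  have d\<beta>: "DERIV (\<lambda>t. \<beta> (t - c)) t :> \<beta>' (t - c)" for t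
    using \<beta>(1)[of "t - c"] DERIV_shift[of \<beta> _ t "- c"] by simp
  have c\<alpha>: "continuous_on UNIV \<alpha>" using d\<alpha> DERIV_isCont by (blast intro: continuous_at_imp_continuous_on)
  have c\<alpha>': "continuous_on UNIV \<alpha>'" unfolding \<alpha>'_def
    by (intro continuous_intros continuous_on_compose2[OF S(2)]) auto
  define R where "R = cbox (min l1 l2 - r, c - r) (max l1 l2 + r, c + r)"
  have R: "R \<subseteq> box p q"
  proof
    fix w assume "w \<in> R"
    then show "w \<in> box p q" using rm by (cases w) (auto simp: R_def pq cbox_Pair_eq mem_box_plane)
  qed
  define C where "C = Q ` R"
  have C: "compact C" unfolding C_def
    by (intro compact_continuous_image continuous_on_subset[OF cQ R]) (simp add: R_def)
  have CA: "C \<subseteq> A" using R QA by (auto simp: C_def)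
  have notC: "T w \<notin> R" if "w \<in> A - C" for w
    using that QT[of w] unfolding C_def by (metis DiffD1 DiffD2 imageI)
  have zero\<beta>: "\<beta> (snd v - c) = 0" if "v \<notin> R" "min l1 l2 - r \<le> fst v" "fst v \<le> max l1 l2 + r" for v
    using that \<beta>(5)[of "snd v - c"] by (cases v) (auto simp: R_def cbox_Pair_eq abs_if split: if_splits)
  have zero\<alpha>: "\<alpha> (fst v) = 0" if "fst v < min l1 l2 - r \<or> max l1 l2 + r < fst v" for v :: plane
    using that S(6)[of "fst v - l1"] S(6)[of "fst v - l2"] S(7)[of "fst v - l1"] S(7)[of "fst v - l2"]
    unfolding \<alpha>_def by auto
  have zero: "\<alpha> (fst v) * \<beta> (snd v - c) = 0" if "v \<notin> R" for v
    using that zero\<alpha>[of v] zero\<beta>[of v] by fastforce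
  define f where "f w = \<alpha> (fst (T w)) * \<beta> (snd (T w) - c)" for w
  define fx where "fx w = (w1 * \<alpha>' (fst (T w))) * \<beta> (snd (T w) - c) + \<alpha> (fst (T w)) * ((- W2 w) * \<beta>' (snd (T w) - c))" for w
  define fy where "fy w = (w2 * \<alpha>' (fst (T w))) * \<beta> (snd (T w) - c) + \<alpha> (fst (T w)) * (W1 w * \<beta>' (snd (T w) - c))" for w
  have f0: "f w = 0" if "w \<in> A - C" for w using zero[OF notC[OF that]] by (simp add: f_def)
  have gf: "has_grad f (fx w) (fy w) w" if "w \<in> A" for w
    unfolding f_def fx_def fy_def
    by (rule has_grad_mult[OF has_grad_compose_real[OF d\<alpha> T1[OF that]] has_grad_compose_real[OF d\<beta> T2[OF that]]])
  have f0': "fx w = 0 \<and> fy w = 0" if "w \<in> A - C" for w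
  proof -
    have "has_grad f 0 0 w"
      using A C that f0 by (intro has_grad_transform_open[OF has_grad_const[of 0], of "A - C"])
        (auto simp: compact_imp_closed open_Diff)
    then show ?thesis using gf[of w] that has_grad_unique by blast
  qed
  have WA: "continuous_on A W1" "continuous_on A W2"
    using W A(2) box_subset_cbox continuous_on_subset by blast+
  have cc: "continuous_on A (\<lambda>w. \<alpha>' (fst (T w)))" "continuous_on A (\<lambda>w. \<alpha> (fst (T w)))"
     "continuous_on A (\<lambda>w. \<beta> (snd (T w) - c))" "continuous_on A (\<lambda>w. \<beta>' (snd (T w) - c))"
     "continuous_on A (\<lambda>w. k (fst (T w) - l1))"
    by (intro continuous_on_compose2[OF c\<alpha>'] continuous_on_compose2[OF c\<alpha>] continuous_on_compose2[OF c\<beta>]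
      continuous_on_compose2[OF \<beta>(2)] continuous_on_compose2[OF S(2)] continuous_intros cT; simp)+
  have cfx: "continuous_on A fx" and cfy: "continuous_on A fy"
    unfolding fx_def fy_def by (intro continuous_intros cc WA)+
  \<comment> \<open>This is what \<open>E\<close> sees of the tested integrand: nonnegative by
    \<open>pos\<close>, and positive at \<open>z1\<close>. Its vanishing integral is the
    contradiction.\<close>
  define G where "G w = (if w \<in> A then k (fst (T w) - l1) * \<beta> (snd (T w) - c) * (w1 * W1 w + w2 * W2 w) else 0)" for w
  have "integral (cbox a b) (\<lambda>z. if z \<in> E then W1 z * (if z \<in> A then fx z else 0) + W2 z * (if z \<in> A then fy z else 0) else 0) = 0"
  proof (rule weak[OF C])
    show "C \<subseteq> box a b" using CA A by blast
    show "(if z \<in> A then f z else 0) = 0" if "z \<notin> C" for z using f0 that by auto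
    show "has_grad (\<lambda>z. if z \<in> A then f z else 0) (if z \<in> A then fx z else 0) (if z \<in> A then fy z else 0) z" for z
      by (rule has_grad_extend_zero[OF A(1) C CA f0 gf])
    show "continuous_on UNIV (\<lambda>z. if z \<in> A then fx z else 0)" "continuous_on UNIV (\<lambda>z. if z \<in> A then fy z else 0)"
      using f0' by (intro continuous_on_extend_zero[OF A(1) C CA] cfx cfy; simp)+
  qed
  moreover have "(if z \<in> E then W1 z * (if z \<in> A then fx z else 0) + W2 z * (if z \<in> A then fy z else 0) else 0) = G z" for z
  proof (cases "z \<in> A")
    case True
    define x where "x = fst (T z)"
    define y where "y = snd (T z)"
    have id: "W1 z * fx z + W2 z * fy z = \<alpha>' x * \<beta> (y - c) * (w1 * W1 z + w2 * W2 z)"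
      unfolding fx_def fy_def x_def y_def by (simp add: algebra_simps)
    have k2: "k (x - l2) * \<beta> (y - c) = 0" if "z \<in> E"
    proof (rule ccontr)
      assume "k (x - l2) * \<beta> (y - c) \<noteq> 0"
      then have "\<bar>x - l2\<bar> < r2" "\<bar>y - c\<bar> < r2"
        using S(5)[of "x - l2"] \<beta>(5)[of "y - c"] r by force+
      then have "z \<in> E'" using r2 True unfolding x_def y_def by blast
      then show False using that E by blast
    qed
    have k1: "k (x - l1) * \<beta> (y - c) = 0" if "z \<notin> E"
    proof (rule ccontr)
      assume "k (x - l1) * \<beta> (y - c) \<noteq> 0"
      then have "\<bar>x - l1\<bar> < r1" "\<bar>y - c\<bar> < r1"
        using S(5)[of "x - l1"] \<beta>(5)[of "y - c"] r by force+
      then have "z \<in> E" using r1 True unfolding x_def y_def by blast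
      then show False using that by blast
    qed
    show ?thesis
    proof (cases "z \<in> E")
      case zE: True
      have "\<alpha>' x * \<beta> (y - c) = k (x - l1) * \<beta> (y - c)"
        using k2[OF zE] by (simp add: \<alpha>'_def algebra_simps)
      then show ?thesis using True zE id unfolding G_def by (simp add: x_def y_def)
    next
      case False
      then show ?thesis using True k1 unfolding G_def by (simp add: x_def y_def)
    qed
  qed (simp add: G_def)
  ultimately have I0: "integral (cbox a b) G = 0" by simp
  have cG: "continuous_on UNIV G" unfolding G_def
  proof (rule continuous_on_extend_zero[OF A(1) C CA])
    show "continuous_on A (\<lambda>w. k (fst (T w) - l1) * \<beta> (snd (T w) - c) * (w1 * W1 w + w2 * W2 w))"
      by (intro continuous_intros cc WA)
    fix w assume "w \<in> A - C"
    then have n: "T w \<notin> R" by (rule notC)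
    have "k (fst (T w) - l1) = 0" if "fst (T w) < min l1 l2 - r \<or> max l1 l2 + r < fst (T w)"
      using that by (intro S(5)) auto
    then have "k (fst (T w) - l1) * \<beta> (snd (T w) - c) = 0" using zero\<beta>[OF n] by fastforce
    then show "k (fst (T w) - l1) * \<beta> (snd (T w) - c) * (w1 * W1 w + w2 * W2 w) = 0" by simp
  qed
  have "(G has_integral 0) (cbox a b)"
    using I0 integrable_integral[OF integrable_continuous[OF continuous_on_subset[OF cG subset_UNIV]], of a b] by simp
  moreover have "G w \<ge> 0" for w using S(3) \<beta>(3) less_imp_le[OF pos] by (auto simp: G_def intro!: mult_nonneg_nonneg)
  moreover have "z1 \<in> box a b" using z A by blast
  moreover have "box a b \<noteq> {}" using z A by blast
  ultimately have "G z1 = 0"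
    using box_subset_cbox[of a b] by (intro has_integral_0_cbox_imp_0[of a b G]) (use cG in \<open>auto intro: continuous_on_subset\<close>)
  moreover have "G z1 > 0" using S(4) \<beta>(4) pos[of z1] z Tz by (simp add: G_def)
  ultimately show False by simp
qed

section \<open>Arcs and sides\<close>

text \<open>Read in the parameter of \<open>\<gamma>\<close>, \<open>X\<close> is an injective
  continuous map from an open set of reals to the reals, so its image is open by invariance of
  domain. Consequently, near a point of such an arc the crack contains nothing but the arc.\<close>

lemma arc_relatively_open:
  fixes \<gamma> :: "plane set" and X :: "real \<Rightarrow> plane"
  assumes \<gamma>: "\<gamma> homeomorphic {0<..<1::real}" and I: "open I" and X: "continuous_on I X" "inj_on X I" "X ` I \<subseteq> \<gamma>"
  obtains G where "open G" "X ` I = \<gamma> \<inter> G"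
proof -
  obtain h k where hk: "homeomorphism \<gamma> {0<..<1::real} h k" using \<gamma> unfolding homeomorphic_def by blast
  have ch: "continuous_on \<gamma> h" and kh: "\<And>x. x \<in> \<gamma> \<Longrightarrow> k (h x) = x"
    using hk by (auto simp: homeomorphism_def)
  have "continuous_on I (\<lambda>t. h (X t))" by (rule continuous_on_compose2[OF ch X(1,3)])
  moreover have "inj_on (\<lambda>t. h (X t)) I"
  proof (rule inj_onI)
    fix s t assume "s \<in> I" "t \<in> I" "h (X s) = h (X t)"
    then have "X s = X t" using kh X(3) by (metis image_subset_iff)
    then show "s = t" using X(2) \<open>s \<in> I\<close> \<open>t \<in> I\<close> by (auto dest: inj_onD)
  qed
  ultimately have o: "open ((\<lambda>t. h (X t)) ` I)" using I invariance_of_domain by blast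
  have "X ` I = \<gamma> \<inter> h -` ((\<lambda>t. h (X t)) ` I)"
  proof (intro equalityI subsetI)
    fix x assume x: "x \<in> \<gamma> \<inter> h -` ((\<lambda>t. h (X t)) ` I)"
    then obtain t where t: "t \<in> I" "h x = h (X t)" by auto
    then have "x = X t" using kh x X(3) by (metis IntD1 image_subset_iff)
    then show "x \<in> X ` I" using t by blast
  qed (use X in auto)
  moreover have "openin (top_of_set \<gamma>) (\<gamma> \<inter> h -` ((\<lambda>t. h (X t)) ` I))"
    using o ch continuous_openin_preimage_gen by blast
  ultimately show thesis using that unfolding openin_open by metis
qed

lemma closure_meets_open:
  assumes "p \<in> closure G" "open S" "p \<in> S"
  shows "S \<inter> G \<noteq> {}"
  using assms open_Int_closure_eq_empty[of S G] by blast

lemma connected_in_one_side: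
  assumes "connected S" "open A" "open B" "A \<inter> B = {}" "S \<subseteq> A \<union> B"
  shows "S \<subseteq> A \<or> S \<subseteq> B"
  using connectedD[OF assms(1-3)] assms(4,5) by blast

lemma open_contains_plane_box:
  fixes p :: plane
  assumes "open O'" "p \<in> O'"
  obtains \<rho> where "\<rho> > 0" "{fst p - \<rho><..<fst p + \<rho>} \<times> {snd p - \<rho><..<snd p + \<rho>} \<subseteq> O'"
proof -
  obtain A B where AB: "open A" "open B" "fst p \<in> A" "snd p \<in> B" "A \<times> B \<subseteq> O'"
    using assms open_prod_elim by (metis mem_Times_iff)
  obtain r s where "r > 0" "ball (fst p) r \<subseteq> A" "s > 0" "ball (snd p) s \<subseteq> B"
    using AB openE by metis
  then have "{fst p - min r s<..<fst p + min r s} \<times> {snd p - min r s<..<snd p + min r s} \<subseteq> O'"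
    using AB(5) by (fastforce simp: dist_real_def)
  then show thesis using that[of "min r s"] \<open>r > 0\<close> \<open>s > 0\<close> by simp
qed

lemma box_Times: "{a<..<b} \<times> {c<..<d} = box (a, c) (b, d :: real)" for a b :: real
  by (auto simp: mem_box_plane)

section \<open>Potential of the jump and straightening of the crack\<close>

text \<open>\<open>F\<close> integrates \<open>W1\<close> upwards from the height \<open>y0\<close>
  and subtracts the integral of \<open>W2\<close> along that height. The vertical derivative is
  \<open>W1\<close>. In the horizontal one the integral of \<open>W1x\<close> equals that of
  \<open>- W2y\<close>, and its lower end cancels against the second integral, leaving
  \<open>- W2\<close>.\<close>

lemma divergence_free_potential:
  fixes W1 W2 :: "plane \<Rightarrow> real"
  assumes S: "S = {\<alpha><..<\<beta>} \<times> {\<gamma><..<\<delta>}" and x0: "\<alpha> < x0" and y0: "\<gamma> < y0" "y0 < \<delta>"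
    and W1: "\<And>z. z \<in> S \<Longrightarrow> has_grad W1 (W1x z) (W1y z) z" "continuous_on S W1x"
    and W2: "\<And>z. z \<in> S \<Longrightarrow> has_grad W2 (W2x z) (W2y z) z"
    and div: "\<And>z. z \<in> S \<Longrightarrow> W1x z + W2y z = 0"
  obtains F where "\<And>z. z \<in> {x0<..<\<beta>} \<times> {y0<..<\<delta>} \<Longrightarrow> has_grad F (- W2 z) (W1 z) z"
proof -
  have c1: "continuous_on S W1" and c2: "continuous_on S W2"
    by (rule has_grad_continuous_on, erule W1(1) W2(1))+
  \<comment> \<open>The coordinates are swapped because the variable limit is the second coordinate
    here but the first one in \<open>has_grad_integral_upper\<close>.\<close>
  define f where "f z = W1 (snd z, fst z)" for z :: plane
  define g where "g z = W1x (snd z, fst z)" for z :: plane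
  define F where "F z = integral {y0..snd z} (\<lambda>s. f (s, fst z)) - integral {x0..fst z} (\<lambda>t. W2 (t, y0))" for z
  have cf: "continuous_on ({y0..<\<delta>} \<times> {\<alpha><..<\<beta>}) f" unfolding f_def
    by (rule continuous_on_compose2[OF c1]) (use y0 in \<open>auto simp: S intro!: continuous_intros\<close>)
  have cg: "continuous_on ({y0..<\<delta>} \<times> {\<alpha><..<\<beta>}) g" unfolding g_def
    by (rule continuous_on_compose2[OF W1(2)]) (use y0 in \<open>auto simp: S intro!: continuous_intros\<close>)
  show thesis
  proof (rule that[of F])
    fix z assume z: "z \<in> {x0<..<\<beta>} \<times> {y0<..<\<delta>}"
    obtain x y where xy: "z = (x, y)" by force
    have zxy: "x0 < x" "x < \<beta>" "y0 < y" "y < \<delta>" using z xy by auto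
    have dg: "DERIV (\<lambda>t. f (s, t)) v :> g (s, v)" if "s \<in> {y0..<\<delta>}" "v \<in> {\<alpha><..<\<beta>}" for s v
      using has_grad_partials(1)[OF W1(1)[of "(v, s)"]] that y0 by (auto simp: S f_def g_def)
    have "has_grad (\<lambda>z. integral {y0..fst z} (\<lambda>r. f (r, snd z))) (f (y, x)) (integral {y0..fst (y, x)} (\<lambda>r. g (r, snd (y, x)))) (y, x)"
      by (rule has_grad_integral_upper[OF cf _ dg cg]) (use zxy x0 in auto)
    from has_grad_compose[of _ _ _ snd z fst, OF _ has_grad_snd has_grad_fst] this
    have 1: "has_grad (\<lambda>z. integral {y0..snd z} (\<lambda>s. f (s, fst z))) (integral {y0..y} (\<lambda>r. g (r, x))) (f (y, x)) z"
      by (fastforce simp: xy)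
    have "((\<lambda>s. W2y (x, s)) has_integral W2 (x, y) - W2 (x, y0)) {y0..y}"
    proof (rule fundamental_theorem_of_calculus)
      fix s assume "s \<in> {y0..y}"
      then have "DERIV (\<lambda>s. W2 (x, s)) s :> W2y (x, s)"
        using zxy x0 y0 by (intro has_grad_partials(2)[OF W2]) (auto simp: S)
      then show "((\<lambda>s. W2 (x, s)) has_vector_derivative W2y (x, s)) (at s within {y0..y})"
        by (simp add: has_real_derivative_iff_has_vector_derivative has_vector_derivative_at_within)
    qed (use zxy in simp)
    then have "((\<lambda>s. - W2y (x, s)) has_integral - (W2 (x, y) - W2 (x, y0))) {y0..y}"
      by (rule has_integral_neg)
    then have "((\<lambda>s. g (s, x)) has_integral - (W2 (x, y) - W2 (x, y0))) {y0..y}"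
    proof (rule has_integral_eq[rotated])
      fix s assume s: "s \<in> {y0..y}"
      then have "W1x (x, s) + W2y (x, s) = 0"
        using zxy x0 y0 by (intro div) (auto simp: S)
      then show "- W2y (x, s) = g (s, x)" by (simp add: g_def)
    qed
    then have 2: "integral {y0..y} (\<lambda>r. g (r, x)) = W2 (x, y0) - W2 z" by (simp add: integral_unique xy)
    obtain x' where x': "x < x'" "x' < \<beta>" using dense zxy(2) by blast
    have "continuous_on {x0..x'} (\<lambda>t. W2 (t, y0))"
      by (rule continuous_on_compose2[OF c2]) (use zxy x0 y0 x' in \<open>auto simp: S intro!: continuous_intros\<close>)
    then have "((\<lambda>t. integral {x0..t} (\<lambda>t. W2 (t, y0))) has_real_derivative W2 (x, y0)) (at x within {x0..x'})"
      using zxy x' by (intro integral_has_real_derivative) auto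
    moreover have "at x within {x0..x'} = at x" using zxy x' by (intro at_within_interior) auto
    ultimately have "DERIV (\<lambda>t. integral {x0..t} (\<lambda>t. W2 (t, y0))) (fst z) :> W2 (x, y0)" by (simp add: xy)
    from has_grad_diff[OF 1 has_grad_compose_real[OF this has_grad_fst]]
    show "has_grad F (- W2 z) (W1 z) z"
      unfolding F_def by (simp add: 2) (simp add: f_def xy)
  qed
qed

text \<open>Both inclusions between the crack and the level set of \<open>F\<close> through
  \<open>p\<close> need an argument. A point of that level off the crack would carry all nearby
  levels on its own side, while the other side has points of such levels near \<open>p\<close>: a
  crossing. Conversely, the level curve is an arc inside \<open>\<gamma>\<close>, hence relatively
  open in it, so \<open>\<gamma>\<close> has no further points near \<open>p\<close>. The sign
  \<open>e\<close> records which side is uphill; the small neighbourhoods with connected halves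
  serve to compare with other decompositions into sides.\<close>

lemma interface_is_C1_curve:
  fixes O' \<gamma> Up Um :: "plane set" and p :: plane
  assumes weak: "weak_solution \<Omega> H \<theta>" and O': "open O'" "O' \<subseteq> \<Omega>" "p \<in> O'" and H: "continuous_on O' H"
    and side: "open Up" "open Um" "Up \<inter> Um = {}" "O' \<subseteq> Up \<union> Um \<union> \<gamma>" "\<gamma> \<inter> (Up \<union> Um) = {}"
    and p: "p \<in> \<gamma>" "p \<in> closure Up" "p \<in> closure Um"
    and \<gamma>: "\<gamma> homeomorphic {0<..<1::real}" "negligible (\<gamma> \<inter> O')"
    and u1: "\<And>z. z \<in> O' \<Longrightarrow> has_grad u1 (u1x z) (u1y z) z" "continuous_on O' u1x"
    and v1: "\<And>z. z \<in> O' \<Longrightarrow> has_grad v1 (v1x z) (v1y z) z"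
    and u2: "\<And>z. z \<in> O' \<Longrightarrow> has_grad u2 (u2x z) (u2y z) z" "continuous_on O' u2x"
    and v2: "\<And>z. z \<in> O' \<Longrightarrow> has_grad v2 (v2x z) (v2y z) z" "continuous_on O' v2y"
    and div1: "\<And>z. z \<in> O' \<Longrightarrow> u1x z + v1y z = H z" and div2: "\<And>z. z \<in> O' \<Longrightarrow> u2x z + v2y z = H z"
    and N1: "\<And>z. z \<in> O' \<inter> Up \<Longrightarrow> Nvec (\<theta> z) = (u1 z, v1 z)"
    and N2: "\<And>z. z \<in> O' \<inter> Um \<Longrightarrow> Nvec (\<theta> z) = (u2 z, v2 z)"
    and ne: "(u1 p, v1 p) \<noteq> (u2 p, v2 p)"
  obtains V g a b F c e where "open V" "p \<in> V" "V \<subseteq> O'" "C1_curve_param (\<gamma> \<inter> V) g a b"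
    "\<And>z. z \<in> V \<Longrightarrow> has_grad F (- (v1 z - v2 z)) (u1 z - u2 z) z"
    "\<gamma> \<inter> V = {z \<in> V. F z = c}" "e \<in> {1, -1 :: real}"
    "Up \<inter> V = {z \<in> V. e * (F z - c) > 0}" "Um \<inter> V = {z \<in> V. e * (F z - c) < 0}"
    "\<And>G. open G \<Longrightarrow> p \<in> G \<Longrightarrow> \<exists>V0. open V0 \<and> p \<in> V0 \<and> V0 \<subseteq> V \<inter> G \<and>
        connected {z \<in> V0. F z - c > 0} \<and> connected {z \<in> V0. F z - c < 0}"
proof -
  define W1 where "W1 z = u1 z - u2 z" for z
  define W2 where "W2 z = v1 z - v2 z" for z
  have gW1: "has_grad W1 (u1x z - u2x z) (u1y z - u2y z) z" if "z \<in> O'" for z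
    unfolding W1_def using that u1 u2 by (intro has_grad_diff) auto
  have gW2: "has_grad W2 (v1x z - v2x z) (v1y z - v2y z) z" if "z \<in> O'" for z
    unfolding W2_def using that v1 v2 by (intro has_grad_diff) auto
  have cW: "continuous_on O' W1" "continuous_on O' W2"
    by (rule has_grad_continuous_on, erule gW1 gW2)+
  obtain \<rho> where \<rho>: "\<rho> > 0" "{fst p - \<rho><..<fst p + \<rho>} \<times> {snd p - \<rho><..<snd p + \<rho>} \<subseteq> O'"
    using open_contains_plane_box[OF O'(1,3)] by blast
  \<comment> \<open>With thirds the closed box lies in \<open>O'\<close>, and it stays within the
    region beyond \<open>fst p - \<rho> / 2\<close> and \<open>snd p - \<rho> / 2\<close> on which
    the potential is constructed.\<close>
  define a where "a = (fst p - \<rho> / 3, snd p - \<rho> / 3)"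
  define b where "b = (fst p + \<rho> / 3, snd p + \<rho> / 3)"
  have abO: "cbox a b \<subseteq> O'"
    using \<rho> by (force simp: a_def b_def cbox_Pair_eq)
  have pab: "p \<in> box a b" using \<rho>(1) by (auto simp: a_def b_def mem_box_plane)
  obtain F0 where F0: "\<And>z. z \<in> {fst p - \<rho> / 2<..<fst p + \<rho>} \<times> {snd p - \<rho> / 2<..<snd p + \<rho>} \<Longrightarrow> has_grad F0 (- W2 z) (W1 z) z"
  proof (rule divergence_free_potential[OF refl, of "fst p - \<rho>" "fst p - \<rho> / 2" "snd p - \<rho>" "snd p - \<rho> / 2" "snd p + \<rho>"
        "fst p + \<rho>" W1 "\<lambda>z. u1x z - u2x z" "\<lambda>z. u1y z - u2y z" W2 "\<lambda>z. v1x z - v2x z" "\<lambda>z. v1y z - v2y z"])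
    fix z assume z: "z \<in> {fst p - \<rho><..<fst p + \<rho>} \<times> {snd p - \<rho><..<snd p + \<rho>}"
    then have "z \<in> O'" using \<rho> by blast
    then show "has_grad W1 (u1x z - u2x z) (u1y z - u2y z) z" "has_grad W2 (v1x z - v2x z) (v1y z - v2y z) z"
      "u1x z - u2x z + (v1y z - v2y z) = 0"
      using gW1 gW2 div1[of z] div2[of z] by auto
  next
    show "continuous_on ({fst p - \<rho><..<fst p + \<rho>} \<times> {snd p - \<rho><..<snd p + \<rho>}) (\<lambda>z. u1x z - u2x z)"
      using \<rho>(2) u1(2) u2(2) by (intro continuous_intros) (auto intro: continuous_on_subset)
  qed (use \<rho> in auto)
  define F where "F = F0"
  have gF: "has_grad F (- W2 z) (W1 z) z" if "z \<in> box a b" for z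
    unfolding F_def
    by (rule F0) (use that \<rho> in \<open>auto simp: a_def b_def mem_box_plane mem_Times_iff\<close>)
  define w1 where "w1 = W1 p"
  define w2 where "w2 = W2 p"
  define l where "l z = w1 * fst z + w2 * snd z" for z :: plane
  define T where "T z = (l z, F z)" for z
  have gl: "has_grad l w1 w2 z" for z unfolding has_grad_def l_def by (auto intro!: derivative_eq_intros)
  \<comment> \<open>The same quantity is the derivative of \<open>l\<close> along the jump field and
    the Jacobian determinant of \<open>T\<close>; at \<open>p\<close> it is the squared length of
    the jump.\<close>
  define S where "S = {z \<in> box a b. w1 * W1 z + w2 * W2 z > 0}"
  have boxO: "box a b \<subseteq> O'" using abO box_subset_cbox by blast
  have oS: "open S"
  proof -
    have "continuous_on (box a b) (\<lambda>z. w1 * W1 z + w2 * W2 z)"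
      using cW boxO by (intro continuous_intros) (auto intro: continuous_on_subset)
    then have "open (box a b \<inter> (\<lambda>z. w1 * W1 z + w2 * W2 z) -` {0<..})"
      by (intro continuous_open_preimage) auto
    moreover have "box a b \<inter> (\<lambda>z. w1 * W1 z + w2 * W2 z) -` {0<..} = S" by (auto simp: S_def)
    ultimately show ?thesis by simp
  qed
  have wpos: "w1 * w1 + w2 * w2 > 0"
  proof -
    have "w1 \<noteq> 0 \<or> w2 \<noteq> 0" using ne by (auto simp: w1_def w2_def W1_def W2_def)
    then show ?thesis by (auto simp: add_pos_nonneg add_nonneg_pos not_square_less_zero zero_less_mult_iff simp flip: power2_eq_square)
  qed
  have pS: "p \<in> S" using pab wpos by (simp add: S_def w1_def w2_def)
  have SO: "S \<subseteq> O'" using boxO by (auto simp: S_def)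
  have gF': "has_grad F (- W2 z) (W1 z) z" if "z \<in> S" for z using gF that by (simp add: S_def)
  have cWS: "continuous_on S (\<lambda>z. - W2 z)" "continuous_on S W1"
    using cW SO by (auto intro!: continuous_intros intro: continuous_on_subset)
  have C1T: "C1_on (\<lambda>z. fst (T z)) S" "C1_on (\<lambda>z. snd (T z)) S"
    unfolding T_def fst_conv snd_conv
    using C1_onI[OF gl continuous_on_const continuous_on_const] C1_onI[OF gF' cWS] .
  have gTp: "has_grad (\<lambda>z. fst (T z)) w1 w2 p" "has_grad (\<lambda>z. snd (T z)) (- w2) w1 p"
    unfolding T_def fst_conv snd_conv w1_def[symmetric] w2_def[symmetric]
    using gl gF'[OF pS] by (simp_all add: w1_def w2_def)
  obtain A B Q where Q: "open A" "p \<in> A" "A \<subseteq> S" "open B" "homeomorphism A B T Q"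
    "C1_on (\<lambda>z. fst (Q z)) B" "C1_on (\<lambda>z. snd (Q z)) B"
    by (rule plane_inverse_function[OF oS pS C1T gTp]) (use wpos in auto)
  have cQ: "continuous_on B Q" and cT: "continuous_on A T"
    and QT: "\<And>z. z \<in> A \<Longrightarrow> Q (T z) = z" and TQ: "\<And>y. y \<in> B \<Longrightarrow> T (Q y) = y"
    and TA: "\<And>z. z \<in> A \<Longrightarrow> T z \<in> B" and QB: "\<And>y. y \<in> B \<Longrightarrow> Q y \<in> A"
    using Q(5) by (auto simp: homeomorphism_def)
  have oQ: "open (Q ` R)" and hQ: "homeomorphism (Q ` R) R T Q" if "open R" "R \<subseteq> B" for R
  proof -
    have "Q ` R = A \<inter> T -` R"
    proof (intro equalityI subsetI)
      fix z assume "z \<in> A \<inter> T -` R"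
      then show "z \<in> Q ` R" using QT[of z] by (metis IntD1 IntD2 imageI vimageE)
    qed (use that QB TQ in auto)
    then show "open (Q ` R)" using continuous_open_preimage[OF cT Q(1) that(1)] by simp
    have "T ` Q ` R = (\<lambda>y. y) ` R"
      unfolding image_image by (rule image_cong) (use that TQ in auto)
    then have "T ` Q ` R = R" by simp
    moreover have "Q ` R \<subseteq> A" using that QB by blast
    ultimately show "homeomorphism (Q ` R) R T Q"
      using homeomorphism_of_subsets[OF Q(5)] that(2) by blast
  qed
  define l0 where "l0 = l p"
  define c where "c = F p"
  have Tp: "T p = (l0, c)" by (simp add: T_def l0_def c_def)
  have Qp: "Q (l0, c) = p" using QT[OF Q(2)] by (simp add: Tp)
  obtain r where r: "r > 0" "{l0 - r<..<l0 + r} \<times> {c - r<..<c + r} \<subseteq> B"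
    using open_contains_plane_box[OF Q(4) TA[OF Q(2)]] unfolding Tp by auto
  define R where "R = {l0 - r<..<l0 + r} \<times> {c - r<..<c + r}"
  have RB: "open R" "R \<subseteq> B" "R = box (l0 - r, c - r) (l0 + r, c + r)"
    using r by (auto simp: R_def open_Times box_Times)
  define A' where "A' = Q ` R"
  have A': "open A'" "homeomorphism A' R T Q" using oQ[OF RB(1,2)] hQ[OF RB(1,2)] by (auto simp: A'_def)
  have A'A: "A' \<subseteq> A" using RB QB by (auto simp: A'_def)
  have pA': "p \<in> A'" unfolding A'_def using Qp r by (intro image_eqI[of _ _ "(l0, c)"]) (auto simp: R_def)
  have A'box: "A' \<subseteq> box a b" using A'A Q(3) by (auto simp: S_def)
  have cWab: "continuous_on (cbox a b) W1" "continuous_on (cbox a b) W2"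
    using cW abO continuous_on_subset by blast+
  have C1weak: "integral (cbox a b) (\<lambda>z. if z \<in> Up then W1 z * \<phi>x z + W2 z * \<phi>y z else 0) = 0"
    if "compact C" "C \<subseteq> box a b" "\<And>z. z \<notin> C \<Longrightarrow> \<phi> z = 0"
      "\<And>z. has_grad \<phi> (\<phi>x z) (\<phi>y z) z" "continuous_on UNIV \<phi>x" "continuous_on UNIV \<phi>y" for \<phi> \<phi>x \<phi>y C
  proof (rule weak_divergence_free_C1[OF _ cWab side(1) that])
    fix \<psi> \<psi>x \<psi>y
    assume \<psi>: "test_function (box a b) \<psi>" "\<And>z. has_grad \<psi> (\<psi>x z) (\<psi>y z) z"
      "continuous_on UNIV \<psi>x" "continuous_on UNIV \<psi>y"
    show "integral (cbox a b) (\<lambda>z. if z \<in> Up then W1 z * \<psi>x z + W2 z * \<psi>y z else 0) = 0"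
    proof (rule weak_solution_jump[OF weak _ _ _ _ _ _ _ cWab side(1) _ _ _ \<psi>,
          where u = u2 and ux = u2x and uy = u2y and v = v2 and vx = v2x and vy = v2y and Z = "\<gamma> \<inter> O'"])
      fix z assume z: "z \<in> cbox a b"
      then have zO: "z \<in> O'" using abO by blast
      show "has_grad u2 (u2x z) (u2y z) z" "has_grad v2 (v2x z) (v2y z) z" "u2x z + v2y z = H z"
        using zO u2 v2 div2 by auto
    next
      fix z assume z: "z \<in> cbox a b - \<gamma> \<inter> O'"
      then have zO: "z \<in> O'" "z \<notin> \<gamma>" using abO by blast+
      show "Nvec (\<theta> z) = (u2 z + W1 z, v2 z + W2 z)" if "z \<in> Up"
        using N1[of z] zO that by (simp add: W1_def W2_def)
      show "Nvec (\<theta> z) = (u2 z, v2 z)" if "z \<notin> Up"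
        using N2[of z] zO that side by blast
    qed (use abO O' H u2 v2 \<gamma> in \<open>auto intro: continuous_on_subset\<close>)
  qed
  have cross: False if "z1 \<in> A' \<inter> Up" "z2 \<in> A' \<inter> Um" "F z1 = F z2" for z1 z2
  proof (rule no_crossing[OF _ cWab A'(1) A'box A'(2)[unfolded RB(3)] _ _ _ side(1,2,3) that(1,2)])
    fix \<phi> \<phi>x \<phi>y :: "plane \<Rightarrow> real" and C
    assume \<phi>: "compact C" "C \<subseteq> box a b" "\<And>z. z \<notin> C \<Longrightarrow> \<phi> z = 0"
      "\<And>z. has_grad \<phi> (\<phi>x z) (\<phi>y z) z" "continuous_on UNIV \<phi>x" "continuous_on UNIV \<phi>y"
    show "integral (cbox a b) (\<lambda>z. if z \<in> Up then W1 z * \<phi>x z + W2 z * \<phi>y z else 0) = 0"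
      using C1weak[of C \<phi> \<phi>x \<phi>y] \<phi> by blast
  next
    fix z assume "z \<in> A'"
    then have "z \<in> S" using A'A Q by blast
    then show "has_grad (\<lambda>z. fst (T z)) w1 w2 z" "has_grad (\<lambda>z. snd (T z)) (- W2 z) (W1 z) z"
      "0 < w1 * W1 z + w2 * W2 z"
      using gl gF' by (auto simp: T_def S_def)
  qed (use that in \<open>auto simp: T_def\<close>)
  have FQ: "F (Q (s, t)) = t" "l (Q (s, t)) = s" if "(s, t) \<in> B" for s t
    using TQ[OF that] by (auto simp: T_def)
  have lev: "z \<in> \<gamma>" if z: "z \<in> A'" "F z = c" for z
  proof (rule ccontr)
    assume n: "z \<notin> \<gamma>"
    have zl: "(l z, c) \<in> R" using z A'(2) homeomorphism_image1 by (force simp: T_def)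
    have Qz: "Q (l z, c) = z" using QT[of z] z A'A by (auto simp: T_def)
    \<comment> \<open>Near \<open>z\<close> the line \<open>l = l z\<close> stays in
      \<open>G\<close> and realises every level close to \<open>c\<close>; near \<open>p\<close> the
      set \<open>G'\<close> contains a point \<open>y\<close> of such a level. The two points then
      share a level.\<close>
    have *: False if G: "open G" "open G'" "z \<in> G" "p \<in> closure G'"
      and x: "\<And>z1 z2. z1 \<in> A' \<inter> G \<Longrightarrow> z2 \<in> A' \<inter> G' \<Longrightarrow> F z1 \<noteq> F z2" for G G'
    proof -
      have "open (R \<inter> Q -` G)"
        using continuous_open_preimage[OF continuous_on_subset[OF cQ RB(2)] RB(1) G(1)] .
      moreover have "(l z, c) \<in> R \<inter> Q -` G" using zl Qz G by simp
      ultimately obtain d where d: "d > 0" "{l z - d<..<l z + d} \<times> {c - d<..<c + d} \<subseteq> R \<inter> Q -` G"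
        using open_contains_plane_box[of "R \<inter> Q -` G" "(l z, c)"] by auto
      have "open (A' \<inter> T -` (UNIV \<times> {c - d<..<c + d}))"
        by (rule continuous_open_preimage[OF continuous_on_subset[OF cT A'A] A'(1)]) (simp add: open_Times)
      moreover have "p \<in> A' \<inter> T -` (UNIV \<times> {c - d<..<c + d})" using pA' Tp d by simp
      ultimately have "A' \<inter> T -` (UNIV \<times> {c - d<..<c + d}) \<inter> G' \<noteq> {}"
        by (rule closure_meets_open[OF G(4)])
      then obtain y where "y \<in> A' \<inter> T -` (UNIV \<times> {c - d<..<c + d}) \<inter> G'" by (rule ex_in_conv[THEN iffD2, THEN exE])
      then have y: "y \<in> G'" "y \<in> A'" "T y \<in> UNIV \<times> {c - d<..<c + d}" by simp_all
      from y(3) have "(l z, F y) \<in> {l z - d<..<l z + d} \<times> {c - d<..<c + d}" using d(1) by (simp add: T_def)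
      then have 1: "(l z, F y) \<in> R \<inter> Q -` G" using d(2) by blast
      then have "Q (l z, F y) \<in> A' \<inter> G" by (auto simp: A'_def)
      moreover have "F (Q (l z, F y)) = F y" using 1 RB by (intro FQ) blast
      ultimately show False using x[of "Q (l z, F y)" y] y by blast
    qed
    have "z \<in> Up \<or> z \<in> Um" using n z A'box boxO side by blast
    then show False
    proof
      assume "z \<in> Up" then show False
        using *[of Up Um] side p cross by metis
    next
      assume "z \<in> Um" then show False
        using *[of Um Up] side p cross by metis
    qed
  qed
  define X where "X t = Q (t, c)" for t
  define I where "I = {l0 - r<..<l0 + r}"
  have IR: "(t, c) \<in> R" if "t \<in> I" for t using that r by (auto simp: I_def R_def)
  have X\<gamma>: "X ` I \<subseteq> \<gamma>"
  proof
    fix x assume "x \<in> X ` I"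
    then obtain t where t: "t \<in> I" "x = Q (t, c)" by (auto simp: X_def)
    then have "x \<in> A'" "F x = c" using IR[OF t(1)] FQ(1)[of t c] RB by (auto simp: A'_def)
    then show "x \<in> \<gamma>" by (rule lev)
  qed
  have cX: "continuous_on I X" unfolding X_def
    by (rule continuous_on_compose2[OF cQ]) (use IR RB in \<open>auto intro!: continuous_intros\<close>)
  have iX: "inj_on X I"
  proof (rule inj_onI)
    fix s t assume "s \<in> I" "t \<in> I" "X s = X t"
    then show "s = t" using FQ(2)[of s c] FQ(2)[of t c] IR RB by (metis X_def subsetD)
  qed
  \<comment> \<open>Inside \<open>G0\<close> the crack is contained in the arc \<open>X\<close>,
    that is, in the level set; this is the reverse of \<open>lev\<close>.\<close>
  obtain G0 where G0: "open G0" "X ` I = \<gamma> \<inter> G0"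
    using arc_relatively_open[OF \<gamma>(1) _ cX iX X\<gamma>] by (auto simp: I_def)
  have pG0: "p \<in> G0" using G0(2) Qp r by (force simp: X_def I_def)
  have small: "\<exists>d>0. d \<le> r \<and> Q ` ({l0 - d<..<l0 + d} \<times> {c - d<..<c + d}) \<subseteq> G" if G: "open G" "p \<in> G" for G
  proof -
    have "open (R \<inter> Q -` G)"
      using continuous_open_preimage[OF continuous_on_subset[OF cQ RB(2)] RB(1) G(1)] .
    moreover have "(l0, c) \<in> R \<inter> Q -` G" using Qp G r by (simp add: R_def)
    ultimately obtain d where d: "d > 0" "{l0 - d<..<l0 + d} \<times> {c - d<..<c + d} \<subseteq> R \<inter> Q -` G"
      using open_contains_plane_box[of "R \<inter> Q -` G" "(l0, c)"] by auto
    have "{l0 - min d r<..<l0 + min d r} \<times> {c - min d r<..<c + min d r} \<subseteq> {l0 - d<..<l0 + d} \<times> {c - d<..<c + d}"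
      by auto
    then have "Q ` ({l0 - min d r<..<l0 + min d r} \<times> {c - min d r<..<c + min d r}) \<subseteq> G" using d(2) by blast
    then show ?thesis using d(1) r(1) by (intro exI[of _ "min d r"]) auto
  qed
  obtain d where d: "d > 0" "d \<le> r" "Q ` ({l0 - d<..<l0 + d} \<times> {c - d<..<c + d}) \<subseteq> G0"
    using small[OF G0(1) pG0] by blast
  define P where "P d = {l0 - d<..<l0 + d} \<times> {c - d<..<c + d}" for d
  have PB: "open (P d')" "P d' \<subseteq> B" "P d' \<subseteq> R" if "d' \<le> r" for d'
    using that RB by (auto simp: P_def R_def open_Times)
  define V where "V = Q ` P d"
  have V: "open V" "homeomorphism V (P d) T Q" unfolding V_def using oQ hQ PB d by auto
  have pV: "p \<in> V" unfolding V_def P_def using Qp d by (intro image_eqI[of _ _ "(l0, c)"]) auto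
  have VA': "V \<subseteq> A'" unfolding V_def A'_def by (rule image_mono[OF PB(3)[OF d(2)]])
  have VO: "V \<subseteq> O'" using VA' A'box boxO by blast
  have \<gamma>V: "\<gamma> \<inter> V = {z \<in> V. F z = c}"
  proof (intro equalityI subsetI)
    fix z assume z: "z \<in> \<gamma> \<inter> V"
    then have "z \<in> X ` I" using G0(2) d(3) by (auto simp: V_def P_def)
    then obtain t where t: "t \<in> I" "z = Q (t, c)" by (auto simp: X_def)
    then show "z \<in> {z \<in> V. F z = c}" using z FQ(1)[of t c] IR RB by auto
  qed (use lev VA' in auto)
  \<comment> \<open>In the chart \<open>T\<close> the two halves are open rectangles.\<close>
  have halfconn: "connected {z \<in> Q ` P d'. F z - c > 0}" "connected {z \<in> Q ` P d'. F z - c < 0}" if "d' \<le> r" for d'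
  proof -
    have FQ': "F (Q v) = snd v" if "v \<in> P d'" for v
      using that PB(2)[OF \<open>d' \<le> r\<close>] FQ(1)[of "fst v" "snd v"] by auto
    have "{z \<in> Q ` P d'. F z - c > 0} = Q ` {v \<in> P d'. c < snd v}" using FQ' by auto
    also have "{v \<in> P d'. c < snd v} = {l0 - d'<..<l0 + d'} \<times> {c<..<c + d'}" by (auto simp: P_def)
    finally have e1: "{z \<in> Q ` P d'. F z - c > 0} = Q ` ({l0 - d'<..<l0 + d'} \<times> {c<..<c + d'})" .
    have "{z \<in> Q ` P d'. F z - c < 0} = Q ` {v \<in> P d'. snd v < c}" using FQ' by auto
    also have "{v \<in> P d'. snd v < c} = {l0 - d'<..<l0 + d'} \<times> {c - d'<..<c}" by (auto simp: P_def)
    finally have e2: "{z \<in> Q ` P d'. F z - c < 0} = Q ` ({l0 - d'<..<l0 + d'} \<times> {c - d'<..<c})" .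
    have s1: "{l0 - d'<..<l0 + d'} \<times> {c<..<c + d'} \<subseteq> B" "{l0 - d'<..<l0 + d'} \<times> {c - d'<..<c} \<subseteq> B"
      using PB(2)[OF that] by (auto simp: P_def)
    show "connected {z \<in> Q ` P d'. F z - c > 0}" "connected {z \<in> Q ` P d'. F z - c < 0}"
      unfolding e1 e2
      by (intro connected_continuous_image continuous_on_subset[OF cQ] s1 connected_Times; simp)+
  qed
  have smallV: "\<exists>V0. open V0 \<and> p \<in> V0 \<and> V0 \<subseteq> V \<inter> G \<and>
        connected {z \<in> V0. F z - c > 0} \<and> connected {z \<in> V0. F z - c < 0}" if G: "open G" "p \<in> G" for G
  proof -
    obtain d' where d': "d' > 0" "d' \<le> r" "Q ` ({l0 - d'<..<l0 + d'} \<times> {c - d'<..<c + d'}) \<subseteq> V \<inter> G"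
      using small[OF open_Int[OF V(1) G(1)]] pV G(2) by blast
    have "p \<in> Q ` P d'" unfolding P_def using Qp d' by (intro image_eqI[of _ _ "(l0, c)"]) auto
    then show ?thesis
      using d' halfconn[OF d'(2)] oQ[OF PB(1,2)[OF d'(2)]] unfolding P_def by blast
  qed
  have sub: "{z \<in> V. F z - c > 0} \<subseteq> Up \<union> Um" "{z \<in> V. F z - c < 0} \<subseteq> Up \<union> Um"
    using VO side \<gamma>V by fastforce+
  have s1: "{z \<in> V. F z - c > 0} \<subseteq> Up \<or> {z \<in> V. F z - c > 0} \<subseteq> Um"
    using halfconn(1)[OF d(2)] sub(1) side unfolding V_def by (intro connected_in_one_side) auto
  have s2: "{z \<in> V. F z - c < 0} \<subseteq> Up \<or> {z \<in> V. F z - c < 0} \<subseteq> Um"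
    using halfconn(2)[OF d(2)] sub(2) side unfolding V_def by (intro connected_in_one_side) auto
  have split: "V \<subseteq> {z \<in> V. F z - c > 0} \<union> {z \<in> V. F z - c < 0} \<union> \<gamma>" using \<gamma>V by force
  have ex: "V \<inter> Up \<noteq> {}" "V \<inter> Um \<noteq> {}"
    using closure_meets_open[OF p(2) V(1) pV] closure_meets_open[OF p(3) V(1) pV] .
  \<comment> \<open>Each half lies in one side, and both sides meet \<open>V\<close>; so the halves
    are distributed one to each side.\<close>
  have "\<exists>e\<in>{1, -1 :: real}. Up \<inter> V = {z \<in> V. e * (F z - c) > 0} \<and> Um \<inter> V = {z \<in> V. e * (F z - c) < 0}"
  proof (cases "{z \<in> V. F z - c > 0} \<subseteq> Up")
    case True
    then have m: "{z \<in> V. F z - c < 0} \<subseteq> Um" using s2 split ex(2) side by blast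
    have "Up \<inter> V = {z \<in> V. 1 * (F z - c) > 0} \<and> Um \<inter> V = {z \<in> V. 1 * (F z - c) < 0}"
      using True m split side unfolding mult_1 by blast
    then show ?thesis by blast
  next
    case False
    then have m: "{z \<in> V. F z - c > 0} \<subseteq> Um" using s1 by blast
    then have m': "{z \<in> V. F z - c < 0} \<subseteq> Up" using s2 split ex(1) side by blast
    have "-1 * x > 0 \<longleftrightarrow> x < 0" "-1 * x < 0 \<longleftrightarrow> x > 0" for x :: real by auto
    then have "Up \<inter> V = {z \<in> V. -1 * (F z - c) > 0} \<and> Um \<inter> V = {z \<in> V. -1 * (F z - c) < 0}"
      using m m' split side by blast
    then show ?thesis by blast
  qed
  then obtain e where e: "e \<in> {1, -1 :: real}" "Up \<inter> V = {z \<in> V. e * (F z - c) > 0}" "Um \<inter> V = {z \<in> V. e * (F z - c) < 0}"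
    by blast
  have "C1_curve_param (\<gamma> \<inter> V) X (l0 - d) (l0 + d)"
  proof -
    obtain ax ay where ga: "\<forall>z\<in>B. has_grad (\<lambda>z. fst (Q z)) (ax z) (ay z) z" "continuous_on B ax" "continuous_on B ay"
      using C1_onE[OF Q(6)] by blast
    obtain bx b_y where gb: "\<forall>z\<in>B. has_grad (\<lambda>z. snd (Q z)) (bx z) (b_y z) z" "continuous_on B bx" "continuous_on B b_y"
      using C1_onE[OF Q(7)] by blast
    define J where "J = {l0 - d<..<l0 + d}"
    have JP: "(t, c) \<in> P d" if "t \<in> J" for t using that d by (auto simp: J_def P_def)
    have JB: "(t, c) \<in> B" if "t \<in> J" for t using JP[OF that] PB d by blast
    have dX: "(X has_vector_derivative (ax (t, c), bx (t, c))) (at t)" if "t \<in> J" for t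
    proof -
      have "DERIV (\<lambda>t. fst (Q (t, c))) t :> ax (t, c)" "DERIV (\<lambda>t. snd (Q (t, c))) t :> bx (t, c)"
        using has_grad_partials(1) ga(1) gb(1) JB[OF that] by blast+
      then have "((\<lambda>t. (fst (Q (t, c)), snd (Q (t, c)))) has_vector_derivative (ax (t, c), bx (t, c))) (at t)"
        by (intro has_vector_derivative_Pair) (simp_all add: has_real_derivative_iff_has_vector_derivative)
      then show ?thesis by (simp add: X_def[abs_def])
    qed
    \<comment> \<open>\<open>l\<close> inverts the parametrization: \<open>l (X t) = t\<close> rules
      out a vanishing velocity.\<close>
    have n0: "(ax (t, c), bx (t, c)) \<noteq> 0" if t: "t \<in> J" for t
    proof
      assume "(ax (t, c), bx (t, c)) = 0"
      then have "DERIV (\<lambda>t. l (X t)) t :> 0"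
        using has_grad_along[OF gl dX[OF t]] by (simp add: prod_eq_iff)
      moreover have "DERIV (\<lambda>t. l (X t)) t :> 1"
        by (rule has_field_derivative_transform_within_open[of "\<lambda>t. t" _ _ J])
           (use t FQ(2)[OF JB] in \<open>auto simp: J_def X_def\<close>)
      ultimately show False using DERIV_unique by fastforce
    qed
    have "continuous_on J (\<lambda>t. (ax (t, c), bx (t, c)))"
      by (intro continuous_on_Pair continuous_on_compose2[OF ga(2)] continuous_on_compose2[OF gb(2)] continuous_intros)
         (use JB in auto)
    then have 1: "X C1_differentiable_on J" unfolding C1_differentiable_on_def
      using dX by (intro exI[of _ "\<lambda>t. (ax (t, c), bx (t, c))"]) simp
    have img: "X ` J = \<gamma> \<inter> V"
    proof (intro equalityI subsetI)
      fix z assume "z \<in> X ` J"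
      then show "z \<in> \<gamma> \<inter> V" unfolding \<gamma>V using JP JB FQ(1) by (auto simp: X_def V_def)
    next
      fix z assume "z \<in> \<gamma> \<inter> V"
      then have z: "z \<in> V" "F z = c" using \<gamma>V by auto
      then have "T z \<in> P d" "Q (T z) = z" using V(2) by (auto simp: homeomorphism_def)
      then show "z \<in> X ` J" using z(2) by (auto simp: T_def P_def X_def J_def intro!: image_eqI[of _ _ "l z"])
    qed
    have "homeomorphism J (\<gamma> \<inter> V) X l"
    proof (rule homeomorphismI)
      show "continuous_on J X" using d by (intro continuous_on_subset[OF cX]) (auto simp: J_def I_def)
      show "continuous_on (\<gamma> \<inter> V) l" unfolding l_def by (intro continuous_intros)
      show "X ` J \<subseteq> \<gamma> \<inter> V" using img by blast
      show lX: "l (X t) = t" if "t \<in> J" for t using FQ(2)[OF JB[OF that]] by (simp add: X_def)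
      show "l ` (\<gamma> \<inter> V) \<subseteq> J" using lX img by force
      show "X (l z) = z" if "z \<in> \<gamma> \<inter> V" for z using that lX unfolding img[symmetric] by auto
    qed
    then show ?thesis unfolding C1_curve_param_def J_def[symmetric]
      using 1 n0 vector_derivative_at[OF dX] by auto
  qed
  moreover have "has_grad F (- (v1 z - v2 z)) (u1 z - u2 z) z" if "z \<in> V" for z
    using gF[of z] that VA' A'box by (auto simp: W1_def W2_def)
  ultimately show thesis
    using that[OF V(1) pV VO _ _ \<gamma>V e smallV] by blast
qed

section \<open>Extension of the field across the crack\<close>

lemma has_derivative_pair_grad:
  assumes "has_grad (\<lambda>z. fst (P z)) a b z" "has_grad (\<lambda>z. snd (P z)) c d z"
  shows "(P has_derivative (\<lambda>h. (fst h * a + snd h * b, fst h * c + snd h * d))) (at z)"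
  using has_derivative_Pair[OF assms[unfolded has_grad_def]] by simp

lemma jacobian_det_eq:
  assumes "has_grad (\<lambda>z. fst (P z)) a b z" "has_grad (\<lambda>z. snd (P z)) c d z"
  shows "jacobian_det P z = a * d - b * c"
  using frechet_derivative_at[OF has_derivative_pair_grad[OF assms], symmetric]
  unfolding jacobian_det_def by simp

text \<open>The increment of \<open>P\<close> over a fixed \<open>\<sigma>\<close>-interval is the integral of \<open>Nperp \<Theta>\<close>, and \<open>\<Theta>\<close> is
  an initial angle minus a \<open>C\<^sup>1\<close> function; the increment therefore is a \<open>C\<^sup>1\<close> vector rotated by the
  initial angle, which makes cosine and sine of that angle \<open>C\<^sup>1\<close>.\<close>

lemma characteristic_direction_C1:
  fixes P :: "plane \<Rightarrow> plane" and \<Theta> H :: "plane \<Rightarrow> real"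
  assumes W: "open W" "z0 \<in> W"
    and P1: "C1_on (\<lambda>z. fst (P z)) W" and P2: "C1_on (\<lambda>z. snd (P z)) W"
    and H: "C1_on H \<Omega>" and P\<Omega>: "\<And>z. z \<in> W \<Longrightarrow> P z \<in> \<Omega>" and inj: "inj_on P W"
    and dP: "\<And>\<sigma> \<tau>. (\<sigma>, \<tau>) \<in> W \<Longrightarrow> ((\<lambda>r. P (r, \<tau>)) has_vector_derivative Nperp (\<Theta> (\<sigma>, \<tau>))) (at \<sigma>)"
    and d\<Theta>: "\<And>\<sigma> \<tau>. (\<sigma>, \<tau>) \<in> W \<Longrightarrow> ((\<lambda>r. \<Theta> (r, \<tau>)) has_real_derivative - H (P (\<sigma>, \<tau>))) (at \<sigma>)"
  obtains W' where "open W'" "z0 \<in> W'" "W' \<subseteq> W"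
    "C1_on (\<lambda>z. cos (\<Theta> z)) W'" "C1_on (\<lambda>z. sin (\<Theta> z)) W'"
proof -
  obtain \<rho> where \<rho>: "\<rho> > 0" "{fst z0 - \<rho><..<fst z0 + \<rho>} \<times> {snd z0 - \<rho><..<snd z0 + \<rho>} \<subseteq> W"
    using open_contains_plane_box[OF W] by blast
  define J where "J = {snd z0 - \<rho><..<snd z0 + \<rho>}"
  \<comment> \<open>An integral is controlled only strictly to the right of its lower limit. So
    \<open>\<kappa>\<close> starts at \<open>s0\<close>, the integrals of its cosine and sine start
    at \<open>s1\<close>, and the increment of \<open>P\<close> is taken from \<open>s1\<close> to
    \<open>s2\<close>, with the base point in between.\<close>
  define s0 where "s0 = fst z0 - \<rho> / 2"
  define s1 where "s1 = fst z0 - \<rho> / 4"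
  define s2 where "s2 = fst z0 + \<rho> / 4"
  define b where "b = fst z0 + \<rho>"
  have s: "s0 < s1" "s1 < fst z0" "fst z0 < s2" "s2 < b" using \<rho> by (auto simp: s0_def s1_def s2_def b_def)
  have RW: "{s0..<b} \<times> J \<subseteq> W" using \<rho> by (auto simp: s0_def b_def J_def subset_iff)
  have oJ: "open J" by (simp add: J_def)
  have HP: "C1_on (\<lambda>z. H (P z)) W"
    using C1_on_compose[OF H P1 P2] P\<Omega> by simp
  define \<kappa> where "\<kappa> z = integral {s0..fst z} (\<lambda>r. H (P (r, snd z)))" for z
  have C\<kappa>: "C1_on \<kappa> ({s0<..<b} \<times> J)" unfolding \<kappa>_def
    by (rule C1_on_integral_upper[OF C1_on_subset[OF HP RW] oJ])
  define \<alpha> where "\<alpha> \<tau> = \<Theta> (s0, \<tau>)" for \<tau>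
  have \<Theta>: "\<Theta> (\<sigma>, \<tau>) = \<alpha> \<tau> - \<kappa> (\<sigma>, \<tau>)" if "s0 < \<sigma>" "\<sigma> < b" "\<tau> \<in> J" for \<sigma> \<tau>
  proof -
    have "((\<lambda>r. - H (P (r, \<tau>))) has_integral \<Theta> (\<sigma>, \<tau>) - \<Theta> (s0, \<tau>)) {s0..\<sigma>}"
    proof (rule fundamental_theorem_of_calculus)
      fix r assume "r \<in> {s0..\<sigma>}"
      then have "(r, \<tau>) \<in> W" using RW that by auto
      then show "((\<lambda>r. \<Theta> (r, \<tau>)) has_vector_derivative - H (P (r, \<tau>))) (at r within {s0..\<sigma>})"
        using d\<Theta> by (simp add: has_real_derivative_iff_has_vector_derivative has_vector_derivative_at_within)
    qed (use that in simp)
    from has_integral_neg[OF this] show ?thesis by (simp add: \<kappa>_def \<alpha>_def integral_unique)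
  qed
  define R where "R = {s1..<b} \<times> J"
  have RR: "R \<subseteq> {s0<..<b} \<times> J" using s by (auto simp: R_def)
  have C\<kappa>R: "C1_on \<kappa> R" by (rule C1_on_subset[OF C\<kappa> RR])
  define W' where "W' = {s1<..<b} \<times> J"
  have W'R: "W' \<subseteq> R" by (auto simp: W'_def R_def)
  have oW': "open W'" using oJ by (simp add: W'_def open_Times)
  define Cc where "Cc z = integral {s1..fst z} (\<lambda>r. cos (\<kappa> (r, snd z)))" for z
  define Ss where "Ss z = integral {s1..fst z} (\<lambda>r. sin (\<kappa> (r, snd z)))" for z
  have CC: "C1_on Cc W'" "C1_on Ss W'" unfolding Cc_def Ss_def W'_def
    by (rule C1_on_integral_upper[OF _ oJ], rule C1_on_cos C1_on_sin, rule C\<kappa>R[unfolded R_def])+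
  define CC where "CC z = Cc (s2, snd z)" for z :: plane
  define SS where "SS z = Ss (s2, snd z)" for z :: plane
  have C3: "C1_on CC W'" "C1_on SS W'" unfolding CC_def SS_def
    by (rule C1_on_compose[OF CC(1) C1_on_const C1_on_snd] C1_on_compose[OF CC(2) C1_on_const C1_on_snd];
        use s in \<open>auto simp: W'_def\<close>)+
  define X1 where "X1 z = fst (P (s2, snd z)) - fst (P (s1, snd z))" for z :: plane
  define X2 where "X2 z = snd (P (s2, snd z)) - snd (P (s1, snd z))" for z :: plane
  have inW: "(s2, snd z) \<in> W" "(s1, snd z) \<in> W" if "z \<in> W'" for z
    using that s RW by (auto simp: W'_def)
  have C4: "C1_on X1 W'" unfolding X1_def
    by (rule C1_on_diff; rule C1_on_compose[OF P1 C1_on_const C1_on_snd]) (use inW in auto)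
  have C5: "C1_on X2 W'" unfolding X2_def
    by (rule C1_on_diff; rule C1_on_compose[OF P2 C1_on_const C1_on_snd]) (use inW in auto)
  have X: "X1 z = sin (\<alpha> (snd z)) * CC z - cos (\<alpha> (snd z)) * SS z"
          "X2 z = - cos (\<alpha> (snd z)) * CC z - sin (\<alpha> (snd z)) * SS z" if z: "z \<in> W'" for z
  proof -
    define \<tau> where "\<tau> = snd z"
    have \<tau>: "\<tau> \<in> J" using z by (auto simp: W'_def \<tau>_def)
    have cont: "continuous_on {s1..s2} (\<lambda>r. \<kappa> (r, \<tau>))"
      by (rule continuous_on_compose2[OF C1_on_continuous[OF C\<kappa>R]]) (use s \<tau> in \<open>auto simp: R_def intro!: continuous_intros\<close>)
    have Ic: "((\<lambda>r. cos (\<kappa> (r, \<tau>))) has_integral CC z) {s1..s2}"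
      unfolding CC_def Cc_def fst_conv snd_conv \<tau>_def[symmetric]
      by (intro integrable_integral integrable_continuous_interval continuous_intros cont)
    have Is: "((\<lambda>r. sin (\<kappa> (r, \<tau>))) has_integral SS z) {s1..s2}"
      unfolding SS_def Ss_def fst_conv snd_conv \<tau>_def[symmetric]
      by (intro integrable_integral integrable_continuous_interval continuous_intros cont)
    have ds: "((\<lambda>r. P (r, \<tau>)) has_vector_derivative Nperp (\<alpha> \<tau> - \<kappa> (r, \<tau>))) (at r within {s1..s2})"
      if r: "r \<in> {s1..s2}" for r
    proof -
      have "(r, \<tau>) \<in> W" using RW r \<tau> s by auto
      then show ?thesis using dP[of r \<tau>] \<Theta>[of r \<tau>] r s \<tau> by (auto intro: has_vector_derivative_at_within)
    qed
    have "((\<lambda>r. sin (\<alpha> \<tau> - \<kappa> (r, \<tau>))) has_integral X1 z) {s1..s2}" unfolding X1_def \<tau>_def[symmetric]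
    proof (rule fundamental_theorem_of_calculus)
      fix r assume "r \<in> {s1..s2}"
      from bounded_linear.has_vector_derivative[OF bounded_linear_fst ds[OF this]]
      show "((\<lambda>r. fst (P (r, \<tau>))) has_vector_derivative sin (\<alpha> \<tau> - \<kappa> (r, \<tau>))) (at r within {s1..s2})"
        by (simp add: Nperp_def)
    qed (use s in simp)
    moreover have "((\<lambda>r. sin (\<alpha> \<tau>) * cos (\<kappa> (r, \<tau>)) - cos (\<alpha> \<tau>) * sin (\<kappa> (r, \<tau>))) has_integral
       sin (\<alpha> \<tau>) * CC z - cos (\<alpha> \<tau>) * SS z) {s1..s2}"
      by (intro has_integral_diff has_integral_mult_right Ic Is)
    ultimately show "X1 z = sin (\<alpha> (snd z)) * CC z - cos (\<alpha> (snd z)) * SS z"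
      unfolding sin_diff \<tau>_def by (rule has_integral_unique)
    have "((\<lambda>r. - cos (\<alpha> \<tau> - \<kappa> (r, \<tau>))) has_integral X2 z) {s1..s2}" unfolding X2_def \<tau>_def[symmetric]
    proof (rule fundamental_theorem_of_calculus)
      fix r assume "r \<in> {s1..s2}"
      from bounded_linear.has_vector_derivative[OF bounded_linear_snd ds[OF this]]
      show "((\<lambda>r. snd (P (r, \<tau>))) has_vector_derivative - cos (\<alpha> \<tau> - \<kappa> (r, \<tau>))) (at r within {s1..s2})"
        by (simp add: Nperp_def)
    qed (use s in simp)
    moreover have "((\<lambda>r. - (cos (\<alpha> \<tau>) * cos (\<kappa> (r, \<tau>)) + sin (\<alpha> \<tau>) * sin (\<kappa> (r, \<tau>)))) has_integral
       - (cos (\<alpha> \<tau>) * CC z + sin (\<alpha> \<tau>) * SS z)) {s1..s2}"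
      by (intro has_integral_neg has_integral_add has_integral_mult_right Ic Is)
    ultimately have "X2 z = - (cos (\<alpha> \<tau>) * CC z + sin (\<alpha> \<tau>) * SS z)"
      unfolding cos_diff by (rule has_integral_unique)
    then show "X2 z = - cos (\<alpha> (snd z)) * CC z - sin (\<alpha> (snd z)) * SS z" by (simp add: \<tau>_def)
  qed
  \<comment> \<open>Up to sign, \<open>N2\<close> is the determinant of the linear system
    \<open>X\<close> for the sine and cosine of the initial angle. If it vanished, \<open>P\<close>
    would agree at \<open>s1\<close> and \<open>s2\<close>, against injectivity.\<close>
  define N2 where "N2 z = CC z * CC z + SS z * SS z" for z
  have N2: "N2 z \<noteq> 0" if z: "z \<in> W'" for z
  proof
    assume "N2 z = 0"
    then have "CC z = 0 \<and> SS z = 0" unfolding N2_def by (simp add: sum_squares_eq_zero_iff)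
    then have "X1 z = 0" "X2 z = 0" using X[OF z] by auto
    then have "P (s2, snd z) = P (s1, snd z)" by (simp add: X1_def X2_def prod_eq_iff)
    then have "(s2, snd z) = (s1, snd z)" using inj inW[OF z] by (auto dest: inj_onD)
    then show False using s by simp
  qed
  define Sa where "Sa z = (CC z * X1 z - SS z * X2 z) / N2 z" for z
  define Ca where "Ca z = - (SS z * X1 z + CC z * X2 z) / N2 z" for z
  have sa: "sin (\<alpha> (snd z)) = Sa z" and ca: "cos (\<alpha> (snd z)) = Ca z" if z: "z \<in> W'" for z
    using N2[OF z] unfolding Sa_def Ca_def X[OF z]
    by (simp_all add: field_simps) (simp_all add: N2_def algebra_simps)
  have "\<Theta> z = \<alpha> (snd z) - \<kappa> z" if "z \<in> W'" for z
    using \<Theta>[of "fst z" "snd z"] that s by (auto simp: W'_def)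
  then have c\<Theta>: "cos (\<Theta> z) = Ca z * cos (\<kappa> z) + Sa z * sin (\<kappa> z)"
    and s\<Theta>: "sin (\<Theta> z) = Sa z * cos (\<kappa> z) - Ca z * sin (\<kappa> z)" if "z \<in> W'" for z
    using that by (simp_all only: cos_diff sin_diff sa ca)
  have CN: "C1_on N2 W'" unfolding N2_def by (intro Ck1_intros C3)
  have CSa: "C1_on Sa W'" and CCa: "C1_on Ca W'"
    unfolding Sa_def Ca_def by (intro Ck1_intros C3 C4 C5 CN N2; assumption)+
  have C\<kappa>W: "C1_on \<kappa> W'" by (rule C1_on_subset[OF C\<kappa>R W'R])
  show thesis
  proof (rule that[OF oW'])
    show "z0 \<in> W'" using s \<rho> by (auto simp: W'_def J_def mem_Times_iff)
    show "W' \<subseteq> W" using RW s by (auto simp: W'_def)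
    have "C1_on (\<lambda>z. Ca z * cos (\<kappa> z) + Sa z * sin (\<kappa> z)) W'"
      by (intro Ck1_intros CSa CCa C\<kappa>W)
    then show "C1_on (\<lambda>z. cos (\<Theta> z)) W'" by (rule C1_on_cong[OF _ oW']) (simp add: c\<Theta>)
    have "C1_on (\<lambda>z. Sa z * cos (\<kappa> z) - Ca z * sin (\<kappa> z)) W'"
      by (intro Ck1_intros CSa CCa C\<kappa>W)
    then show "C1_on (\<lambda>z. sin (\<Theta> z)) W'" by (rule C1_on_cong[OF _ oW']) (simp add: s\<Theta>)
  qed
qed

text \<open>The characteristic system prescribes the derivative of the field N = (cos \<Theta>, sin
  \<Theta>) in the direction of its perpendicular, and differentiating |N|^2 = 1 supplies the
  remaining relations. No derivative of \<open>\<Theta>\<close> in the seed parameter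
  occurs.\<close>

lemma characteristic_field_divergence:
  fixes P Q :: "plane \<Rightarrow> plane" and \<Theta> H :: "plane \<Rightarrow> real"
  assumes A: "open A" and B: "open B" and PQ: "homeomorphism A B P Q"
    and dP: "\<And>\<sigma> \<tau>. (\<sigma>, \<tau>) \<in> A \<Longrightarrow> ((\<lambda>r. P (r, \<tau>)) has_vector_derivative Nperp (\<Theta> (\<sigma>, \<tau>))) (at \<sigma>)"
    and d\<Theta>: "\<And>\<sigma> \<tau>. (\<sigma>, \<tau>) \<in> A \<Longrightarrow> ((\<lambda>r. \<Theta> (r, \<tau>)) has_real_derivative - H (P (\<sigma>, \<tau>))) (at \<sigma>)"
    and gu: "has_grad (\<lambda>y. cos (\<Theta> (Q y))) a b y" and gv: "has_grad (\<lambda>y. sin (\<Theta> (Q y))) c d y" and y: "y \<in> B"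
  shows "a + d = H y"
proof -
  obtain \<sigma> \<tau> where z: "Q y = (\<sigma>, \<tau>)" by force
  have zA: "(\<sigma>, \<tau>) \<in> A" using homeomorphism_image2[OF PQ] y z by (metis image_eqI)
  have Pz: "P (\<sigma>, \<tau>) = y"
    using homeomorphism_apply2[OF PQ y] z by simp
  define C where "C = cos (\<Theta> (\<sigma>, \<tau>))"
  define S where "S = sin (\<Theta> (\<sigma>, \<tau>))"
  have "open ((\<lambda>r. (r, \<tau>)) -` A)" by (rule open_vimage[OF A]) (auto intro!: continuous_intros)
  then obtain I where I: "open I" "\<sigma> \<in> I" "\<And>r. r \<in> I \<Longrightarrow> (r, \<tau>) \<in> A" using zA by blast
  have QP: "Q (P (r, \<tau>)) = (r, \<tau>)" if "r \<in> I" for r using I(3)[OF that] PQ by (auto simp: homeomorphism_def)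
  have 1: "DERIV (\<lambda>r. cos (\<Theta> (Q (P (r, \<tau>))))) \<sigma> :> S * a + (- C) * b"
    using has_grad_along[of "\<lambda>y. cos (\<Theta> (Q y))" a b "\<lambda>r. P (r, \<tau>)" \<sigma>, OF _ dP[OF zA]] gu Pz
    by (simp add: Nperp_def C_def S_def)
  have 2: "DERIV (\<lambda>r. sin (\<Theta> (Q (P (r, \<tau>))))) \<sigma> :> S * c + (- C) * d"
    using has_grad_along[of "\<lambda>y. sin (\<Theta> (Q y))" c d "\<lambda>r. P (r, \<tau>)" \<sigma>, OF _ dP[OF zA]] gv Pz
    by (simp add: Nperp_def C_def S_def)
  have "DERIV (\<lambda>r. cos (\<Theta> (r, \<tau>))) \<sigma> :> S * H y"
    using DERIV_chain2[OF DERIV_cos d\<Theta>[OF zA]] by (simp add: S_def Pz)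
  then have "DERIV (\<lambda>r. cos (\<Theta> (Q (P (r, \<tau>))))) \<sigma> :> S * H y"
    by (rule has_field_derivative_transform_within_open[OF _ I(1,2)]) (simp add: QP)
  with 1 have e1: "S * a - C * b = S * H y" using DERIV_unique by fastforce
  have "DERIV (\<lambda>r. sin (\<Theta> (r, \<tau>))) \<sigma> :> - C * H y"
    using DERIV_chain2[OF DERIV_sin d\<Theta>[OF zA]] by (simp add: C_def Pz)
  then have "DERIV (\<lambda>r. sin (\<Theta> (Q (P (r, \<tau>))))) \<sigma> :> - C * H y"
    by (rule has_field_derivative_transform_within_open[OF _ I(1,2)]) (simp add: QP)
  with 2 have e2: "S * c - C * d = - C * H y" using DERIV_unique by fastforce
  have "has_grad (\<lambda>y. cos (\<Theta> (Q y)) * cos (\<Theta> (Q y)) + sin (\<Theta> (Q y)) * sin (\<Theta> (Q y)))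
     ((a * C + C * a) + (c * S + S * c)) ((b * C + C * b) + (d * S + S * d)) y"
    using has_grad_add[OF has_grad_mult[OF gu gu] has_grad_mult[OF gv gv]] by (simp add: C_def S_def z)
  moreover have "(\<lambda>y. cos (\<Theta> (Q y)) * cos (\<Theta> (Q y)) + sin (\<Theta> (Q y)) * sin (\<Theta> (Q y))) = (\<lambda>_. 1)"
    by (simp flip: power2_eq_square)
  ultimately have "(a * C + C * a) + (c * S + S * c) = 0 \<and> (b * C + C * b) + (d * S + S * d) = 0"
    using has_grad_unique[OF _ has_grad_const[of 1]] by metis
  then have e3: "a * C + c * S = 0" "b * C + d * S = 0" by (auto simp: algebra_simps)
  have cs: "C * C + S * S = 1" by (simp add: C_def S_def flip: power2_eq_square)
  \<comment> \<open>The relations \<open>e3\<close> turn \<open>S\<close> times \<open>e1\<close>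
    into \<open>S * S * (a + d) = S * S * H y\<close>, and \<open>- C\<close> times
    \<open>e2\<close> into the same with \<open>C * C\<close>; these are added.\<close>
  have "(C * C + S * S) * (a + d) = (C * C + S * S) * H y"
    using e1 e2 e3 by algebra
  then show ?thesis by (simp add: cs)
qed

section \<open>Regions bounded by a graph, and the extension from one side\<close>

text \<open>Affine interpolation between \<open>h\<close> and \<open>e\<close> on each fibre makes
  the region a continuous image of a rectangle.\<close>

lemma connected_above_graph:
  fixes h :: "real \<Rightarrow> real"
  assumes h: "continuous_on I h" and I: "connected I" and e: "\<And>\<tau>. \<tau> \<in> I \<Longrightarrow> h \<tau> < e"
  shows "connected {z. snd z \<in> I \<and> h (snd z) < fst z \<and> fst z < e}"
proof -
  define f where "f z = (h (snd z) + fst z * (e - h (snd z)), snd z)" for z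
  have "continuous_on ({0<..<1} \<times> I) f" unfolding f_def
    by (intro continuous_intros continuous_on_compose2[OF h]) auto
  moreover have "connected {0<..<1::real}" by (simp add: convex_connected)
  ultimately have "connected (f ` ({0<..<1} \<times> I))"
    by (intro connected_continuous_image connected_Times I)
  moreover have "f ` ({0<..<1} \<times> I) = {z. snd z \<in> I \<and> h (snd z) < fst z \<and> fst z < e}"
  proof (intro equalityI subsetI)
    fix z assume "z \<in> f ` ({0<..<1} \<times> I)"
    then obtain l \<tau> where l: "0 < l" "l < 1" "\<tau> \<in> I" "z = (h \<tau> + l * (e - h \<tau>), \<tau>)" by (auto simp: f_def)
    have "0 < e - h \<tau>" using e l by simp
    then have "0 < l * (e - h \<tau>)" "l * (e - h \<tau>) < 1 * (e - h \<tau>)" using l by (simp, intro mult_strict_right_mono)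
    then show "z \<in> {z. snd z \<in> I \<and> h (snd z) < fst z \<and> fst z < e}" using l by simp
  next
    fix z assume "z \<in> {z. snd z \<in> I \<and> h (snd z) < fst z \<and> fst z < e}"
    then obtain x \<tau> where z: "z = (x, \<tau>)" "\<tau> \<in> I" "h \<tau> < x" "x < e" by (cases z) auto
    show "z \<in> f ` ({0<..<1} \<times> I)"
      by (rule image_eqI[of _ _ "((x - h \<tau>) / (e - h \<tau>), \<tau>)"]) (use z in \<open>auto simp: f_def\<close>)
  qed
  ultimately show ?thesis by simp
qed

lemma connected_below_graph:
  fixes h :: "real \<Rightarrow> real"
  assumes h: "continuous_on I h" and I: "connected I" and e: "\<And>\<tau>. \<tau> \<in> I \<Longrightarrow> e < h \<tau>"
  shows "connected {z. snd z \<in> I \<and> e < fst z \<and> fst z < h (snd z)}"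
proof -
  have "connected {z. snd z \<in> I \<and> - h (snd z) < fst z \<and> fst z < - e}"
    by (rule connected_above_graph) (use assms in \<open>auto intro!: continuous_intros\<close>)
  then have "connected ((\<lambda>z. (- fst z, snd z)) ` {z. snd z \<in> I \<and> - h (snd z) < fst z \<and> fst z < - e})"
    by (rule connected_continuous_image[rotated]) (intro continuous_intros)
  moreover have "(\<lambda>z. (- fst z, snd z)) ` {z. snd z \<in> I \<and> - h (snd z) < fst z \<and> fst z < - e} = {z. snd z \<in> I \<and> e < fst z \<and> fst z < h (snd z)}"
    by (auto simp: image_iff) (metis fst_conv minus_less_iff minus_minus neg_less_iff_less snd_conv)
  ultimately show ?thesis by simp
qed

text \<open>With the second coordinate fixed, the slice of the graph has at most one point; Fubini
  gives measure zero.\<close>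

lemma negligible_graph:
  fixes h :: "real \<Rightarrow> real"
  assumes "continuous_on {a..b} h"
  shows "negligible ((\<lambda>t. (h t, t)) ` {a..b})" (is "negligible ?G")
proof -
  have "compact ?G" using assms by (intro compact_continuous_image continuous_intros) auto
  then have G': "?G \<in> sets lborel" using compact_imp_closed borel_closed by auto
  then have G: "?G \<in> sets (lborel \<Otimes>\<^sub>M lborel)" by (simp only: lborel_prod)
  have "emeasure (lborel \<Otimes>\<^sub>M lborel) ?G = (\<integral>\<^sup>+ y. emeasure lborel ((\<lambda>x. (x, y)) -` ?G) \<partial>lborel)"
    by (rule lborel_pair.emeasure_pair_measure_alt2[OF G])
  also have "\<dots> = (\<integral>\<^sup>+ (y::real). 0 \<partial>lborel)"
  proof (rule nn_integral_cong)
    fix y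
    have "(\<lambda>x. (x, y)) -` ?G \<subseteq> {h y}" by auto
    then show "emeasure lborel ((\<lambda>x. (x, y)) -` ?G) = 0"
      by (metis emeasure_lborel_countable countable_subset countable_insert countable_empty)
  qed
  finally have "?G \<in> null_sets lborel" using G' unfolding lborel_prod by (intro null_setsI) simp_all
  then show ?thesis by (simp add: negligible_iff_null_sets null_sets_completionI)
qed


lemma divides_at_commute: "divides_at \<Omega> K p U Up Um \<longleftrightarrow> divides_at \<Omega> K p U Um Up"
  unfolding divides_at_def by (auto simp: Un_commute Int_commute)

text \<open>The field is continued by cosine and sine of \<open>\<Theta>\<close> in the chart
  \<open>P\<close>. What must be excluded is that \<open>S\<close> also reaches \<open>p\<close>
  from beyond the hitting curve, where \<open>P\<close> still follows the system but need not follow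
  \<open>\<theta>\<close>. The part of the chart beyond the hit is connected and free of crack
  points, so it lies in one side; \<open>S'\<close> accumulates at \<open>p\<close> and cannot come
  from the part before the hit, so the part beyond is in \<open>S'\<close>. The crack itself is the
  image of the graph of hitting times, which makes it null and lets each of its points inherit
  nondegeneracy.\<close>

lemma side_extension:
  fixes S S' :: "plane set"
  assumes div: "divides_at \<Omega> K p U S S'" and nd: "nondegenerate_side \<Omega> H \<theta> S (U \<inter> K) p"
    and H: "C1_on H \<Omega>"
  obtains O' u ux uy v vx vy where "open O'" "p \<in> O'" "O' \<subseteq> U"
    "\<And>z. z \<in> O' \<Longrightarrow> has_grad u (ux z) (uy z) z" "continuous_on O' ux"
    "\<And>z. z \<in> O' \<Longrightarrow> has_grad v (vx z) (vy z) z" "continuous_on O' vy"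
    "\<And>z. z \<in> O' \<Longrightarrow> ux z + vy z = H z" "\<And>z. z \<in> O' \<Longrightarrow> (u z)\<^sup>2 + (v z)\<^sup>2 = 1"
    "\<And>z. z \<in> O' \<inter> S \<Longrightarrow> Nvec (\<theta> z) = (u z, v z)" "negligible (U \<inter> K \<inter> O')"
    "\<And>q. q \<in> U \<inter> K \<inter> O' \<Longrightarrow> nondegenerate_side \<Omega> H \<theta> S (U \<inter> K) q"
proof -
  define \<gamma> where "\<gamma> = U \<inter> K"
  have dv: "open U" "U \<subseteq> \<Omega>" "p \<in> \<gamma>" "\<gamma> homeomorphic {0<..<1::real}" "open S" "open S'" "S \<inter> S' = {}"
    "U - K = S \<union> S'" "\<gamma> \<subseteq> closure S'"
    using div by (auto simp: divides_at_def \<gamma>_def frontier_def)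
  have S\<gamma>: "S \<inter> \<gamma> = {}" "S' \<inter> \<gamma> = {}" using dv(8) by (auto simp: \<gamma>_def)
  obtain g a b \<tau>0 s D P \<Theta> \<sigma>h W where
    \<tau>0: "\<tau>0 \<in> {a<..<b}" and s: "s \<in> {-1, 1::real}"
    and g: "\<forall>\<tau>\<in>{a<..<b}. g \<tau> \<in> S \<and> (g has_vector_derivative s *\<^sub>R Nvec (\<theta> (g \<tau>))) (at \<tau>)"
    and D: "open D" "D \<subseteq> UNIV \<times> {a<..<b}"
    and DI: "\<forall>\<tau>\<in>{a<..<b}. is_interval {\<sigma>. (\<sigma>, \<tau>) \<in> D} \<and> (0, \<tau>) \<in> D \<and> (\<sigma>h \<tau>, \<tau>) \<in> D"
    and ode: "\<forall>\<sigma> \<tau>. (\<sigma>, \<tau>) \<in> D \<longrightarrow>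
           P (\<sigma>, \<tau>) \<in> \<Omega> \<and>
           ((\<lambda>r. P (r, \<tau>)) has_vector_derivative Nperp (\<Theta> (\<sigma>, \<tau>))) (at \<sigma>) \<and>
           ((\<lambda>r. \<Theta> (r, \<tau>)) has_real_derivative - H (P (\<sigma>, \<tau>))) (at \<sigma>)"
    and init: "\<forall>\<tau>\<in>{a<..<b}. P (0, \<tau>) = g \<tau> \<and> \<Theta> (0, \<tau>) = \<theta> (g \<tau>)"
    and \<sigma>h: "continuous_on {a<..<b} \<sigma>h"
    and hit: "\<forall>\<tau>\<in>{a<..<b}.
           P (\<sigma>h \<tau>, \<tau>) \<in> \<gamma> \<and>
           (\<forall>\<sigma>\<in>open_segment 0 (\<sigma>h \<tau>).
              P (\<sigma>, \<tau>) \<in> S \<and>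
              ((\<lambda>r. P (r, \<tau>)) has_vector_derivative Nperp (\<theta> (P (\<sigma>, \<tau>)))) (at \<sigma>))"
    and p0: "P (\<sigma>h \<tau>0, \<tau>0) = p"
    and W: "open W" "(\<sigma>h \<tau>0, \<tau>0) \<in> W" "W \<subseteq> D"
      "C1_on (\<lambda>z. fst (P z)) W" "C1_on (\<lambda>z. snd (P z)) W"
    and jac: "jacobian_det P (\<sigma>h \<tau>0, \<tau>0) \<noteq> 0"
    using nd unfolding nondegenerate_side_def \<gamma>_def[symmetric] One_nat_def by (elim exE conjE) rule
  define \<sigma>0 where "\<sigma>0 = \<sigma>h \<tau>0"
  define z0 where "z0 = (\<sigma>0, \<tau>0)"
  have z0W: "z0 \<in> W" and Pz0: "P z0 = p" using W p0 by (auto simp: z0_def \<sigma>0_def)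
  \<comment> \<open>The seed curve runs in \<open>S\<close>, the hit is on the crack. This makes it
    meaningful to speak of points before and after the hit.\<close>
  have \<sigma>0: "\<sigma>0 \<noteq> 0"
  proof
    assume "\<sigma>0 = 0"
    then have "p = g \<tau>0" using p0 init \<tau>0 by (simp add: \<sigma>0_def)
    then have "p \<in> S" using g \<tau>0 by blast
    then show False using S\<gamma> dv by blast
  qed
  obtain ax ay where ga: "\<forall>z\<in>W. has_grad (\<lambda>z. fst (P z)) (ax z) (ay z) z" "continuous_on W ax" "continuous_on W ay"
    using C1_onE[OF W(4)] by blast
  obtain bx b_y where gb: "\<forall>z\<in>W. has_grad (\<lambda>z. snd (P z)) (bx z) (b_y z) z" "continuous_on W bx" "continuous_on W b_y"
    using C1_onE[OF W(5)] by blast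
  define \<Delta> where "\<Delta> z = ax z * b_y z - ay z * bx z" for z
  have jac\<Delta>: "jacobian_det P z = \<Delta> z" if "z \<in> W" for z
    using jacobian_det_eq ga(1) gb(1) that unfolding \<Delta>_def by blast
  have \<Delta>0: "\<Delta> z0 \<noteq> 0" using jac jac\<Delta> z0W by (simp add: z0_def \<sigma>0_def)
  have "continuous_on W \<Delta>" unfolding \<Delta>_def by (intro continuous_intros ga gb)
  then have "open (W \<inter> \<Delta> -` (- {0}))" using W(1) by (intro continuous_open_preimage) auto
  \<comment> \<open>A nonzero Jacobian throughout \<open>W1\<close> serves the chart and, later, the
    nondegeneracy of nearby crack points.\<close>
  define W1 where "W1 = W \<inter> \<Delta> -` (- {0})"
  have W1: "open W1" "z0 \<in> W1" "W1 \<subseteq> W" unfolding W1_def using \<open>open (W \<inter> \<Delta> -` (- {0}))\<close> z0W \<Delta>0 by auto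
  have "has_grad (\<lambda>z. fst (P z)) (ax z0) (ay z0) z0" "has_grad (\<lambda>z. snd (P z)) (bx z0) (b_y z0) z0"
    using ga gb z0W by auto
  then obtain A B Q where Q: "open A" "z0 \<in> A" "A \<subseteq> W1" "open B" "homeomorphism A B P Q"
    "C1_on (\<lambda>z. fst (Q z)) B" "C1_on (\<lambda>z. snd (Q z)) B"
    using plane_inverse_function[OF W1(1,2) C1_on_subset[OF W(4) W1(3)] C1_on_subset[OF W(5) W1(3)]] \<Delta>0
    unfolding \<Delta>_def by blast
  have AW: "A \<subseteq> W" "A \<subseteq> D" using Q W1 W by auto
  have injA: "inj_on P A" using Q(5) by (metis homeomorphism_def inj_on_inverseI)
  have dP: "((\<lambda>r. P (r, \<tau>)) has_vector_derivative Nperp (\<Theta> (\<sigma>, \<tau>))) (at \<sigma>)"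
    and d\<Theta>: "((\<lambda>r. \<Theta> (r, \<tau>)) has_real_derivative - H (P (\<sigma>, \<tau>))) (at \<sigma>)" if "(\<sigma>, \<tau>) \<in> D" for \<sigma> \<tau>
    using ode that by blast+
  have P\<Omega>: "P z \<in> \<Omega>" if "z \<in> A" for z using ode AW that by (cases z) blast
  have dPA: "((\<lambda>r. P (r, \<tau>)) has_vector_derivative Nperp (\<Theta> (\<sigma>, \<tau>))) (at \<sigma>)"
    and d\<Theta>A: "((\<lambda>r. \<Theta> (r, \<tau>)) has_real_derivative - H (P (\<sigma>, \<tau>))) (at \<sigma>)" if "(\<sigma>, \<tau>) \<in> A" for \<sigma> \<tau>
    using dP[of \<sigma> \<tau>] d\<Theta>[of \<sigma> \<tau>] that AW(2) by (meson subsetD)+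
  obtain A1 where A1: "open A1" "z0 \<in> A1" "A1 \<subseteq> A"
      "C1_on (\<lambda>z. cos (\<Theta> z)) A1" "C1_on (\<lambda>z. sin (\<Theta> z)) A1"
    by (rule characteristic_direction_C1[OF Q(1,2) C1_on_subset[OF W(4) AW(1)] C1_on_subset[OF W(5) AW(1)]
          H P\<Omega> injA dPA d\<Theta>A])
  have cQ: "continuous_on B Q" and cP: "continuous_on A P"
    and QP: "\<And>z. z \<in> A \<Longrightarrow> Q (P z) = z" and PQ: "\<And>y. y \<in> B \<Longrightarrow> P (Q y) = y"
    and PA: "\<And>z. z \<in> A \<Longrightarrow> P z \<in> B" and QB: "\<And>y. y \<in> B \<Longrightarrow> Q y \<in> A"
    using Q(5) by (auto simp: homeomorphism_def)
  have oP: "open (P ` R)" if "open R" "R \<subseteq> A" for R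
  proof -
    have "P ` R = B \<inter> Q -` R"
    proof (intro equalityI subsetI)
      fix z assume "z \<in> B \<inter> Q -` R"
      then show "z \<in> P ` R" using PQ[of z] by (metis IntD1 IntD2 imageI vimageE)
    qed (use that PA QP in auto)
    then show ?thesis using continuous_open_preimage[OF cQ Q(4) that(1)] by simp
  qed
  have "continuous_on {a<..<b} (\<lambda>\<tau>. (\<sigma>h \<tau>, \<tau>))" by (intro continuous_intros \<sigma>h)
  then have "open ({a<..<b} \<inter> (\<lambda>\<tau>. (\<sigma>h \<tau>, \<tau>)) -` A1)" using A1 by (intro continuous_open_preimage) auto
  moreover have "\<tau>0 \<in> {a<..<b} \<inter> (\<lambda>\<tau>. (\<sigma>h \<tau>, \<tau>)) -` A1" using \<tau>0 A1 by (simp add: z0_def \<sigma>0_def)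
  ultimately obtain \<epsilon>1 where \<epsilon>1: "\<epsilon>1 > 0" "ball \<tau>0 \<epsilon>1 \<subseteq> {a<..<b} \<inter> (\<lambda>\<tau>. (\<sigma>h \<tau>, \<tau>)) -` A1"
    using openE by blast
  define I1 where "I1 = ball \<tau>0 \<epsilon>1"
  have I1: "\<tau> \<in> {a<..<b}" "(\<sigma>h \<tau>, \<tau>) \<in> A1" if "\<tau> \<in> I1" for \<tau> using \<epsilon>1 that by (auto simp: I1_def)
  define X where "X \<tau> = P (\<sigma>h \<tau>, \<tau>)" for \<tau>
  have cX: "continuous_on I1 X" unfolding X_def
    using I1 A1 by (intro continuous_on_compose2[OF cP] continuous_intros continuous_on_subset[OF \<sigma>h]) auto
  have iX: "inj_on X I1"
  proof (rule inj_onI)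
    fix \<tau> \<tau>' assume t: "\<tau> \<in> I1" "\<tau>' \<in> I1" "X \<tau> = X \<tau>'"
    then have "(\<sigma>h \<tau>, \<tau>) = (\<sigma>h \<tau>', \<tau>')" using I1 A1(3) injA unfolding X_def by (meson inj_onD subsetD)
    then show "\<tau> = \<tau>'" by simp
  qed
  have X\<gamma>: "X ` I1 \<subseteq> \<gamma>" using hit I1(1) by (auto simp: X_def)
  \<comment> \<open>Every crack point in \<open>G\<close> is hit by a characteristic curve with
    parameter in \<open>I1\<close>.\<close>
  obtain G where G: "open G" "X ` I1 = \<gamma> \<inter> G"
    using arc_relatively_open[OF dv(4) _ cX iX X\<gamma>] by (auto simp: I1_def)
  have "\<tau>0 \<in> I1" using \<epsilon>1 by (simp add: I1_def)
  then have pG: "p \<in> G" using G(2) p0 by (force simp: X_def)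
  have "open (A1 \<inter> P -` (G \<inter> U))"
    using A1 G dv continuous_on_subset[OF cP A1(3)] by (intro continuous_open_preimage) auto
  moreover have "z0 \<in> A1 \<inter> P -` (G \<inter> U)" using A1 pG dv Pz0 by (auto simp: \<gamma>_def)
  ultimately obtain \<rho>0 where \<rho>0: "\<rho>0 > 0" "{\<sigma>0 - \<rho>0<..<\<sigma>0 + \<rho>0} \<times> {\<tau>0 - \<rho>0<..<\<tau>0 + \<rho>0} \<subseteq> A1 \<inter> P -` (G \<inter> U)"
    using open_contains_plane_box[of "A1 \<inter> P -` (G \<inter> U)" z0] unfolding z0_def fst_conv snd_conv by metis
  \<comment> \<open>The bound by \<open>\<bar>\<sigma>0\<bar>\<close> keeps
    \<open>\<sigma> = 0\<close> out of the chart box, so the seed lies on the same side of the whole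
    box.\<close>
  define \<rho> where "\<rho> = min \<rho>0 \<bar>\<sigma>0\<bar>"
  have \<rho>: "\<rho> > 0" "\<rho> \<le> \<rho>0" "\<rho> \<le> \<bar>\<sigma>0\<bar>" using \<rho>0 \<sigma>0 by (auto simp: \<rho>_def)
  have "isCont \<sigma>h \<tau>0" using \<sigma>h \<tau>0 by (simp add: continuous_on_eq_continuous_at)
  then obtain \<epsilon>2 where \<epsilon>2: "\<epsilon>2 > 0" "\<And>\<tau>. \<bar>\<tau> - \<tau>0\<bar> < \<epsilon>2 \<Longrightarrow> \<bar>\<sigma>h \<tau> - \<sigma>0\<bar> < \<rho>"
    unfolding \<sigma>0_def using \<rho>(1) by (auto simp: continuous_at_eps_delta dist_real_def)
  \<comment> \<open>Half of \<open>\<epsilon>1\<close> puts the closed interval into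
    \<open>I1\<close>, as needed for \<open>negligible_graph\<close>; \<open>\<epsilon>2\<close>
    keeps the hitting times within the height of the box.\<close>
  define \<epsilon> where "\<epsilon> = min (\<epsilon>1 / 2) (min \<epsilon>2 \<rho>0)"
  have \<epsilon>: "\<epsilon> > 0" "\<epsilon> < \<epsilon>1" "\<epsilon> \<le> \<epsilon>2" "\<epsilon> \<le> \<rho>0" using \<epsilon>1 \<epsilon>2 \<rho>0 by (auto simp: \<epsilon>_def)
  define I where "I = {\<tau>0 - \<epsilon><..<\<tau>0 + \<epsilon>}"
  have II1: "{\<tau>0 - \<epsilon>..\<tau>0 + \<epsilon>} \<subseteq> I1" using \<epsilon> by (auto simp: I1_def dist_real_def)
  have I: "\<tau> \<in> I1" "\<tau> \<in> {a<..<b}" "\<bar>\<sigma>h \<tau> - \<sigma>0\<bar> < \<rho>" if "\<tau> \<in> I" for \<tau>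
  proof -
    have "\<bar>\<tau> - \<tau>0\<bar> < \<epsilon>" using that by (auto simp: I_def)
    then show "\<bar>\<sigma>h \<tau> - \<sigma>0\<bar> < \<rho>" using \<epsilon> \<epsilon>2 by simp
    have "\<tau> \<in> {\<tau>0 - \<epsilon>..\<tau>0 + \<epsilon>}" using that by (auto simp: I_def)
    then show "\<tau> \<in> I1" using II1 by blast
    then show "\<tau> \<in> {a<..<b}" by (rule I1)
  qed
  define Bx where "Bx = {\<sigma>0 - \<rho><..<\<sigma>0 + \<rho>} \<times> I"
  have Bx: "open Bx" "z0 \<in> Bx" unfolding Bx_def using \<rho> \<epsilon> by (auto simp: I_def z0_def open_Times)
  have "Bx \<subseteq> {\<sigma>0 - \<rho>0<..<\<sigma>0 + \<rho>0} \<times> {\<tau>0 - \<rho>0<..<\<tau>0 + \<rho>0}"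
    using \<rho>(2) \<epsilon>(4) unfolding Bx_def I_def by (intro Sigma_mono) auto
  then have BxA1: "Bx \<subseteq> A1" and BxG: "\<And>z. z \<in> Bx \<Longrightarrow> P z \<in> G \<and> P z \<in> U" using \<rho>0(2) by blast+
  have BxA: "Bx \<subseteq> A" using BxA1 A1 by blast
  define O' where "O' = P ` Bx"
  have O': "open O'" "p \<in> O'" "O' \<subseteq> U"
    unfolding O'_def using oP[OF Bx(1) BxA] Bx(2) Pz0 BxG by auto
  have O'B: "O' \<subseteq> B" unfolding O'_def using BxA PA by blast
  have graph: "fst z = \<sigma>h (snd z)" if "z \<in> Bx" "P z \<in> \<gamma>" for z
  proof -
    have "P z \<in> X ` I1" using G(2) BxG that by blast
    then obtain \<tau> where \<tau>: "\<tau> \<in> I1" "P z = P (\<sigma>h \<tau>, \<tau>)" by (auto simp: X_def)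
    then have "z = (\<sigma>h \<tau>, \<tau>)" using injA I1(2)[OF \<tau>(1)] BxA that(1) A1(3) by (meson inj_onD subsetD)
    then show ?thesis by simp
  qed
  have graph': "P z \<in> \<gamma>" if "z \<in> Bx" "fst z = \<sigma>h (snd z)" for z
    using hit I(2)[of "snd z"] that by (cases z) (auto simp: Bx_def)
  \<comment> \<open>The part of the box past the hit as seen from the seed curve; on which side of
    the graph it lies depends on the sign of \<open>\<sigma>0\<close>.\<close>
  define R2 where "R2 = (if \<sigma>0 > 0 then {z. snd z \<in> I \<and> \<sigma>h (snd z) < fst z \<and> fst z < \<sigma>0 + \<rho>}
     else {z. snd z \<in> I \<and> \<sigma>0 - \<rho> < fst z \<and> fst z < \<sigma>h (snd z)})"
  have chI: "continuous_on I \<sigma>h" using I by (intro continuous_on_subset[OF \<sigma>h]) auto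
  have cI: "connected I" by (simp add: I_def)
  have hb: "\<sigma>0 - \<rho> < \<sigma>h \<tau>" "\<sigma>h \<tau> < \<sigma>0 + \<rho>" if "\<tau> \<in> I" for \<tau> using I(3)[OF that] by auto
  have cR2: "connected R2"
    unfolding R2_def using connected_above_graph[OF chI cI hb(2)] connected_below_graph[OF chI cI hb(1)] by auto
  have R2Bx: "R2 \<subseteq> Bx"
  proof
    fix z assume z: "z \<in> R2"
    then have "snd z \<in> I" by (auto simp: R2_def split: if_splits)
    then show "z \<in> Bx" using z hb[of "snd z"] by (auto simp: R2_def Bx_def mem_Times_iff split: if_splits)
  qed
  have R2\<gamma>: "P z \<notin> \<gamma>" if "z \<in> R2" for z
    using graph[of z] that R2Bx by (auto simp: R2_def split: if_splits)
  have R1: "fst z \<in> open_segment 0 (\<sigma>h (snd z))" if "z \<in> Bx" "z \<notin> R2" "fst z \<noteq> \<sigma>h (snd z)" for z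
  proof -
    have z: "snd z \<in> I" "\<sigma>0 - \<rho> < fst z" "fst z < \<sigma>0 + \<rho>" using that(1) by (auto simp: Bx_def)
    show ?thesis
      using z that(2,3) hb[OF z(1)] \<rho>(3) by (auto simp: R2_def open_segment_eq_real_ivl split: if_splits)
  qed
  \<comment> \<open>Before the hit the curve has velocity \<open>Nperp\<close> of
    \<open>\<theta>\<close> and also of \<open>\<Theta>\<close>. This identifies cosines and sines,
    whereas the angles may differ by a multiple of 2 pi.\<close>
  have PR1: "P z \<in> S" "Nvec (\<theta> (P z)) = (cos (\<Theta> z), sin (\<Theta> z))"
    if z: "z \<in> Bx" "fst z \<in> open_segment 0 (\<sigma>h (snd z))" for z
  proof -
    obtain \<sigma> \<tau> where st: "z = (\<sigma>, \<tau>)" by force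
    have \<tau>: "\<tau> \<in> {a<..<b}" using z I(2) by (auto simp: Bx_def st)
    have h: "P (\<sigma>, \<tau>) \<in> S" "((\<lambda>r. P (r, \<tau>)) has_vector_derivative Nperp (\<theta> (P (\<sigma>, \<tau>)))) (at \<sigma>)"
      using hit \<tau> z(2) by (auto simp: st)
    show "P z \<in> S" using h by (simp add: st)
    have "(\<sigma>, \<tau>) \<in> D" using z(1) BxA AW st by blast
    then have "Nperp (\<theta> (P (\<sigma>, \<tau>))) = Nperp (\<Theta> (\<sigma>, \<tau>))"
      using vector_derivative_unique_at[OF h(2) dP] by blast
    then show "Nvec (\<theta> (P z)) = (cos (\<Theta> z), sin (\<Theta> z))" by (simp add: Nvec_def Nperp_def st)
  qed
  have "P ` R2 \<subseteq> S \<union> S'"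
    using R2\<gamma> R2Bx BxG dv(8) by (fastforce simp: \<gamma>_def)
  moreover have "connected (P ` R2)"
    by (rule connected_continuous_image[OF continuous_on_subset[OF cP] cR2]) (use R2Bx BxA in blast)
  ultimately have "P ` R2 \<subseteq> S \<or> P ` R2 \<subseteq> S'"
    by (intro connected_in_one_side dv)
  \<comment> \<open>A point of \<open>S'\<close> in the chart is neither before the hit, where
    \<open>P\<close> maps to \<open>S\<close>, nor on the graph, so it comes from
    \<open>R2\<close>.\<close>
  moreover have "O' \<inter> S' \<noteq> {}" using closure_meets_open[OF _ O'(1,2)] dv by blast
  then obtain w where w: "w \<in> Bx" "P w \<in> S'" unfolding O'_def by blast
  then have "w \<in> R2" using R1[of w] PR1(1)[of w] graph'[of w] S\<gamma> dv(7) by blast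
  ultimately have R2S': "P ` R2 \<subseteq> S'" using w dv(7) by blast
  define u where "u y = cos (\<Theta> (Q y))" for y
  define v where "v y = sin (\<Theta> (Q y))" for y
  have QO': "(fst (Q y), snd (Q y)) \<in> A1" if y: "y \<in> O'" for y
  proof -
    obtain w where w: "w \<in> Bx" "y = P w" using y unfolding O'_def by blast
    then have "Q y = w" using QP BxA by blast
    then show ?thesis using w(1) BxA1 by auto
  qed
  have "C1_on u O'"
    using C1_on_compose[OF A1(4) C1_on_subset[OF Q(6) O'B] C1_on_subset[OF Q(7) O'B] QO'] by (simp add: u_def[abs_def])
  then obtain ux uy where u: "\<forall>z\<in>O'. has_grad u (ux z) (uy z) z" "continuous_on O' ux" "continuous_on O' uy"
    using C1_onE by blast
  have "C1_on v O'"
    using C1_on_compose[OF A1(5) C1_on_subset[OF Q(6) O'B] C1_on_subset[OF Q(7) O'B] QO'] by (simp add: v_def[abs_def])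
  then obtain vx vy where v: "\<forall>z\<in>O'. has_grad v (vx z) (vy z) z" "continuous_on O' vx" "continuous_on O' vy"
    using C1_onE by blast
  have uv1: "(u z)\<^sup>2 + (v z)\<^sup>2 = 1" for z by (simp add: u_def v_def)
  have divH: "ux z + vy z = H z" if z: "z \<in> O'" for z
  proof (rule characteristic_field_divergence[OF Q(1,4,5) dPA d\<Theta>A])
    show "has_grad (\<lambda>y. cos (\<Theta> (Q y))) (ux z) (uy z) z" "has_grad (\<lambda>y. sin (\<Theta> (Q y))) (vx z) (vy z) z"
      using u(1) v(1) z unfolding u_def[abs_def] v_def[abs_def] by blast+
    show "z \<in> B" using z O'B by blast
  qed
  have N: "Nvec (\<theta> z) = (u z, v z)" if z: "z \<in> O' \<inter> S" for z
  proof -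
    obtain w where w: "w \<in> Bx" "z = P w" using z unfolding O'_def by blast
    have "w \<notin> R2" using R2S' w z dv(7) by blast
    moreover have "fst w \<noteq> \<sigma>h (snd w)" using graph'[OF w(1)] w z S\<gamma> by blast
    ultimately have "fst w \<in> open_segment 0 (\<sigma>h (snd w))" using R1[OF w(1)] by blast
    from PR1(2)[OF w(1) this] show ?thesis
      using QP[of w] w BxA by (auto simp: u_def v_def)
  qed
  \<comment> \<open>A differentiable map of the plane sends the null graph of hitting times to a
    null set, and that set covers the crack in \<open>O'\<close>.\<close>
  have neg: "negligible (\<gamma> \<inter> O')"
  proof -
    define \<Gamma> where "\<Gamma> = (\<lambda>t. (\<sigma>h t, t)) ` {\<tau>0 - \<epsilon>..\<tau>0 + \<epsilon>}"
    have "negligible \<Gamma>" unfolding \<Gamma>_def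
      using II1 I1(1) by (intro negligible_graph continuous_on_subset[OF \<sigma>h]) blast
    moreover have "P differentiable_on \<Gamma>"
    proof -
      have "\<Gamma> \<subseteq> W" using II1 I1(2) A1(3) AW(1) by (auto simp: \<Gamma>_def)
      have "P differentiable (at w)" if w: "w \<in> \<Gamma>" for w
      proof -
        have "w \<in> W" using \<open>\<Gamma> \<subseteq> W\<close> w by blast
        from has_derivative_pair_grad[OF bspec[OF ga(1) this] bspec[OF gb(1) this]] show ?thesis by (rule differentiableI)
      qed
      then show ?thesis by (simp add: differentiable_at_imp_differentiable_on)
    qed
    ultimately have "negligible (P ` \<Gamma>)" by (intro negligible_differentiable_image_negligible) auto
    moreover have "\<gamma> \<inter> O' \<subseteq> P ` \<Gamma>"
    proof
      fix y assume "y \<in> \<gamma> \<inter> O'"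
      then obtain w where w: "w \<in> Bx" "y = P w" "P w \<in> \<gamma>" unfolding O'_def by blast
      have "w = (\<sigma>h (snd w), snd w)" using graph[OF w(1,3)] by (simp add: prod_eq_iff)
      moreover have "snd w \<in> {\<tau>0 - \<epsilon>..\<tau>0 + \<epsilon>}" using w(1) by (auto simp: Bx_def I_def)
      ultimately have "w \<in> \<Gamma>" unfolding \<Gamma>_def by (rule image_eqI)
      then show "y \<in> P ` \<Gamma>" unfolding w(2) by (rule imageI)
    qed
    ultimately show ?thesis using negligible_subset by blast
  qed
  \<comment> \<open>Seed curve, flow and hitting time are kept; only the base parameter moves to
    \<open>\<tau>q\<close>.\<close>
  have nd': "nondegenerate_side \<Omega> H \<theta> S \<gamma> q" if q: "q \<in> \<gamma> \<inter> O'" for q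
  proof -
    obtain w where w: "w \<in> Bx" "q = P w" "P w \<in> \<gamma>" using q unfolding O'_def by blast
    define \<tau>q where "\<tau>q = snd w"
    have wq: "w = (\<sigma>h \<tau>q, \<tau>q)" using graph[OF w(1,3)] by (simp add: prod_eq_iff \<tau>q_def)
    have \<tau>q: "\<tau>q \<in> {a<..<b}" using w(1) I(2) by (auto simp: Bx_def \<tau>q_def)
    have wW: "(\<sigma>h \<tau>q, \<tau>q) \<in> W1" using w(1) BxA Q(3) wq by blast
    then have jq: "jacobian_det P (\<sigma>h \<tau>q, \<tau>q) \<noteq> 0" using jac\<Delta> by (auto simp: W1_def)
    have Wq: "\<exists>W. open W \<and> (\<sigma>h \<tau>q, \<tau>q) \<in> W \<and> W \<subseteq> D \<and>
             C1_on (\<lambda>z. fst (P z)) W \<and> C1_on (\<lambda>z. snd (P z)) W"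
      using W wW W1(3) by blast
    have Pq: "P (\<sigma>h \<tau>q, \<tau>q) = q" using w wq by simp
    show ?thesis
      unfolding nondegenerate_side_def One_nat_def
      by (rule exI[of _ g], rule exI[of _ a], rule exI[of _ b], rule exI[of _ \<tau>q], rule exI[of _ s],
          rule exI[of _ D], rule exI[of _ P], rule exI[of _ \<Theta>], rule exI[of _ \<sigma>h], intro conjI)
         (fact \<tau>q s g D DI ode init \<sigma>h hit Pq Wq jq)+
  qed
  show thesis
    by (rule that[OF O' u(1)[rule_format] u(2) v(1)[rule_format] v(3) divH uv1 N, folded \<gamma>_def])
       (use neg nd' in auto)
qed

section \<open>Nondegenerate crack points\<close>

lemma side_limit:
  assumes "open O'" "q \<in> O'" "isCont N q" "\<And>z. z \<in> O' \<inter> S \<Longrightarrow> Nvec (\<theta> z) = N z"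
  shows "((\<lambda>z. Nvec (\<theta> z)) \<longlongrightarrow> N q) (at q within S)"
proof (rule Lim_transform_eventually)
  show "(N \<longlongrightarrow> N q) (at q within S)"
    using assms(3) unfolding isCont_def by (rule tendsto_within_subset) simp
  show "\<forall>\<^sub>F z in at q within S. N z = Nvec (\<theta> z)"
    unfolding eventually_at_topological using assms by (intro exI[of _ O']) auto
qed

text \<open>The crack condition and the nondegeneracy condition each bring their own neighbourhood
  and sides; the jump is transferred from the former to the latter. The limiting fields are named by
  the sign of \<open>F - c\<close> rather than by sides, so that the result can be compared with any
  decomposition around \<open>p\<close>.\<close>

lemma nondegenerate_crack_point_interface:
  assumes HC: "C1_on H \<Omega>" and weak: "weak_solution \<Omega> H \<theta>"
    and p: "p \<in> nondegenerate_crack_points \<Omega> K H \<theta>"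
  obtains V g a b F c e M1 M2 where "open V" "p \<in> V"
    "C1_curve_param (V \<inter> nondegenerate_crack_points \<Omega> K H \<theta>) g a b"
    "V \<inter> K = {z \<in> V. F z = c}" "e \<in> {1, -1 :: real}"
    "isCont M1 p" "isCont M2 p" "norm (M1 p) = 1" "norm (M2 p) = 1" "M1 p \<noteq> M2 p"
    "has_grad F (- e * (snd (M1 p) - snd (M2 p))) (e * (fst (M1 p) - fst (M2 p))) p"
    "\<And>z. z \<in> V \<Longrightarrow> F z > c \<Longrightarrow> Nvec (\<theta> z) = M1 z" "\<And>z. z \<in> V \<Longrightarrow> F z < c \<Longrightarrow> Nvec (\<theta> z) = M2 z"
    "\<And>G. open G \<Longrightarrow> p \<in> G \<Longrightarrow> \<exists>V0. open V0 \<and> p \<in> V0 \<and> V0 \<subseteq> V \<inter> G \<and>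
        connected {z \<in> V0. F z - c > 0} \<and> connected {z \<in> V0. F z - c < 0}"
proof -
  let ?ND = "nondegenerate_crack_points \<Omega> K H \<theta>"
  obtain U Up Um where two: "two_chars_at \<Omega> K \<theta> p U Up Um"
    and s1: "nondegenerate_side \<Omega> H \<theta> Up (U \<inter> K) p" and s2: "nondegenerate_side \<Omega> H \<theta> Um (U \<inter> K) p"
    using p by (auto simp: nondegenerate_crack_points_def nondegenerate_point_def)
  obtain U' Up' Um' Np Nm where div': "divides_at \<Omega> K p U' Up' Um'"
    and lim': "((\<lambda>q. Nvec (\<theta> q)) \<longlongrightarrow> Np) (at p within Up')" "((\<lambda>q. Nvec (\<theta> q)) \<longlongrightarrow> Nm) (at p within Um')" "Np \<noteq> Nm"
    using p by (auto simp: nondegenerate_crack_points_def crack_point_def)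
  have div: "divides_at \<Omega> K p U Up Um" using two by (simp add: two_chars_at_def)
  then have div2: "divides_at \<Omega> K p U Um Up" by (simp add: divides_at_commute)
  define \<gamma> where "\<gamma> = U \<inter> K"
  have dv: "open U" "U \<subseteq> \<Omega>" "p \<in> \<gamma>" "\<gamma> homeomorphic {0<..<1::real}" "open Up" "open Um" "Up \<inter> Um = {}"
    "U - K = Up \<union> Um" "p \<in> closure Up" "p \<in> closure Um"
    using div by (auto simp: divides_at_def \<gamma>_def frontier_def)
  obtain O1 u1 u1x u1y v1 v1x v1y where 1: "open O1" "p \<in> O1" "O1 \<subseteq> U"
    "\<And>z. z \<in> O1 \<Longrightarrow> has_grad u1 (u1x z) (u1y z) z" "continuous_on O1 u1x"
    "\<And>z. z \<in> O1 \<Longrightarrow> has_grad v1 (v1x z) (v1y z) z" "continuous_on O1 v1y"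
    "\<And>z. z \<in> O1 \<Longrightarrow> u1x z + v1y z = H z" "\<And>z. z \<in> O1 \<Longrightarrow> (u1 z)\<^sup>2 + (v1 z)\<^sup>2 = 1"
    "\<And>z. z \<in> O1 \<inter> Up \<Longrightarrow> Nvec (\<theta> z) = (u1 z, v1 z)" "negligible (U \<inter> K \<inter> O1)"
    "\<And>q. q \<in> U \<inter> K \<inter> O1 \<Longrightarrow> nondegenerate_side \<Omega> H \<theta> Up (U \<inter> K) q"
    proof (rule side_extension[OF div s1 HC], goal_cases)
      case 1
      show ?case by (rule 1(1)[OF 1(2-)])
    qed
  obtain O2 u2 u2x u2y v2 v2x v2y where 2: "open O2" "p \<in> O2" "O2 \<subseteq> U"
    "\<And>z. z \<in> O2 \<Longrightarrow> has_grad u2 (u2x z) (u2y z) z" "continuous_on O2 u2x"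
    "\<And>z. z \<in> O2 \<Longrightarrow> has_grad v2 (v2x z) (v2y z) z" "continuous_on O2 v2y"
    "\<And>z. z \<in> O2 \<Longrightarrow> u2x z + v2y z = H z" "\<And>z. z \<in> O2 \<Longrightarrow> (u2 z)\<^sup>2 + (v2 z)\<^sup>2 = 1"
    "\<And>z. z \<in> O2 \<inter> Um \<Longrightarrow> Nvec (\<theta> z) = (u2 z, v2 z)" "negligible (U \<inter> K \<inter> O2)"
    "\<And>q. q \<in> U \<inter> K \<inter> O2 \<Longrightarrow> nondegenerate_side \<Omega> H \<theta> Um (U \<inter> K) q"
    proof (rule side_extension[OF div2 s2 HC], goal_cases)
      case 1
      show ?case by (rule 1(1)[OF 1(2-)])
    qed
  define N1 where "N1 z = (u1 z, v1 z)" for z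
  define N2 where "N2 z = (u2 z, v2 z)" for z
  have cN1: "isCont N1 z" if "z \<in> O1" for z unfolding N1_def
    using has_grad_continuous[OF 1(4)[OF that]] has_grad_continuous[OF 1(6)[OF that]] by (intro continuous_intros)
  have cN2: "isCont N2 z" if "z \<in> O2" for z unfolding N2_def
    using has_grad_continuous[OF 2(4)[OF that]] has_grad_continuous[OF 2(6)[OF that]] by (intro continuous_intros)
  have l1: "((\<lambda>z. Nvec (\<theta> z)) \<longlongrightarrow> N1 q) (at q within Up)" if "q \<in> O1" for q
    by (rule side_limit[OF 1(1) that cN1[OF that]]) (use 1(10) in \<open>auto simp: N1_def\<close>)
  have l2: "((\<lambda>z. Nvec (\<theta> z)) \<longlongrightarrow> N2 q) (at q within Um)" if "q \<in> O2" for q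
    by (rule side_limit[OF 2(1) that cN2[OF that]]) (use 2(10) in \<open>auto simp: N2_def\<close>)
  \<comment> \<open>If the extensions agreed at \<open>p\<close>, the field would have one limit
    from all of \<open>U - K\<close>. The sides of the crack condition lie in that set near
    \<open>p\<close>, so their two limits would coincide.\<close>
  have ne: "N1 p \<noteq> N2 p"
  proof
    assume eq: "N1 p = N2 p"
    have lim: "n = N1 p" if A: "A \<inter> K = {}" "p \<in> closure A" and n: "((\<lambda>q. Nvec (\<theta> q)) \<longlongrightarrow> n) (at p within A)" for A n
    proof -
      have "((\<lambda>z. Nvec (\<theta> z)) \<longlongrightarrow> N1 p) (at p within Up \<union> Um)"
        using l1[OF 1(2)] l2[OF 2(2)] eq by (intro Lim_Un) auto
      then have "((\<lambda>z. Nvec (\<theta> z)) \<longlongrightarrow> N1 p) (at p within A \<inter> U)"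
        by (rule tendsto_within_subset) (use A dv in blast)
      moreover have "at p within A \<inter> U = at p within A"
        by (rule at_within_nhd[of _ U]) (use dv in \<open>auto simp: \<gamma>_def\<close>)
      ultimately have "((\<lambda>z. Nvec (\<theta> z)) \<longlongrightarrow> N1 p) (at p within A)" by simp
      moreover have "p \<notin> A" using A(1) dv(3) by (auto simp: \<gamma>_def)
      then have "at p within A \<noteq> bot"
        using A(2) by (simp add: trivial_limit_within closure_def)
      ultimately show ?thesis using n tendsto_unique by blast
    qed
    have "Up' \<inter> K = {}" "Um' \<inter> K = {}" "p \<in> closure Up'" "p \<in> closure Um'"
      using div' by (auto simp: divides_at_def frontier_def)
    then have "Np = N1 p" "Nm = N1 p" using lim lim' by blast+
    then show False using lim'(3) by simp
  qed
  \<comment> \<open>On \<open>O3\<close> the extensions differ, so the jump persists at the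
    neighbouring points of the crack.\<close>
  define O3 where "O3 = {z \<in> O1 \<inter> O2. N1 z \<noteq> N2 z}"
  have O3: "open O3" "p \<in> O3" "O3 \<subseteq> O1" "O3 \<subseteq> O2"
  proof -
    have "continuous_on (O1 \<inter> O2) (\<lambda>z. N1 z - N2 z)"
      using cN1 cN2 by (intro continuous_at_imp_continuous_on ballI continuous_intros) auto
    then have "open ((O1 \<inter> O2) \<inter> (\<lambda>z. N1 z - N2 z) -` (- {0}))"
      using 1 2 by (intro continuous_open_preimage) auto
    moreover have "(O1 \<inter> O2) \<inter> (\<lambda>z. N1 z - N2 z) -` (- {0}) = O3" by (auto simp: O3_def)
    ultimately show "open O3" by simp
  qed (use 1 2 ne in \<open>auto simp: O3_def\<close>)
  have s3: "O3 \<subseteq> \<Omega>" "O3 \<subseteq> Up \<union> Um \<union> \<gamma>" "\<gamma> \<inter> (Up \<union> Um) = {}"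
    using O3 1(3) dv unfolding \<gamma>_def by blast+
  have HO: "continuous_on O3 H" using C1_on_continuous[OF HC] s3 continuous_on_subset by blast
  have neg: "negligible (\<gamma> \<inter> O3)" by (rule negligible_subset[OF 1(11)]) (use O3 in \<open>auto simp: \<gamma>_def\<close>)
  have g1: "has_grad u1 (u1x z) (u1y z) z" "has_grad v1 (v1x z) (v1y z) z" "u1x z + v1y z = H z"
    and g2: "has_grad u2 (u2x z) (u2y z) z" "has_grad v2 (v2x z) (v2y z) z" "u2x z + v2y z = H z"
    if "z \<in> O3" for z
    using 1(4,6,8)[OF subsetD[OF O3(3) that]] 2(4,6,8)[OF subsetD[OF O3(4) that]] .
  note c1 = continuous_on_subset[OF _ O3(3)] and c2 = continuous_on_subset[OF _ O3(4)]
  have n1: "Nvec (\<theta> z) = (u1 z, v1 z)" if "z \<in> O3 \<inter> Up" for z using 1(10) that O3 by blast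
  have n2: "Nvec (\<theta> z) = (u2 z, v2 z)" if "z \<in> O3 \<inter> Um" for z using 2(10) that O3 by blast
  obtain V g a b F c e where V: "open V" "p \<in> V" "V \<subseteq> O3" "C1_curve_param (\<gamma> \<inter> V) g a b"
    "\<And>z. z \<in> V \<Longrightarrow> has_grad F (- (v1 z - v2 z)) (u1 z - u2 z) z"
    "\<gamma> \<inter> V = {z \<in> V. F z = c}" "e \<in> {1, -1 :: real}"
    "Up \<inter> V = {z \<in> V. e * (F z - c) > 0}" "Um \<inter> V = {z \<in> V. e * (F z - c) < 0}"
    "\<And>G. open G \<Longrightarrow> p \<in> G \<Longrightarrow> \<exists>V0. open V0 \<and> p \<in> V0 \<and> V0 \<subseteq> V \<inter> G \<and>
        connected {z \<in> V0. F z - c > 0} \<and> connected {z \<in> V0. F z - c < 0}"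
    proof ((rule interface_is_C1_curve[OF weak O3(1) s3(1) O3(2) HO dv(5-7) s3(2,3) dv(3,9,10,4) neg
       g1(1) c1[OF 1(5)] g1(2) g2(1) c2[OF 2(5)] g2(2) c2[OF 2(7)]
       g1(3) g2(3) n1 n2 ne[unfolded N1_def N2_def]]; assumption?), goal_cases)
      case 1
      show ?case by (rule 1(1)[OF 1(2-)])
    qed
  have VU: "V \<subseteq> U" using V(3) O3(3) 1(3) by blast
  have VK: "V \<inter> K = \<gamma> \<inter> V" using VU by (auto simp: \<gamma>_def)
  \<comment> \<open>Each point of the crack in \<open>V\<close> satisfies both conditions with the
    same \<open>U\<close>, \<open>Up\<close> and \<open>Um\<close>, so the regular curve found is
    locally the whole set of nondegenerate crack points.\<close>
  have "q \<in> ?ND" if q: "q \<in> \<gamma> \<inter> V" for q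
  proof -
    have qO: "q \<in> O3" "q \<in> O1" "q \<in> O2" using q V(3) O3 by blast+
    have dq: "divides_at \<Omega> K q U Up Um" using div q by (auto simp: divides_at_def \<gamma>_def)
    have "crack_point \<Omega> K \<theta> q"
      unfolding crack_point_def
    proof (intro exI conjI)
      show "N1 q \<noteq> N2 q" using qO(1) by (simp add: O3_def)
    qed (fact dq l1[OF qO(2)] l2[OF qO(3)])+
    moreover have "two_chars_at \<Omega> K \<theta> q U Up Um" using two dq by (auto simp: two_chars_at_def)
    then have "nondegenerate_point \<Omega> K H \<theta> q"
      unfolding nondegenerate_point_def using 1(12)[of q] 2(12)[of q] q qO by (auto simp: \<gamma>_def)
    ultimately show ?thesis using q by (auto simp: nondegenerate_crack_points_def \<gamma>_def)
  qed
  then have VND: "V \<inter> ?ND = \<gamma> \<inter> V" using VK by (auto simp: nondegenerate_crack_points_def)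
  have norm1: "norm (N1 p) = 1" "norm (N2 p) = 1"
    using 1(9)[OF 1(2)] 2(9)[OF 2(2)] by (simp_all add: N1_def N2_def norm_Pair)
  have cp: "isCont N1 p" "isCont N2 p" using cN1 cN2 1 2 by auto
  have VN1: "Nvec (\<theta> z) = N1 z" if "z \<in> V" "e * (F z - c) > 0" for z
  proof -
    have "z \<in> Up \<inter> V" unfolding V(8) using that by blast
    then show ?thesis using n1[of z] V(3) by (auto simp: N1_def)
  qed
  have VN2: "Nvec (\<theta> z) = N2 z" if "z \<in> V" "e * (F z - c) < 0" for z
  proof -
    have "z \<in> Um \<inter> V" unfolding V(9) using that by blast
    then show ?thesis using n2[of z] V(3) by (auto simp: N2_def)
  qed
  have V4: "C1_curve_param (V \<inter> ?ND) g a b" and V6: "V \<inter> K = {z \<in> V. F z = c}"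
    using V(4,6) VND VK by simp_all
  show thesis
  proof (cases "e = 1")
    case True
    show thesis
      by (rule that[where e = 1, OF V(1,2) V4 V6 _ cp norm1 ne _ _ _ V(10)])
         (use V(5)[OF V(2)] VN1 VN2 True in \<open>auto simp: N1_def N2_def\<close>)
  next
    case False
    \<comment> \<open>Here \<open>Um\<close> is uphill, so the roles of \<open>N1\<close> and
      \<open>N2\<close> are exchanged; this reverses the jump, and \<open>e\<close> restores the
      gradient.\<close>
    then have e: "e = -1" using V(7) by simp
    show thesis
      by (rule that[where e = "-1", OF V(1,2) V4 V6 _ cp(2,1) norm1(2,1) ne[symmetric] _ _ _ V(10)])
         (use V(5)[OF V(2)] VN1 VN2 e in \<open>auto simp: N1_def N2_def algebra_simps\<close>)
  qed
qed

section \<open>Directions of the characteristic curves at the crack\<close>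

text \<open>The equation of the curve holds only for positive times. Its velocity is the rotated
  field, which has a limit along the curve, and the mean value inequality carries this limit over to
  the derivative at 0.\<close>

lemma characteristic_one_sided_derivative:
  assumes c: "char_issuing \<theta> S q c e" and q: "q \<notin> S"
    and lim: "((\<lambda>z. Nvec (\<theta> z)) \<longlongrightarrow> n) (at q within S)"
  obtains s where "s \<in> {-1, 1 :: real}"
    "(c has_vector_derivative s *\<^sub>R (snd n, - fst n)) (at 0 within {0..<e})"
proof -
  have e: "0 < e" "c 0 = q" "continuous_on {0..<e} c" "\<And>t. t \<in> {0<..<e} \<Longrightarrow> c t \<in> S"
    using c by (auto simp: char_issuing_def)
  have "\<exists>s\<in>{-1, 1 :: real}. \<forall>t\<in>{0<..<e}. (c has_vector_derivative s *\<^sub>R Nperp (\<theta> (c t))) (at t)"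
    using c unfolding char_issuing_def by (elim conjE)
  then obtain s where s: "s \<in> {-1, 1 :: real}"
    "\<forall>t\<in>{0<..<e}. (c has_vector_derivative s *\<^sub>R Nperp (\<theta> (c t))) (at t)"
    by (rule bexE)
  define v where "v = s *\<^sub>R (snd n, - fst n)"
  have "(c \<longlongrightarrow> c 0) (at 0 within {0..<e})" using e by (auto simp: continuous_on_def)
  then have c0: "(c \<longlongrightarrow> q) (at 0 within {0<..<e})"
    unfolding e(2) by (rule tendsto_within_subset) auto
  have "filterlim c (at q within S) (at 0 within {0<..<e})"
    unfolding filterlim_at
  proof
    have inS: "c t \<in> S \<and> c t \<noteq> q" if "t \<in> {0<..<e}" for t using e(4)[OF that] q by metis
    show "\<forall>\<^sub>F t in at 0 within {0<..<e}. c t \<in> S \<and> c t \<noteq> q"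
      unfolding eventually_at_filter by (intro always_eventually allI impI inS)
  qed (rule c0)
  from filterlim_compose[OF lim this]
  have "((\<lambda>t. Nvec (\<theta> (c t))) \<longlongrightarrow> n) (at 0 within {0<..<e})" .
  then have "((\<lambda>t. s *\<^sub>R (snd (Nvec (\<theta> (c t))), - fst (Nvec (\<theta> (c t))))) \<longlongrightarrow> v) (at 0 within {0<..<e})"
    unfolding v_def by (intro tendsto_intros)
  then have l: "((\<lambda>t. s *\<^sub>R Nperp (\<theta> (c t))) \<longlongrightarrow> v) (at 0 within {0<..<e})"
    by (simp add: Nvec_def Nperp_def)
  have "(c has_derivative (\<lambda>h. h *\<^sub>R v)) (at 0 within {0..<e})"
    unfolding has_derivative_within_alt
  proof (intro conjI allI impI)
    show "bounded_linear (\<lambda>h. h *\<^sub>R v)" by (rule bounded_linear_scaleR_left)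
    fix \<epsilon> :: real assume \<epsilon>: "\<epsilon> > 0"
    obtain d where d: "d > 0" "\<And>t. t \<in> {0<..<e} \<Longrightarrow> t < d \<Longrightarrow> norm (s *\<^sub>R Nperp (\<theta> (c t)) - v) < \<epsilon>"
      using tendstoD[OF l \<epsilon>] unfolding eventually_at by (auto simp: dist_norm)
    have "norm (c y - c 0 - (y - 0) *\<^sub>R v) \<le> \<epsilon> * norm (y - 0)" if y: "y \<in> {0..<e}" "norm (y - 0) < d" for y
    proof (cases "y = 0")
      case False
      then have y0: "0 < y" "y < e" "y < d" using y by auto
      \<comment> \<open>With the linear part removed, the derivative of \<open>f\<close> is the
        deviation of the velocity from its limit, at most \<epsilon> in norm.\<close>
      define f where "f t = c t - t *\<^sub>R v" for t
      have "\<exists>x\<in>{0<..<y}. norm (f y - f 0) \<le> norm ((y - 0) *\<^sub>R (s *\<^sub>R Nperp (\<theta> (c x)) - v))"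
      proof (rule mvt_general[OF y0(1)])
        show "continuous_on {0..y} f" unfolding f_def
          using y0 by (intro continuous_intros continuous_on_subset[OF e(3)]) auto
        fix x assume "0 < x" "x < y"
        then have "(f has_vector_derivative (s *\<^sub>R Nperp (\<theta> (c x)) - v)) (at x)"
          unfolding f_def using bspec[OF s(2), of x] y0 by (auto intro!: derivative_eq_intros)
        then show "(f has_derivative (\<lambda>h. h *\<^sub>R (s *\<^sub>R Nperp (\<theta> (c x)) - v))) (at x)"
          by (simp add: has_vector_derivative_def)
      qed
      then obtain x where x: "0 < x" "x < y" "norm (f y - f 0) \<le> y * norm (s *\<^sub>R Nperp (\<theta> (c x)) - v)"
        using y0 by auto
      note x(3)
      also have "y * norm (s *\<^sub>R Nperp (\<theta> (c x)) - v) \<le> y * \<epsilon>"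
        using d(2)[of x] x y0 by (intro mult_left_mono) auto
      finally have "norm (f y - f 0) \<le> y * \<epsilon>" .
      then show ?thesis using y0 by (simp add: f_def algebra_simps)
    qed simp
    then show "\<exists>d>0. \<forall>y\<in>{0..<e}. norm (y - 0) < d \<longrightarrow> norm (c y - c 0 - (y - 0) *\<^sub>R v) \<le> \<epsilon> * norm (y - 0)"
      using d(1) by blast
  qed
  then show thesis using that[OF s(1)] by (simp add: has_vector_derivative_def v_def)
qed

lemma derivative_into_superlevel_nonneg:
  assumes F: "has_grad F a b (c 0)" and c: "(c has_vector_derivative v) (at 0 within {0..<e})" "0 < e"
    and ev: "\<forall>\<^sub>F t in at_right 0. F (c t) > F (c 0)"
  shows "fst v * a + snd v * b \<ge> 0"
proof (rule ccontr)
  assume "\<not> ?thesis"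
  then have neg: "fst v * a + snd v * b < 0" by simp
  have der: "((\<lambda>t. F (c t)) has_real_derivative (fst v * a + snd v * b)) (at 0 within {0..<e})"
    by (rule has_grad_along[OF F c(1)])
  obtain d where d: "d > 0" "\<forall>h > 0. 0 + h \<in> {0..<e} \<longrightarrow> h < d \<longrightarrow> F (c 0) > F (c (0 + h))"
    using has_real_derivative_neg_dec_right[OF der neg] by blast
  have "\<forall>\<^sub>F t in at_right (0::real). t < min d e \<and> t > 0"
    unfolding eventually_at_right_field using d(1) c(2) by (intro exI[of _ "min d e"]) auto
  with ev have "\<forall>\<^sub>F t in at_right (0::real). False"
    by eventually_elim (use d(2) in fastforce)
  then show False by simp
qed

text \<open>Entering the uphill side forces \<open>s1 = - e\<close>, and entering the downhill side
  forces \<open>s2 = - e\<close>. With equal signs the difference of the two unit directions is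
  exactly the gradient of \<open>F\<close>, to which \<open>T\<close> is orthogonal; so both have
  the same inner product with \<open>T\<close>.\<close>

lemma equal_angles_across_interface:
  fixes n1 n2 T :: plane
  assumes F: "has_grad F (- e * (snd n1 - snd n2)) (e * (fst n1 - fst n2)) p" "F p = k" and e: "e \<in> {1, -1 :: real}"
    and n: "norm n1 = 1" "norm n2 = 1" "n1 \<noteq> n2"
    and T: "fst T * (- e * (snd n1 - snd n2)) + snd T * (e * (fst n1 - fst n2)) = 0"
    and c1: "(c1 has_vector_derivative s1 *\<^sub>R (snd n1, - fst n1)) (at 0 within {0..<e1})" "0 < e1" "c1 0 = p"
      "\<forall>\<^sub>F t in at_right 0. F (c1 t) > k" "s1 \<in> {-1, 1 :: real}"
    and c2: "(c2 has_vector_derivative s2 *\<^sub>R (snd n2, - fst n2)) (at 0 within {0..<e2})" "0 < e2" "c2 0 = p"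
      "\<forall>\<^sub>F t in at_right 0. F (c2 t) < k" "s2 \<in> {-1, 1 :: real}"
  shows "vec_angle (s1 *\<^sub>R (snd n1, - fst n1)) T = vec_angle (s2 *\<^sub>R (snd n2, - fst n2)) T"
proof -
  obtain a1 b1 a2 b2 where ab: "n1 = (a1, b1)" "n2 = (a2, b2)" by (cases n1; cases n2) auto
  have u: "a1 * a1 + b1 * b1 = 1" "a2 * a2 + b2 * b2 = 1"
    using n by (simp_all add: ab norm_Pair power2_eq_square)
  define \<kappa> where "\<kappa> = a1 * a2 + b1 * b2"
  \<comment> \<open>For unit vectors, \<open>1 - \<kappa>\<close> is half the squared length of the
    jump.\<close>
  have \<kappa>: "1 - \<kappa> > 0"
  proof -
    have "(a1 - a2) * (a1 - a2) + (b1 - b2) * (b1 - b2) > 0"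
      using n(3) by (simp add: ab sum_squares_gt_zero_iff)
    moreover have "(a1 - a2) * (a1 - a2) + (b1 - b2) * (b1 - b2) = 2 * (1 - \<kappa>)"
      using u by (simp add: \<kappa>_def algebra_simps)
    ultimately show ?thesis by simp
  qed
  have "fst (s1 *\<^sub>R (snd n1, - fst n1)) * (- e * (snd n1 - snd n2)) + snd (s1 *\<^sub>R (snd n1, - fst n1)) * (e * (fst n1 - fst n2)) \<ge> 0"
    by (rule derivative_into_superlevel_nonneg[OF _ c1(1,2), of F]) (use F c1 in auto)
  moreover have "fst (s1 *\<^sub>R (snd n1, - fst n1)) * (- e * (snd n1 - snd n2)) + snd (s1 *\<^sub>R (snd n1, - fst n1)) * (e * (fst n1 - fst n2))
     = - (s1 * e) * ((a1 * a1 + b1 * b1) - \<kappa>)" by (simp add: ab \<kappa>_def algebra_simps)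
  ultimately have "(s1 * e) * (1 - \<kappa>) \<le> 0" using u by simp
  then have "s1 * e \<le> 0" using \<kappa> by (simp add: mult_le_0_iff)
  then have 1: "s1 = - e" using e c1(5) by auto
  have F': "has_grad (\<lambda>z. - F z) (e * (snd n1 - snd n2)) (- e * (fst n1 - fst n2)) p"
    using has_grad_diff[OF has_grad_const[of 0] F(1)] by simp
  have "fst (s2 *\<^sub>R (snd n2, - fst n2)) * (e * (snd n1 - snd n2)) + snd (s2 *\<^sub>R (snd n2, - fst n2)) * (- e * (fst n1 - fst n2)) \<ge> 0"
    by (rule derivative_into_superlevel_nonneg[OF _ c2(1,2), of "\<lambda>z. - F z"]) (use F F' c2 in auto)
  moreover have "fst (s2 *\<^sub>R (snd n2, - fst n2)) * (e * (snd n1 - snd n2)) + snd (s2 *\<^sub>R (snd n2, - fst n2)) * (- e * (fst n1 - fst n2))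
     = - (s2 * e) * ((a2 * a2 + b2 * b2) - \<kappa>)" by (simp add: ab \<kappa>_def algebra_simps)
  ultimately have "(s2 * e) * (1 - \<kappa>) \<le> 0" using u by simp
  then have "s2 * e \<le> 0" using \<kappa> by (simp add: mult_le_0_iff)
  then have 2: "s2 = - e" using e c2(5) by auto
  obtain t1 t2 where t: "T = (t1, t2)" by force
  have nn: "norm (s1 *\<^sub>R (snd n1, - fst n1)) = 1" "norm (s2 *\<^sub>R (snd n2, - fst n2)) = 1"
    using c1(5) c2(5) u by (auto simp: ab norm_Pair power2_eq_square add.commute)
  have "inner (s1 *\<^sub>R (snd n1, - fst n1)) T - inner (s2 *\<^sub>R (snd n2, - fst n2)) T = 0"
    using T by (simp add: 1 2 ab t algebra_simps)
  then show ?thesis unfolding vec_angle_def nn by simp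
qed

theorem mainTheorem8:
  fixes \<Omega> K :: "plane set" and \<theta> H :: "plane \<Rightarrow> real"
  assumes "open \<Omega>" and "connected \<Omega>" and "\<Omega> \<noteq> {}"
    and "K \<subseteq> \<Omega>" and "hausdorff_measure 2 K = 0"
    and "continuous_on (\<Omega> - K) \<theta>"
    and "Ck_on 1 H \<Omega>"
    and "weak_solution \<Omega> H \<theta>"
  shows
    "(\<forall>p\<in>nondegenerate_crack_points \<Omega> K H \<theta>.
        \<exists>V g a b. open V \<and> p \<in> V \<and>
          C1_curve_param (V \<inter> nondegenerate_crack_points \<Omega> K H \<theta>) g a b) \<and>
     (\<forall>p0\<in>nondegenerate_crack_points \<Omega> K H \<theta>.
        \<forall>V g a b t0 U Up Um cp ep cm em.
          open V \<and> C1_curve_param (V \<inter> nondegenerate_crack_points \<Omega> K H \<theta>) g a b \<and>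
          t0 \<in> {a<..<b} \<and> g t0 = p0 \<and>
          two_chars_at \<Omega> K \<theta> p0 U Up Um \<and>
          char_issuing \<theta> Up p0 cp ep \<and> char_issuing \<theta> Um p0 cm em \<longrightarrow>
          (\<exists>vp vm. vp \<noteq> 0 \<and> vm \<noteq> 0 \<and>
             (cp has_vector_derivative vp) (at 0 within {0..<ep}) \<and>
             (cm has_vector_derivative vm) (at 0 within {0..<em}) \<and>
             vec_angle vp (vector_derivative g (at t0)) =
             vec_angle vm (vector_derivative g (at t0))))"
proof (intro conjI ballI allI impI)
  let ?ND = "nondegenerate_crack_points \<Omega> K H \<theta>"
  have HC: "C1_on H \<Omega>" using assms(7) by simp
  fix p assume p: "p \<in> ?ND"
  show "\<exists>V g a b. open V \<and> p \<in> V \<and> C1_curve_param (V \<inter> ?ND) g a b"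
    using nondegenerate_crack_point_interface[OF HC assms(8) p] by metis
next
  let ?ND = "nondegenerate_crack_points \<Omega> K H \<theta>"
  have HC: "C1_on H \<Omega>" using assms(7) by simp
  fix p V' g a b t0 U Up Um cp ep cm em
  assume p: "p \<in> ?ND" and asm: "open V' \<and> C1_curve_param (V' \<inter> ?ND) g a b \<and>
          t0 \<in> {a<..<b} \<and> g t0 = p \<and> two_chars_at \<Omega> K \<theta> p U Up Um \<and>
          char_issuing \<theta> Up p cp ep \<and> char_issuing \<theta> Um p cm em"
  obtain V g' a' b' F c e M1 M2 where V: "open V" "p \<in> V"
    "C1_curve_param (V \<inter> ?ND) g' a' b'"
    "V \<inter> K = {z \<in> V. F z = c}" "e \<in> {1, -1 :: real}"
    "isCont M1 p" "isCont M2 p" "norm (M1 p) = 1" "norm (M2 p) = 1" "M1 p \<noteq> M2 p"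
    "has_grad F (- e * (snd (M1 p) - snd (M2 p))) (e * (fst (M1 p) - fst (M2 p))) p"
    "\<And>z. z \<in> V \<Longrightarrow> F z > c \<Longrightarrow> Nvec (\<theta> z) = M1 z" "\<And>z. z \<in> V \<Longrightarrow> F z < c \<Longrightarrow> Nvec (\<theta> z) = M2 z"
    "\<And>G. open G \<Longrightarrow> p \<in> G \<Longrightarrow> \<exists>V0. open V0 \<and> p \<in> V0 \<and> V0 \<subseteq> V \<inter> G \<and>
        connected {z \<in> V0. F z - c > 0} \<and> connected {z \<in> V0. F z - c < 0}"
    proof (rule nondegenerate_crack_point_interface[OF HC assms(8) p], goal_cases)
      case 1
      show ?case by (rule 1(1)[OF 1(2-)])
    qed
  define T where "T = vector_derivative g (at t0)"
  have t0: "t0 \<in> {a<..<b}" "g t0 = p" using asm by auto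
  have cur: "g C1_differentiable_on {a<..<b}" "g ` {a<..<b} \<subseteq> ?ND"
    using asm by (auto simp: C1_curve_param_def homeomorphism_def)
  have gT: "(g has_vector_derivative T) (at t0)"
    using cur(1) t0 unfolding T_def C1_differentiable_on_eq by (simp add: vector_derivative_works)
  have pK: "p \<in> K" using p by (simp add: nondegenerate_crack_points_def)
  have Fp: "F p = c" using V(2,4) pK by blast
  \<comment> \<open>The parametrization is arbitrary, but it runs in \<open>K\<close>, where
    \<open>F\<close> equals \<open>c\<close> near \<open>p\<close>; hence its velocity annihilates
    the gradient of \<open>F\<close>.\<close>
  have T: "fst T * (- e * (snd (M1 p) - snd (M2 p))) + snd T * (e * (fst (M1 p) - fst (M2 p))) = 0"
  proof -
    have "continuous_on {a<..<b} g" using cur(1) C1_differentiable_imp_continuous_on by blast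
    then have "open ({a<..<b} \<inter> g -` V)" using V(1) by (intro continuous_open_preimage) auto
    moreover have "t0 \<in> {a<..<b} \<inter> g -` V" using t0 V(2) by simp
    moreover have "c = F (g t)" if "t \<in> {a<..<b} \<inter> g -` V" for t
    proof -
      have "g t \<in> ?ND" using cur(2) that by blast
      then have "g t \<in> V \<inter> K" using that by (simp add: nondegenerate_crack_points_def)
      then show ?thesis unfolding V(4) by simp
    qed
    ultimately have "DERIV (\<lambda>t. F (g t)) t0 :> 0"
      by (intro has_field_derivative_transform_within_open[OF DERIV_const[of c]])
    moreover have "DERIV (\<lambda>t. F (g t)) t0 :> fst T * (- e * (snd (M1 p) - snd (M2 p))) + snd T * (e * (fst (M1 p) - fst (M2 p)))"
      by (rule has_grad_along[OF _ gT]) (use V(11) t0 in simp)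
    ultimately show ?thesis using DERIV_unique by blast
  qed
  have chars: "char_issuing \<theta> Up p cp ep" "char_issuing \<theta> Um p cm em" using asm by auto
  have div: "divides_at \<Omega> K p U Up Um" using asm by (simp add: two_chars_at_def)
  then have dv: "open U" "p \<in> U" "open Up" "open Um" "Up \<inter> Um = {}" "U - K = Up \<union> Um" "p \<in> closure Up" "p \<in> closure Um"
    by (auto simp: divides_at_def frontier_def)
  have pS: "p \<notin> Up" "p \<notin> Um" using dv(6) pK by blast+
  \<comment> \<open>\<open>Up\<close> and \<open>Um\<close> are unrelated to the sides from which
    \<open>F\<close> was built. Each half of \<open>V0\<close> is connected and off the crack, so it
    lies in one of them; as both meet \<open>V0\<close>, they coincide there with the two
    halves.\<close>
  obtain V0 where V0: "open V0" "p \<in> V0" "V0 \<subseteq> V \<inter> U" "connected {z \<in> V0. F z - c > 0}" "connected {z \<in> V0. F z - c < 0}"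
    using V(14)[OF dv(1,2)] by blast
  define A where "A = {z \<in> V0. F z - c > 0}"
  define B where "B = {z \<in> V0. F z - c < 0}"
  have V0K: "z \<in> K \<longleftrightarrow> F z = c" if "z \<in> V0" for z using V(4) V0(3) that by blast
  have AB: "A \<subseteq> Up \<union> Um" "B \<subseteq> Up \<union> Um"
    using V0K V0(3) dv(6) unfolding A_def B_def by force+
  have V0AB: "z \<in> A \<or> z \<in> B" if "z \<in> V0" "z \<in> Up \<union> Um" for z
  proof -
    have "F z \<noteq> c" using that dv(6) V0K by blast
    then show ?thesis using that by (auto simp: A_def B_def)
  qed
  have meet: "V0 \<inter> Up \<noteq> {}" "V0 \<inter> Um \<noteq> {}"
    using closure_meets_open[OF dv(7) V0(1,2)] closure_meets_open[OF dv(8) V0(1,2)] .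
  have "A \<subseteq> Up \<or> A \<subseteq> Um" "B \<subseteq> Up \<or> B \<subseteq> Um"
    by (rule connected_in_one_side[OF _ dv(3-5)]; use V0(4,5) AB in \<open>simp add: A_def B_def\<close>)+
  then have sides: "(A \<subseteq> Up \<and> B \<subseteq> Um) \<or> (A \<subseteq> Um \<and> B \<subseteq> Up)"
    using meet V0AB dv(5) by blast
  \<comment> \<open>Stated for an uphill set \<open>S1\<close> and a downhill set \<open>S2\<close>,
    so that it covers both assignments of \<open>Up\<close> and \<open>Um\<close>.\<close>
  have conclude: "\<exists>v1 v2. v1 \<noteq> 0 \<and> v2 \<noteq> 0 \<and>
        (c1 has_vector_derivative v1) (at 0 within {0..<e1}) \<and>
        (c2 has_vector_derivative v2) (at 0 within {0..<e2}) \<and> vec_angle v1 T = vec_angle v2 T"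
    if S1: "V0 \<inter> S1 \<subseteq> A" "p \<notin> S1" and S2: "V0 \<inter> S2 \<subseteq> B" "p \<notin> S2"
      and c1: "char_issuing \<theta> S1 p c1 e1" and c2: "char_issuing \<theta> S2 p c2 e2" for S1 S2 c1 c2 e1 e2
  proof -
    have "((\<lambda>z. Nvec (\<theta> z)) \<longlongrightarrow> M1 p) (at p within S1)"
      by (rule side_limit[OF V0(1,2) V(6)]) (use S1 V(12) V0(3) in \<open>force simp: A_def\<close>)
    then obtain s1 where s1: "s1 \<in> {-1, 1}" "(c1 has_vector_derivative s1 *\<^sub>R (snd (M1 p), - fst (M1 p))) (at 0 within {0..<e1})"
      using characteristic_one_sided_derivative[OF c1 S1(2)] by blast
    have "((\<lambda>z. Nvec (\<theta> z)) \<longlongrightarrow> M2 p) (at p within S2)"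
      by (rule side_limit[OF V0(1,2) V(7)]) (use S2 V(13) V0(3) in \<open>force simp: B_def\<close>)
    then obtain s2 where s2: "s2 \<in> {-1, 1}" "(c2 has_vector_derivative s2 *\<^sub>R (snd (M2 p), - fst (M2 p))) (at 0 within {0..<e2})"
      using characteristic_one_sided_derivative[OF c2 S2(2)] by blast
    have ev: "\<forall>\<^sub>F t in at_right 0. c' t \<in> V0 \<inter> S" if "char_issuing \<theta> S p c' e'" for S c' e'
    proof -
      have c': "0 < e'" "c' 0 = p" "continuous_on {0..<e'} c'" "\<And>t. t \<in> {0<..<e'} \<Longrightarrow> c' t \<in> S"
        using that by (auto simp: char_issuing_def)
      have "(c' \<longlongrightarrow> p) (at 0 within {0..<e'})" using c' by (auto simp: continuous_on_def)
      then have "(c' \<longlongrightarrow> p) (at 0 within {0<..<e'})" by (rule tendsto_within_subset) auto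
      moreover have "at 0 within {0<..<e'} = at_right 0" using c'(1)
        by (intro at_within_nhd[of _ "{..<e'}"]) auto
      ultimately have "(c' \<longlongrightarrow> p) (at_right 0)" by simp
      then have "\<forall>\<^sub>F t in at_right 0. c' t \<in> V0" using V0(1,2) by (rule topological_tendstoD)
      moreover have "\<forall>\<^sub>F t in at_right 0. t \<in> {0<..<e'}"
        using c'(1) eventually_at_right_real by blast
      ultimately show ?thesis by eventually_elim (use c' in auto)
    qed
    have e0: "0 < e1" "c1 0 = p" "0 < e2" "c2 0 = p" using c1 c2 by (auto simp: char_issuing_def)
    have "\<forall>\<^sub>F t in at_right 0. F (c1 t) > c" using ev[OF c1] by eventually_elim (use S1 in \<open>auto simp: A_def\<close>)
    moreover have "\<forall>\<^sub>F t in at_right 0. F (c2 t) < c" using ev[OF c2] by eventually_elim (use S2 in \<open>auto simp: B_def\<close>)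
    ultimately have "vec_angle (s1 *\<^sub>R (snd (M1 p), - fst (M1 p))) T = vec_angle (s2 *\<^sub>R (snd (M2 p), - fst (M2 p))) T"
      using equal_angles_across_interface[OF V(11) Fp V(5,8,9,10) T s1(2) e0(1,2) _ s1(1) s2(2) e0(3,4) _ s2(1)] by blast
    moreover have "s1 *\<^sub>R (snd (M1 p), - fst (M1 p)) \<noteq> 0" "s2 *\<^sub>R (snd (M2 p), - fst (M2 p)) \<noteq> 0"
      using s1(1) s2(1) V(8,9) by (auto simp: prod_eq_iff norm_prod_def)
    ultimately show ?thesis using s1(2) s2(2) by blast
  qed
  from sides show "\<exists>vp vm. vp \<noteq> 0 \<and> vm \<noteq> 0 \<and>
             (cp has_vector_derivative vp) (at 0 within {0..<ep}) \<and>
             (cm has_vector_derivative vm) (at 0 within {0..<em}) \<and>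
             vec_angle vp (vector_derivative g (at t0)) = vec_angle vm (vector_derivative g (at t0))"
  proof
    assume h: "A \<subseteq> Up \<and> B \<subseteq> Um"
    have "V0 \<inter> Up \<subseteq> A" "V0 \<inter> Um \<subseteq> B" using V0AB h dv(5) by blast+
    from conclude[OF this(1) pS(1) this(2) pS(2) chars] show ?thesis unfolding T_def .
  next
    assume h: "A \<subseteq> Um \<and> B \<subseteq> Up"
    have "V0 \<inter> Um \<subseteq> A" "V0 \<inter> Up \<subseteq> B" using V0AB h dv(5) by blast+
    from conclude[OF this(1) pS(2) this(2) pS(1) chars(2,1)] show ?thesis unfolding T_def by metis
  qed
qed

end
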